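(* Let $M\in\mathbb{R}$, $M\neq 0$, let $c\in\mathbb{R}\setminus\{-1,0,1\}$, let $T>2\pi\left(\frac{1}{|c|}+\frac{1}{|1-c|}+\frac{1}{|1+c|}\right)$, let $\omega_0$ be a nonempty open subset of $\mathbb{T}=\mathbb{R}/2\pi\mathbb{Z}$ and let $\omega(t)=\omega_0-ct$ for $t\in[0,T]$. Put $\mathcal{O}=\{(t,x): t\in(0,T),\ x\in\omega(t)\}$. Then for each initial data $(y^0,y^1)\in H^3_p(\mathbb{T})\times H^2_p(\mathbb{T})$ there exists a control $u\in L^2(\mathcal{O})$ verifying $$\int_{-\pi}^{\pi}\mathbf{1}_{\omega(t)}(x)u(t,x)\,dx=0,\qquad t\in(0,T),$$ such that the solution $y$ of $$\begin{cases} y_{tt}(t,x)-y_{xx}(t,x)+M\displaystyle\int_0^t y_{xx}(s,x)\,ds=\mathbf{1}_{\omega(t)}(x)u(t,x), & (t,x)\in(0,T)\times\mathbb{T},\\ y(0,x)=y^0(x),\quad y_t(0,x)=y^1(x), & x\in\mathbb{T},\end{cases}$$ satisfies $$y(T,x)=y_t(T,x)=\int_0^T y_{xx}(s,x)\,ds=0,\qquad x\in\mathbb{T}.$$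
   Context: $L^2_p(\mathbb{T})$ is the space of complex-valued square-integrable functions on $\mathbb{T}=\mathbb{R}/2\pi\mathbb{Z}$ with zero mean, and for an integer $k\ge 1$, $H^k_p(\mathbb{T})$ is the subspace of functions whose derivatives up to order $k$ are in $L^2(\mathbb{T})$ (zero-mean periodic Sobolev space), with norm $\|f\|_{H^k_p}=\left(\frac1{2\pi}\int_{-\pi}^{\pi}|D^kf|^2dx\right)^{1/2}$; $H^{-1}_p(\mathbb{T})$ is the dual of $H^1_p(\mathbb{T})$ with respect to the pivot space $L^2_p(\mathbb{T})$. For data in $H^1_p(\mathbb{T})\times L^2_p(\mathbb{T})$ and controls as in the statement, the solution is the unique weak solution $y\in C([0,T];H^1_p(\mathbb{T}))\cap C^1([0,T];L^2_p(\mathbb{T}))$ (the equation holding in the sense of distributions on $(0,T)$ with values in $H^{-1}_p(\mathbb{T})$). The function $\mathbf{1}_{\omega(t)}u$ is understood to be $u$ extended by $0$ outside $\mathcal{O}$. The integral $\int_0^T y_{xx}(s,\cdot)\,ds$ is an element of $H^{-1}_p(\mathbb{T})$. *)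

theory Defs
  imports "HOL-Analysis.Analysis"
begin

text \<open>
  The torus is the real line modulo \<open>2\<pi>\<close>: functions on it are \<open>2\<pi>\<close>-periodic functions on the
  reals, subsets of it are \<open>2\<pi>\<close>-periodic sets of reals, and integrals are taken over the
  fundamental domain \<open>[-\<pi>, \<pi>]\<close>. Elements of the function spaces are represented by functions;
  equality in the spaces is equality almost everywhere (\<open>ae_eq\<close>).
\<close>

definition periodic :: "(real \<Rightarrow> complex) \<Rightarrow> bool" where
  "periodic f \<longleftrightarrow> (\<forall>x. f (x + 2 * pi) = f x)"

definition torus_set :: "real set \<Rightarrow> bool" where
  "torus_set W \<longleftrightarrow> (\<forall>x. x + 2 * pi \<in> W \<longleftrightarrow> x \<in> W)"

definition ae_eq :: "(real \<Rightarrow> complex) \<Rightarrow> (real \<Rightarrow> complex) \<Rightarrow> bool" where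
  "ae_eq f g \<longleftrightarrow> (AE x in lebesgue. f x = g x)"


subsection \<open>Smooth functions\<close>

definition nderiv :: "nat \<Rightarrow> (real \<Rightarrow> complex) \<Rightarrow> real \<Rightarrow> complex" where
  "nderiv n f = ((\<lambda>g x. vector_derivative g (at x)) ^^ n) f"

definition smooth :: "(real \<Rightarrow> complex) \<Rightarrow> bool" where
  "smooth f \<longleftrightarrow> (\<forall>n x. nderiv n f differentiable (at x))"

text \<open>\<open>C\<^sub>c\<^sup>\<infinity>(0,T)\<close>\<close>

definition test_fun :: "real \<Rightarrow> (real \<Rightarrow> complex) \<Rightarrow> bool" where
  "test_fun T \<theta> \<longleftrightarrow> smooth \<theta> \<and> (\<exists>K. compact K \<and> K \<subseteq> {0<..<T} \<and> (\<forall>t. t \<notin> K \<longrightarrow> \<theta> t = 0))"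


subsection \<open>Lebesgue and Sobolev spaces on the torus\<close>

definition L2 :: "(real \<Rightarrow> complex) set" where
  "L2 = {f. periodic f \<and> f \<in> borel_measurable (lebesgue_on {-pi..pi}) \<and>
            integrable (lebesgue_on {-pi..pi}) (\<lambda>x. (cmod (f x))\<^sup>2)}"

definition L2p :: "(real \<Rightarrow> complex) set" where
  "L2p = {f \<in> L2. (LINT x|lebesgue_on {-pi..pi}. f x) = 0}"

definition L2_norm :: "(real \<Rightarrow> complex) \<Rightarrow> real" where
  "L2_norm f = sqrt (1 / (2 * pi) * (LINT x|lebesgue_on {-pi..pi}. (cmod (f x))\<^sup>2))"

text \<open>\<open>g\<close> is the \<open>k\<close>-th derivative of \<open>f\<close> in the sense of distributions on the torus.\<close>

definition weak_deriv :: "nat \<Rightarrow> (real \<Rightarrow> complex) \<Rightarrow> (real \<Rightarrow> complex) \<Rightarrow> bool" where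
  "weak_deriv k f g \<longleftrightarrow> (\<forall>\<phi>. smooth \<phi> \<and> periodic \<phi> \<longrightarrow>
     (LINT x|lebesgue_on {-pi..pi}. f x * nderiv k \<phi> x) =
       (-1) ^ k * (LINT x|lebesgue_on {-pi..pi}. g x * \<phi> x))"

definition Hp :: "nat \<Rightarrow> (real \<Rightarrow> complex) set" where
  "Hp k = {f \<in> L2p. \<forall>j\<le>k. \<exists>g\<in>L2. weak_deriv j f g}"

text \<open>For \<open>f \<in> Hp k\<close> this is determined up to equality almost everywhere.\<close>

definition D :: "nat \<Rightarrow> (real \<Rightarrow> complex) \<Rightarrow> real \<Rightarrow> complex" where
  "D k f = (SOME g. g \<in> L2 \<and> weak_deriv k f g)"

definition Hp_norm :: "nat \<Rightarrow> (real \<Rightarrow> complex) \<Rightarrow> real" where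
  "Hp_norm k f = L2_norm (D k f)"


subsection \<open>The dual space \<open>H\<^sup>-\<^sup>1\<close>\<close>

text \<open>
  Elements of the dual of \<open>Hp 1\<close> are represented by functionals, compared on \<open>Hp 1\<close> only.
  The pivot identification sends \<open>f \<in> L2p\<close> to the linear functional \<open>pair f\<close>. (The pairing is
  bilinear rather than sesquilinear; since \<open>Hp 1\<close> is closed under complex conjugation,
  equalities in the dual do not depend on this choice.)
\<close>

definition pair :: "(real \<Rightarrow> complex) \<Rightarrow> (real \<Rightarrow> complex) \<Rightarrow> complex" where
  "pair f \<phi> = 1 / (2 * complex_of_real pi) * (LINT x|lebesgue_on {-pi..pi}. f x * \<phi> x)"

definition eq_Hm1 ::
    "((real \<Rightarrow> complex) \<Rightarrow> complex) \<Rightarrow> ((real \<Rightarrow> complex) \<Rightarrow> complex) \<Rightarrow> bool" where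
  "eq_Hm1 F G \<longleftrightarrow> (\<forall>\<phi>\<in>Hp 1. F \<phi> = G \<phi>)"

text \<open>The second space derivative of an element of \<open>Hp 1\<close>, as an element of the dual.\<close>

definition Dxx :: "(real \<Rightarrow> complex) \<Rightarrow> (real \<Rightarrow> complex) \<Rightarrow> complex" where
  "Dxx f = (\<lambda>\<phi>. - pair (D 1 f) (D 1 \<phi>))"

text \<open>
  Integral over \<open>[a, b]\<close> of a function with values in the dual. The integral commutes with
  evaluation at \<open>\<phi>\<close>, which determines it.
\<close>

definition int_Hm1 ::
    "real \<Rightarrow> real \<Rightarrow> (real \<Rightarrow> (real \<Rightarrow> complex) \<Rightarrow> complex) \<Rightarrow> (real \<Rightarrow> complex) \<Rightarrow> complex" where
  "int_Hm1 a b F = (\<lambda>\<phi>. LINT s|lebesgue_on {a..b}. F s \<phi>)"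

text \<open>
  The dual-valued distribution on \<open>(0,T)\<close> given by a dual-valued function \<open>F\<close> of time,
  evaluated at the scalar test function \<open>\<theta>\<close>.
\<close>

definition distr_Hm1 ::
    "real \<Rightarrow> (real \<Rightarrow> (real \<Rightarrow> complex) \<Rightarrow> complex) \<Rightarrow> (real \<Rightarrow> complex) \<Rightarrow>
     (real \<Rightarrow> complex) \<Rightarrow> complex" where
  "distr_Hm1 T F \<theta> = int_Hm1 0 T (\<lambda>t \<phi>. \<theta> t * F t \<phi>)"


subsection \<open>Continuity and differentiability in time\<close>

definition C0_H1p :: "real \<Rightarrow> (real \<Rightarrow> real \<Rightarrow> complex) \<Rightarrow> bool" where
  "C0_H1p T y \<longleftrightarrow> (\<forall>t\<in>{0..T}. y t \<in> Hp 1 \<and>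
     ((\<lambda>s. Hp_norm 1 (\<lambda>x. y s x - y t x)) \<longlongrightarrow> 0) (at t within {0..T}))"

definition C0_L2p :: "real \<Rightarrow> (real \<Rightarrow> real \<Rightarrow> complex) \<Rightarrow> bool" where
  "C0_L2p T v \<longleftrightarrow> (\<forall>t\<in>{0..T}. v t \<in> L2p \<and>
     ((\<lambda>s. L2_norm (\<lambda>x. v s x - v t x)) \<longlongrightarrow> 0) (at t within {0..T}))"

text \<open>\<open>y \<in> C\<^sup>1([0,T]; L2p)\<close> with time derivative \<open>v\<close>\<close>

definition C1_L2p :: "real \<Rightarrow> (real \<Rightarrow> real \<Rightarrow> complex) \<Rightarrow> (real \<Rightarrow> real \<Rightarrow> complex) \<Rightarrow> bool" where
  "C1_L2p T y v \<longleftrightarrow> C0_L2p T y \<and> C0_L2p T v \<and> (\<forall>t\<in>{0..T}.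
     ((\<lambda>s. L2_norm (\<lambda>x. (y s x - y t x) / of_real (s - t) - v t x)) \<longlongrightarrow> 0)
       (at t within {0..T}))"


subsection \<open>The moving control and the wave equation with memory\<close>

definition moving :: "real set \<Rightarrow> real \<Rightarrow> real \<Rightarrow> real set" where
  "moving W c t = (\<lambda>x. x - c * t) ` W"

definition control_region :: "real set \<Rightarrow> real \<Rightarrow> real \<Rightarrow> (real \<times> real) set" where
  "control_region W c T = {(t, x). t \<in> {0<..<T} \<and> x \<in> moving W c t}"

text \<open>Square-integrable functions on a region in \<open>(0,T)\<close> times the torus.\<close>

definition L2_region :: "(real \<times> real) set \<Rightarrow> (real \<Rightarrow> real \<Rightarrow> complex) set" where
  "L2_region Q = {u. (\<forall>(t, x)\<in>Q. u t (x + 2 * pi) = u t x) \<and>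
     (\<lambda>(t, x). u t x) \<in> borel_measurable (lebesgue_on (Q \<inter> UNIV \<times> {-pi..pi})) \<and>
     integrable (lebesgue_on (Q \<inter> UNIV \<times> {-pi..pi})) (\<lambda>(t, x). (cmod (u t x))\<^sup>2)}"

definition extend0 ::
    "(real \<Rightarrow> real set) \<Rightarrow> (real \<Rightarrow> real \<Rightarrow> complex) \<Rightarrow> real \<Rightarrow> real \<Rightarrow> complex" where
  "extend0 w u = (\<lambda>t x. indicator (w t) x * u t x)"

text \<open>
  \<open>y\<close>, with time derivative \<open>v\<close>, is the weak solution with right-hand side \<open>f\<close>. The first term
  of the equation is the second distributional time derivative of \<open>y\<close>.
\<close>

definition weak_solution ::
    "real \<Rightarrow> real \<Rightarrow> (real \<Rightarrow> real \<Rightarrow> complex) \<Rightarrow> (real \<Rightarrow> complex) \<Rightarrow> (real \<Rightarrow> complex) \<Rightarrow>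
     (real \<Rightarrow> real \<Rightarrow> complex) \<Rightarrow> (real \<Rightarrow> real \<Rightarrow> complex) \<Rightarrow> bool" where
  "weak_solution M T f y0 y1 y v \<longleftrightarrow>
     C0_H1p T y \<and> C1_L2p T y v \<and>
     (\<forall>\<theta>. test_fun T \<theta> \<longrightarrow>
        eq_Hm1
          (\<lambda>\<phi>. distr_Hm1 T (\<lambda>t. pair (y t)) (nderiv 2 \<theta>) \<phi>
             - distr_Hm1 T (\<lambda>t. Dxx (y t)) \<theta> \<phi>
             + of_real M * distr_Hm1 T (\<lambda>t. int_Hm1 0 t (\<lambda>s. Dxx (y s))) \<theta> \<phi>)
          (distr_Hm1 T (\<lambda>t. pair (f t)) \<theta>)) \<and>
     ae_eq (y 0) y0 \<and> ae_eq (v 0) y1"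

end

theory Submission
  imports Defs "HOL-Computational_Algebra.Polynomial"
begin

text \<open>
  The primitive \<open>z = \<integral> y\<close> satisfies a local third-order equation. Putting
  \<open>h = z\<^sub>t\<^sub>t - z\<^sub>x\<^sub>x + M z\<^sub>t + M\<^sup>2 z\<close>, this equation reads \<open>h\<^sub>t - M h + M\<^sup>3 z = u\<close>, and the components
  \<open>z\<^sub>t \<plusminus> z\<^sub>x\<close>, \<open>z\<close>, \<open>h\<close> solve a linear transport system with the speeds \<open>\<plusminus>1\<close> and \<open>0\<close>. As
  \<open>c\<close> avoids \<open>-1, 0, 1\<close>, no characteristic is parallel to the line \<open>x + c t = const\<close>, so
  \<open>\<xi> = x + c t\<close> can serve as the evolution variable instead of \<open>t\<close>.

  Multiply the uncontrolled solution by a cutoff in time, and remove the source this produces by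
  solving the system in the variable \<open>\<xi>\<close> with zero data on a line inside the control region. The
  correction spreads in \<open>t\<close> by at most the crossing times \<open>2\<pi>/|c|\<close>, \<open>2\<pi>/|1-c|\<close>, \<open>2\<pi>/|1+c|\<close> while \<open>\<xi>\<close>
  runs once around the torus; as \<open>T\<close> is larger, it vanishes near \<open>t = 0\<close> and \<open>t = T\<close>. The result
  lives on a strip slightly wider than one period. A cutoff in \<open>\<xi>\<close> and summation over all
  translates make it periodic, at the cost of a source supported in the moving set: this source is
  the control. Its mean is removed by subtracting from \<open>z\<close> its mean times a bump in \<open>\<xi>\<close>.

  The \<open>H\<^sup>3 \<times> H\<^sup>2\<close> data have \<open>C\<^sup>1\<close> representatives, so all of this is classical. A weak solution is
  unique since each of its Fourier coefficients solves a linear ordinary differential equation.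
\<close>

subsection \<open>Continuously differentiable functions of two variables\<close>

text \<open>With y = z_t the equation reads z_ttt - z_txx + M z_xx = u with z(0) = 0. In h_t - M h +
  M^3 z the leftover terms M z_tt and M^2 z_t cancel, which fixes the coefficients M and M^2 in h:
  the result is exactly this left-hand side, and the first-order system is coupled only in order
  zero.

  Working with z merges the three final conditions into one: if z vanishes near t = T, so do y, y_t
  and z_xx, and the last is the integral of y_xx.

  The obstacle that shapes the proof is regularity. The components of the system are only C^1, so z
  has no third derivatives to work with, and the equation has to be read through h, which is C^1
  although it is formed from second derivatives of z. Every cutoff and the correction of the mean
  are arranged so that this survives.

  One turn of the variable x + c t moves a characteristic of speed s by 2 pi/(c + s) in time,
  forwards or backwards according to the sign of c + s. Bounding the spread by the sum over the
  three families gives the constant in the hypothesis on T; its strictness pays for the width of the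
  time cutoff and for the overlap of the strip.\<close>

definition C1 ::
    "(real \<times> real \<Rightarrow> complex) \<Rightarrow> (real \<times> real \<Rightarrow> complex) \<Rightarrow> (real \<times> real \<Rightarrow> complex) \<Rightarrow> bool"
  where "C1 F Ft Fx \<longleftrightarrow>
    (\<forall>X. (F has_derivative (\<lambda>h. fst h *\<^sub>R Ft X + snd h *\<^sub>R Fx X)) (at X)) \<and>
    continuous_on UNIV Ft \<and> continuous_on UNIV Fx"

lemma C1_cong:
  assumes "C1 F Ft Fx" "\<And>X. F X = G X" "\<And>X. Ft X = Gt X" "\<And>X. Fx X = Gx X"
  shows "C1 G Gt Gx"
proof -
  have "F = G" "Ft = Gt" "Fx = Gx" using assms by auto
  then show ?thesis using assms(1) by simp
qed

lemma C1_continuous: "C1 F Ft Fx \<Longrightarrow> continuous_on UNIV F"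
  unfolding C1_def by (meson continuous_at_imp_continuous_on has_derivative_continuous)

lemma C1_continuous_partials:
  "C1 F Ft Fx \<Longrightarrow> continuous_on UNIV Ft" "C1 F Ft Fx \<Longrightarrow> continuous_on UNIV Fx"
  by (auto simp: C1_def)

lemma continuous_on_slice:
  fixes F :: "real \<times> real \<Rightarrow> complex"
  assumes "continuous_on UNIV F"
  shows "continuous_on S (\<lambda>t. F (t, x))" "continuous_on S (\<lambda>x. F (t, x))"
  by (rule continuous_on_compose2[OF assms]; auto intro!: continuous_intros)+

lemma C1_partial_fst: "C1 F Ft Fx \<Longrightarrow> ((\<lambda>t. F (t, x)) has_vector_derivative Ft (t, x)) (at t within S)"
proof -
  assume "C1 F Ft Fx"
  then have *: "(F has_derivative (\<lambda>h. fst h *\<^sub>R Ft (t, x) + snd h *\<^sub>R Fx (t, x))) (at (t, x))"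
    by (simp add: C1_def)
  have "((\<lambda>t. (t, x)) has_derivative (\<lambda>h. (h, 0))) (at t within S)"
    by (auto intro!: derivative_eq_intros)
  from has_derivative_compose[OF this *]
  show ?thesis by (simp add: has_vector_derivative_def)
qed

lemma C1_partial_snd: "C1 F Ft Fx \<Longrightarrow> ((\<lambda>x. F (t, x)) has_vector_derivative Fx (t, x)) (at x within S)"
proof -
  assume "C1 F Ft Fx"
  then have *: "(F has_derivative (\<lambda>h. fst h *\<^sub>R Ft (t, x) + snd h *\<^sub>R Fx (t, x))) (at (t, x))"
    by (simp add: C1_def)
  have "((\<lambda>x. (t, x)) has_derivative (\<lambda>h. (0, h))) (at x within S)"
    by (auto intro!: derivative_eq_intros)
  from has_derivative_compose[OF this *]
  show ?thesis by (simp add: has_vector_derivative_def)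
qed

text \<open>Derivatives depend only on the values near a point, so agreement on an open set is
  enough. A vanishing or a coincidence that is known only in a region can thus be differentiated
  there.\<close>

lemma C1_unique:
  assumes "C1 F Ft Fx" "C1 G Gt Gx" "open U" "X \<in> U" "\<And>Y. Y \<in> U \<Longrightarrow> F Y = G Y"
  shows "Ft X = Gt X" "Fx X = Gx X"
proof -
  have "(F has_derivative (\<lambda>h. fst h *\<^sub>R Ft X + snd h *\<^sub>R Fx X)) (at X)"
       and G: "(G has_derivative (\<lambda>h. fst h *\<^sub>R Gt X + snd h *\<^sub>R Gx X)) (at X)"
    using assms(1,2) unfolding C1_def by blast+
  from this(1) have "(G has_derivative (\<lambda>h. fst h *\<^sub>R Ft X + snd h *\<^sub>R Fx X)) (at X)"
    by (rule has_derivative_transform_within_open[OF _ assms(3,4)]) (auto simp: assms(5))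
  from has_derivative_unique[OF this G]
  have *: "(\<lambda>h. fst h *\<^sub>R Ft X + snd h *\<^sub>R Fx X) = (\<lambda>h. fst h *\<^sub>R Gt X + snd h *\<^sub>R Gx X)" .
  show "Ft X = Gt X" using fun_cong[OF *, of "(1, 0)"] by simp
  show "Fx X = Gx X" using fun_cong[OF *, of "(0, 1)"] by simp
qed

lemma C1_const: "C1 (\<lambda>_. k) (\<lambda>_. 0) (\<lambda>_. 0)"
  unfolding C1_def by (auto intro!: derivative_eq_intros)

lemma C1_add: "C1 F Ft Fx \<Longrightarrow> C1 G Gt Gx \<Longrightarrow>
    C1 (\<lambda>X. F X + G X) (\<lambda>X. Ft X + Gt X) (\<lambda>X. Fx X + Gx X)"
  unfolding C1_def
  by (auto intro!: continuous_intros derivative_eq_intros simp: algebra_simps)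

lemma C1_mult: "C1 F Ft Fx \<Longrightarrow> C1 G Gt Gx \<Longrightarrow>
    C1 (\<lambda>X. F X * G X) (\<lambda>X. Ft X * G X + F X * Gt X) (\<lambda>X. Fx X * G X + F X * Gx X)"
  using C1_continuous[of F Ft Fx] C1_continuous[of G Gt Gx]
  unfolding C1_def
  by (auto intro!: continuous_intros derivative_eq_intros simp: algebra_simps)

lemma C1_cmul: "C1 F Ft Fx \<Longrightarrow> C1 (\<lambda>X. k * F X) (\<lambda>X. k * Ft X) (\<lambda>X. k * Fx X)"
  using C1_mult[OF C1_const[of k], of F Ft Fx] by simp

lemma C1_diff: "C1 F Ft Fx \<Longrightarrow> C1 G Gt Gx \<Longrightarrow>
    C1 (\<lambda>X. F X - G X) (\<lambda>X. Ft X - Gt X) (\<lambda>X. Fx X - Gx X)"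
  using C1_add[OF _ C1_cmul[of G Gt Gx "-1"], of F Ft Fx] by simp

lemma C1_sum:
  "(\<And>i. i \<in> I \<Longrightarrow> C1 (F i) (Ft i) (Fx i)) \<Longrightarrow>
    C1 (\<lambda>X. \<Sum>i\<in>I. F i X) (\<lambda>X. \<Sum>i\<in>I. Ft i X) (\<lambda>X. \<Sum>i\<in>I. Fx i X)"
  by (induction I rule: infinite_finite_induct) (auto intro: C1_const C1_add)

text \<open>The chain rule behind translations, behind the passage between (t, x) and the comoving
  coordinates, and behind the restriction to a slanted line.\<close>

lemma C1_affine:
  assumes "C1 F Ft Fx"
  shows "C1 (\<lambda>X. F (k * fst X + l * snd X + d, m * fst X + n * snd X + e))
     (\<lambda>X. k * Ft (k * fst X + l * snd X + d, m * fst X + n * snd X + e)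
        + m * Fx (k * fst X + l * snd X + d, m * fst X + n * snd X + e))
     (\<lambda>X. l * Ft (k * fst X + l * snd X + d, m * fst X + n * snd X + e)
        + n * Fx (k * fst X + l * snd X + d, m * fst X + n * snd X + e))"
proof -
  let ?A = "\<lambda>X::real \<times> real. (k * fst X + l * snd X + d, m * fst X + n * snd X + e)"
  have A: "(?A has_derivative (\<lambda>h. (k * fst h + l * snd h, m * fst h + n * snd h))) (at X)" for X
    by (auto intro!: derivative_eq_intros)
  have "((\<lambda>X. F (?A X)) has_derivative
     (\<lambda>h. (k * fst h + l * snd h) *\<^sub>R Ft (?A X) + (m * fst h + n * snd h) *\<^sub>R Fx (?A X))) (at X)" for X
    using has_derivative_compose[OF A, of F] assms unfolding C1_def by fastforce
  then have "((\<lambda>X. F (?A X)) has_derivative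
     (\<lambda>h. fst h *\<^sub>R (k * Ft (?A X) + m * Fx (?A X)) + snd h *\<^sub>R (l * Ft (?A X) + n * Fx (?A X)))) (at X)" for X
    by (rule has_derivative_eq_rhs) (auto simp: algebra_simps scaleR_conv_of_real)
  moreover have "continuous_on UNIV (\<lambda>X. Ft (?A X))" "continuous_on UNIV (\<lambda>X. Fx (?A X))"
    using assms unfolding C1_def
    by (auto intro!: continuous_on_compose2[of UNIV Ft] continuous_on_compose2[of UNIV Fx] continuous_intros)
  ultimately show ?thesis
    unfolding C1_def by (auto intro!: continuous_intros)
qed

lemma C1_plane_wave:
  assumes "\<And>x. (g has_vector_derivative g' x) (at x)" "continuous_on UNIV g'"
  shows "C1 (\<lambda>X. g (k * fst X + l * snd X + d))
    (\<lambda>X. k * g' (k * fst X + l * snd X + d)) (\<lambda>X. l * g' (k * fst X + l * snd X + d))"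
proof -
  have "C1 (\<lambda>X. g (fst X)) (\<lambda>X. g' (fst X)) (\<lambda>_. 0)"
    unfolding C1_def
  proof (intro conjI allI)
    fix X :: "real \<times> real"
    show "((\<lambda>X. g (fst X)) has_derivative (\<lambda>h. fst h *\<^sub>R g' (fst X) + snd h *\<^sub>R 0)) (at X)"
      using has_derivative_compose[OF has_derivative_fst[OF has_derivative_ident, of "at X"], where g = g and
          g' = "\<lambda>x. x *\<^sub>R g' (fst X)"]
        assms(1)[of "fst X"] unfolding has_vector_derivative_def by simp
  qed (auto intro!: continuous_on_compose2[OF assms(2)] continuous_intros)
  from C1_affine[OF this, of k l d 0 0 0] show ?thesis by simp
qed

section \<open>Integration along characteristics\<close>

text \<open>Rescaling the integral from 0 to s to the fixed interval [0, 1] gives one formula for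
  both signs of s, whereas the integral over \<open>{0..s}\<close> is zero for negative s.\<close>

lemma has_vector_derivative_integral_scaled:
  fixes H :: "real \<Rightarrow> 'a::banach"
  assumes "continuous_on UNIV H"
  shows "((\<lambda>s. s *\<^sub>R integral {0..1} (\<lambda>\<tau>. H (s * \<tau>))) has_vector_derivative H s) (at s)"
proof -
  \<comment> \<open>The margin 1 keeps s in the interior of the interval, so the derivative within
    it is a full derivative.\<close>
  define N where "N = \<bar>s\<bar> + 1"
  have "continuous_on {-N..N} H" using assms by (rule continuous_on_subset) auto
  from antiderivative_continuous[OF this] obtain K where
    K: "\<And>x. x \<in> {-N..N} \<Longrightarrow> (K has_vector_derivative H x) (at x within {-N..N})" by blast
  have eq: "s' *\<^sub>R integral {0..1} (\<lambda>\<tau>. H (s' * \<tau>)) = K s' - K 0" if "s' \<in> {-N..N}" for s'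
  proof -
    have mem: "s' * \<tau> \<in> {-N..N}" if "\<tau> \<in> {0..1}" for \<tau>
    proof -
      have "\<bar>s' * \<tau>\<bar> \<le> N * 1"
        unfolding abs_mult using that \<open>s' \<in> {-N..N}\<close> by (intro mult_mono) auto
      then show ?thesis by auto
    qed
    have "((\<lambda>\<tau>. s' *\<^sub>R H (s' * \<tau>)) has_integral (K (s' * 1) - K (s' * 0))) {0..1}"
    proof (rule fundamental_theorem_of_calculus)
      fix \<tau> :: real assume \<tau>: "\<tau> \<in> {0..1}"
      have d: "((\<lambda>\<tau>. s' * \<tau>) has_vector_derivative s') (at \<tau> within {0..1})"
        by (auto intro!: derivative_eq_intros)
      have "(K has_vector_derivative H (s' * \<tau>)) (at (s' * \<tau>) within (\<lambda>\<tau>. s' * \<tau>) ` {0..1})"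
        by (rule has_vector_derivative_within_subset[OF K]) (use mem \<tau> in auto)
      from vector_diff_chain_within[OF d this]
      show "((\<lambda>\<tau>. K (s' * \<tau>)) has_vector_derivative s' *\<^sub>R H (s' * \<tau>)) (at \<tau> within {0..1})"
        by (simp add: o_def)
    qed auto
    from integral_unique[OF this] show ?thesis by simp
  qed
  have "(K has_vector_derivative H s) (at s within {-N..N})" by (rule K) (auto simp: N_def)
  moreover have "at s within {-N..N} = at s"
    by (rule at_within_interior) (auto simp: N_def)
  ultimately have "((\<lambda>s'. K s' - K 0) has_vector_derivative H s) (at s)"
    by (auto intro!: derivative_eq_intros)
  then show ?thesis
  proof (rule has_vector_derivative_transform_within_open[of _ _ _ "{-N<..<N}"])
    show "s \<in> {-N<..<N}" by (auto simp: N_def)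
  qed (auto simp: eq)
qed

lemma C1_from_partials:
  assumes s: "\<And>s r. ((\<lambda>s. F (s, r)) has_vector_derivative Fs (s, r)) (at s)"
    and r: "\<And>s r. ((\<lambda>r. F (s, r)) has_vector_derivative Fr (s, r)) (at r)"
    and c: "continuous_on UNIV Fs" "continuous_on UNIV Fr"
  shows "C1 F Fs Fr"
  unfolding C1_def
proof (intro conjI allI c)
  fix X :: "real \<times> real"
  obtain x y where X: "X = (x, y)" by (cases X)
  have "((\<lambda>(x, y). F (x, y)) has_derivative
      (\<lambda>(tx, ty). tx *\<^sub>R Fs (x, y) + blinfun_scaleR_left (Fr (x, y)) ty)) (at (x, y) within UNIV \<times> UNIV)"
  proof (rule has_derivative_partialsI)
    show "((\<lambda>x. F (x, y)) has_derivative (\<lambda>tx. tx *\<^sub>R Fs (x, y))) (at x within UNIV)"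
      using s by (simp add: has_vector_derivative_def)
    show "\<And>x y. ((\<lambda>y. F (x, y)) has_derivative blinfun_apply (blinfun_scaleR_left (Fr (x, y)))) (at y within UNIV)"
      using r by (simp add: has_vector_derivative_def)
    have "continuous (at (x, y)) Fr"
      using c(2) by (simp add: continuous_on_eq_continuous_at)
    then have "continuous (at (x, y) within UNIV \<times> UNIV) Fr" by simp
    then show "continuous (at (x, y) within UNIV \<times> UNIV) (\<lambda>(x, y). blinfun_scaleR_left (Fr (x, y)))"
      unfolding split_beta prod.collapse
      by (intro bounded_linear.continuous[OF bounded_linear_blinfun_scaleR_left])
  qed auto
  then show "(F has_derivative (\<lambda>h. fst h *\<^sub>R Fs X + snd h *\<^sub>R Fr X)) (at X)"
    by (simp add: X split_beta')
qed

text \<open>Duhamel's formula for w_s + a w_r = G with w = 0 at s = 0: the integral of G along the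
  backward characteristic from X down to s = 0, with its parameter rescaled to [0, 1].\<close>

definition tint :: "real \<Rightarrow> (real \<times> real \<Rightarrow> complex) \<Rightarrow> real \<times> real \<Rightarrow> complex" where
  "tint a G X = fst X *\<^sub>R integral {0..1} (\<lambda>\<tau>. G (fst X * \<tau>, snd X - a * fst X * (1 - \<tau>)))"

lemma continuous_on_tint_integrand:
  fixes G :: "real \<times> real \<Rightarrow> complex"
  assumes "continuous_on UNIV G"
  shows "continuous_on S (\<lambda>\<tau>. G (s * \<tau>, r - a * s * (1 - \<tau>)))"
  by (rule continuous_on_compose2[OF assms]) (auto intro!: continuous_intros)

lemma continuous_on_tint:
  assumes "continuous_on UNIV G"
  shows "continuous_on UNIV (tint a G)"
proof -
  have "continuous_on (UNIV \<times> cbox 0 1)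
      (\<lambda>(X, \<tau>). G (fst X * \<tau>, snd X - a * fst X * (1 - \<tau>)))"
    unfolding split_beta
    by (rule continuous_on_compose2[OF assms]) (auto intro!: continuous_intros)
  from integral_continuous_on_param[OF this]
  have "continuous_on UNIV (\<lambda>X. integral {0..1} (\<lambda>\<tau>. G (fst X * \<tau>, snd X - a * fst X * (1 - \<tau>))))"
    by simp
  then show ?thesis unfolding tint_def by (intro continuous_intros)
qed

lemma tint_partial_snd:
  assumes "continuous_on UNIV G" "continuous_on UNIV Gr"
    and "\<And>s r. ((\<lambda>r. G (s, r)) has_vector_derivative Gr (s, r)) (at r)"
  shows "((\<lambda>r. tint a G (s, r)) has_vector_derivative tint a Gr (s, r)) (at r)"
proof -
  have "((\<lambda>r. integral (cbox 0 1) (\<lambda>\<tau>. G (s * \<tau>, r - a * s * (1 - \<tau>)))) has_vector_derivative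
      integral (cbox 0 1) (\<lambda>\<tau>. Gr (s * \<tau>, r - a * s * (1 - \<tau>)))) (at r within UNIV)"
  proof (rule leibniz_rule_vector_derivative)
    show "((\<lambda>r. G (s * \<tau>, r - a * s * (1 - \<tau>))) has_vector_derivative Gr (s * \<tau>, r - a * s * (1 - \<tau>))) (at r within UNIV)"
      for r \<tau>
    proof -
      have "((\<lambda>r. r - a * s * (1 - \<tau>)) has_vector_derivative 1) (at r)"
        by (auto intro!: derivative_eq_intros)
      from vector_diff_chain_at[OF this, of "\<lambda>r. G (s * \<tau>, r)"] assms(3)
      show ?thesis by (auto simp: o_def)
    qed
    show "(\<lambda>\<tau>. G (s * \<tau>, r - a * s * (1 - \<tau>))) integrable_on cbox 0 1" for r
      by (intro integrable_continuous continuous_on_tint_integrand assms)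
    show "continuous_on (UNIV \<times> cbox 0 1) (\<lambda>(r, \<tau>). Gr (s * \<tau>, r - a * s * (1 - \<tau>)))"
      unfolding split_beta
      by (rule continuous_on_compose2[OF assms(2)]) (auto intro!: continuous_intros)
  qed auto
  then show ?thesis unfolding tint_def by (auto intro!: derivative_eq_intros)
qed

text \<open>After the shear r + a s the characteristics are the lines r = const, and the integral is
  a plain primitive in s whose s-derivative is G itself. Hence G has to be differentiable in r
  only.\<close>

lemma C1_tint:
  assumes "continuous_on UNIV G" "continuous_on UNIV Gr"
    and "\<And>s r. ((\<lambda>r. G (s, r)) has_vector_derivative Gr (s, r)) (at r)"
  shows "C1 (tint a G) (\<lambda>X. G X - a * tint a Gr X) (tint a Gr)"
proof -
  define J where "J X = tint a G (fst X, snd X + a * fst X)" for X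
  have "C1 J (\<lambda>X. G (fst X, snd X + a * fst X)) (\<lambda>X. tint a Gr (fst X, snd X + a * fst X))"
  proof (rule C1_from_partials)
    fix s r
    have "continuous_on UNIV (\<lambda>s. G (s, r + a * s))"
      by (rule continuous_on_compose2[OF assms(1)]) (auto intro!: continuous_intros)
    from has_vector_derivative_integral_scaled[OF this, of s]
    show "((\<lambda>s. J (s, r)) has_vector_derivative G (fst (s, r), snd (s, r) + a * fst (s, r))) (at s)"
      by (simp add: J_def tint_def algebra_simps)
    have "((\<lambda>r. r + a * s) has_vector_derivative 1) (at r)"
      by (auto intro!: derivative_eq_intros)
    from vector_diff_chain_at[OF this tint_partial_snd[OF assms]]
    show "((\<lambda>r. J (s, r)) has_vector_derivative tint a Gr (fst (s, r), snd (s, r) + a * fst (s, r))) (at r)"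
      by (simp add: J_def o_def)
  next
    show "continuous_on UNIV (\<lambda>X. G (fst X, snd X + a * fst X))"
      by (rule continuous_on_compose2[OF assms(1)]) (auto intro!: continuous_intros)
    show "continuous_on UNIV (\<lambda>X. tint a Gr (fst X, snd X + a * fst X))"
      by (rule continuous_on_compose2[OF continuous_on_tint[OF assms(2)]]) (auto intro!: continuous_intros)
  qed
  from C1_affine[OF this, of 1 0 0 "-a" 1 0]
  show ?thesis by (rule C1_cong) (auto simp: J_def)
qed

subsection \<open>First-order transport systems\<close>

text \<open>Integrating \<tau>^n contributes the factor 1/(n + 1). Under iteration these factors
  build up the factorial that makes the series converge for every s.\<close>

lemma tint_norm_bound:
  assumes "continuous_on UNIV G" "\<And>\<tau>. \<tau> \<in> {0..1} \<Longrightarrow> norm (G (s * \<tau>, r - a * s * (1 - \<tau>))) \<le> k * \<tau> ^ n"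
  shows "norm (tint a G (s, r)) \<le> \<bar>s\<bar> * (k / real (Suc n))"
proof -
  have I: "((\<lambda>\<tau>. k * \<tau> ^ n) has_integral k * (1 ^ Suc n / Suc n) - k * (0 ^ Suc n / Suc n)) {0..1}"
  proof (rule fundamental_theorem_of_calculus)
    fix x :: real
    have "((\<lambda>\<tau>. k * (\<tau> ^ Suc n / Suc n)) has_real_derivative k * x ^ n) (at x within {0..1})"
      by (auto intro!: derivative_eq_intros simp del: power_Suc)
    then show "((\<lambda>\<tau>. k * (\<tau> ^ Suc n / Suc n)) has_vector_derivative k * x ^ n) (at x within {0..1})"
      by (simp add: has_real_derivative_iff_has_vector_derivative)
  qed simp
  have "norm (integral {0..1} (\<lambda>\<tau>. G (s * \<tau>, r - a * s * (1 - \<tau>)))) \<le> integral {0..1} (\<lambda>\<tau>. k * \<tau> ^ n)"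
    using assms I
    by (intro integral_norm_bound_integral integrable_continuous_real continuous_on_tint_integrand)
      (auto simp: has_integral_iff intro!: continuous_intros)
  also have "\<dots> = k / real (Suc n)" using integral_unique[OF I] by simp
  finally show ?thesis unfolding tint_def norm_scaleR fst_conv snd_conv
    by (rule mult_left_mono) simp
qed

lemma tint_add:
  assumes "continuous_on UNIV G" "continuous_on UNIV H"
  shows "tint a (\<lambda>X. G X + H X) X = tint a G X + tint a H X"
  unfolding tint_def
  by (subst integral_add) (auto intro!: integrable_continuous_real continuous_on_tint_integrand assms
      simp: scaleR_add_right)

text \<open>Terms of the Neumann series for the integral equation w = tint (B w + F): each
  application of the coupling is followed by one integration along characteristics.\<close>

fun tser ::
    "nat \<Rightarrow> (nat \<Rightarrow> real) \<Rightarrow> (nat \<Rightarrow> nat \<Rightarrow> real) \<Rightarrow> (nat \<Rightarrow> real \<times> real \<Rightarrow> complex) \<Rightarrow>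
     nat \<Rightarrow> nat \<Rightarrow> real \<times> real \<Rightarrow> complex" where
  "tser N a B F 0 i = tint (a i) (F i)"
| "tser N a B F (Suc n) i = tint (a i) (\<lambda>X. \<Sum>j<N. B i j * tser N a B F n j X)"

lemma continuous_on_tser:
  assumes "\<And>i. i < N \<Longrightarrow> continuous_on UNIV (F i)"
  shows "i < N \<Longrightarrow> continuous_on UNIV (tser N a B F n i)"
proof (induction n arbitrary: i)
  case 0
  then show ?case by (simp add: continuous_on_tint assms)
next
  case (Suc n)
  show ?case by (simp, intro continuous_on_tint continuous_intros Suc.IH) auto
qed

text \<open>With constant coefficients, differentiation in r commutes with every operation in the
  series, so the same series built on \<open>Fr\<close> consists of the derivatives.\<close>

lemma tser_partial_snd:
  assumes "\<And>i. i < N \<Longrightarrow> continuous_on UNIV (F i)" "\<And>i. i < N \<Longrightarrow> continuous_on UNIV (Fr i)"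
    and "\<And>i s r. i < N \<Longrightarrow> ((\<lambda>r. F i (s, r)) has_vector_derivative Fr i (s, r)) (at r)"
  shows "i < N \<Longrightarrow> ((\<lambda>r. tser N a B F n i (s, r)) has_vector_derivative tser N a B Fr n i (s, r)) (at r)"
proof (induction n arbitrary: i s r)
  case 0
  then show ?case by (simp add: tint_partial_snd assms)
next
  case (Suc n)
  show ?case unfolding tser.simps
  proof (rule tint_partial_snd)
    show "continuous_on UNIV (\<lambda>X. \<Sum>j<N. complex_of_real (B i j) * tser N a B F n j X)"
      "continuous_on UNIV (\<lambda>X. \<Sum>j<N. complex_of_real (B i j) * tser N a B Fr n j X)"
      by (intro continuous_intros continuous_on_tser assms; simp)+
    show "((\<lambda>r. \<Sum>j<N. complex_of_real (B i j) * tser N a B F n j (s, r)) has_vector_derivative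
        (\<Sum>j<N. complex_of_real (B i j) * tser N a B Fr n j (s, r))) (at r)" for s r
      by (intro has_vector_derivative_sum has_vector_derivative_mult_right Suc.IH) simp
  qed
qed

text \<open>The usual Volterra estimate. A bound on F for |s| \<le> S suffices because backward
  characteristics from such points stay in that range; it has to be uniform in r, which is not
  confined.\<close>

lemma tser_bound:
  assumes F: "\<And>i. i < N \<Longrightarrow> continuous_on UNIV (F i)"
    and K: "\<And>i s r. i < N \<Longrightarrow> \<bar>s\<bar> \<le> S \<Longrightarrow> norm (F i (s, r)) \<le> K"
    and C: "\<And>i. i < N \<Longrightarrow> (\<Sum>j<N. \<bar>B i j\<bar>) \<le> C" and C0: "0 \<le> C"
  shows "i < N \<Longrightarrow> \<bar>s\<bar> \<le> S \<Longrightarrow> norm (tser N a B F n i (s, r)) \<le> K * C ^ n * \<bar>s\<bar> ^ Suc n / fact (Suc n)"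
proof (induction n arbitrary: i s r)
  case 0
  have "norm (tint (a i) (F i) (s, r)) \<le> \<bar>s\<bar> * (K / real (Suc 0))"
  proof (rule tint_norm_bound)
    fix \<tau> :: real assume "\<tau> \<in> {0..1}"
    then have "\<bar>s * \<tau>\<bar> \<le> \<bar>s\<bar> * 1" unfolding abs_mult by (intro mult_left_mono) auto
    then show "norm (F i (s * \<tau>, r - a i * s * (1 - \<tau>))) \<le> K * \<tau> ^ 0"
      using K 0 by simp
  qed (use F 0 in auto)
  then show ?case by (simp add: mult.commute)
next
  case (Suc n)
  let ?k = "K * C ^ Suc n * \<bar>s\<bar> ^ Suc n / fact (Suc n)"
  have "norm (tser N a B F (Suc n) i (s, r)) \<le> \<bar>s\<bar> * (?k / real (Suc (Suc n)))"
    unfolding tser.simps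
  proof (rule tint_norm_bound)
    show "continuous_on UNIV (\<lambda>X. \<Sum>j<N. complex_of_real (B i j) * tser N a B F n j X)"
      by (intro continuous_intros continuous_on_tser F) auto
    fix \<tau> :: real assume \<tau>: "\<tau> \<in> {0..1}"
    then have le: "\<bar>s * \<tau>\<bar> \<le> S"
    proof -
      have "\<bar>s * \<tau>\<bar> \<le> \<bar>s\<bar> * 1" using \<tau> unfolding abs_mult by (intro mult_left_mono) auto
      with Suc.prems show ?thesis by simp
    qed
    let ?Y = "(s * \<tau>, r - a i * s * (1 - \<tau>))"
    let ?b = "K * C ^ n * \<bar>s * \<tau>\<bar> ^ Suc n / fact (Suc n)"
    have b0: "0 \<le> ?b" using order_trans[OF norm_ge_zero Suc.IH[OF \<open>i < N\<close> le]] .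
    have "norm (\<Sum>j<N. complex_of_real (B i j) * tser N a B F n j ?Y) \<le> (\<Sum>j<N. \<bar>B i j\<bar> * ?b)"
    proof (rule sum_norm_le)
      fix j assume "j \<in> {..<N}"
      then show "norm (complex_of_real (B i j) * tser N a B F n j ?Y) \<le> \<bar>B i j\<bar> * ?b"
        unfolding norm_mult norm_of_real by (intro mult_left_mono Suc.IH le) auto
    qed
    also have "\<dots> \<le> C * ?b"
      unfolding sum_distrib_right[symmetric] by (intro mult_right_mono C b0 Suc.prems)
    \<comment> \<open>The bound at the point with parameter \<tau> is the bound at s times
      \<tau>^(n+1), which is the shape that \<open>tint_norm_bound\<close> integrates.\<close>
    also have "\<dots> = ?k * \<tau> ^ Suc n"
      using \<tau> by (simp add: abs_mult power_mult_distrib del: fact_Suc)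
    finally show "norm (\<Sum>j<N. complex_of_real (B i j) * tser N a B F n j ?Y) \<le> ?k * \<tau> ^ Suc n" .
  qed
  also have "\<dots> = K * C ^ Suc n * \<bar>s\<bar> ^ Suc (Suc n) / fact (Suc (Suc n))"
    unfolding fact_Suc[of "Suc n"] by (simp del: fact_Suc add: divide_simps)
  finally show ?case .
qed

lemma tser_uniform_limit:
  assumes F: "\<And>i. i < N \<Longrightarrow> continuous_on UNIV (F i)"
    and K: "\<And>i s r. i < N \<Longrightarrow> \<bar>s\<bar> \<le> S \<Longrightarrow> norm (F i (s, r)) \<le> K"
    and i: "i < N"
  shows "uniform_limit ({-S..S} \<times> UNIV) (\<lambda>n X. \<Sum>m<n. tser N a B F m i X)
     (\<lambda>X. \<Sum>m. tser N a B F m i X) sequentially"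
proof (cases "S \<ge> 0")
  case True
  define C where "C = (\<Sum>i<N. \<Sum>j<N. \<bar>B i j\<bar>)"
  have C: "(\<Sum>j<N. \<bar>B i j\<bar>) \<le> C" if "i < N" for i
    unfolding C_def using that by (intro member_le_sum[of i "{..<N}"]) (auto intro: sum_nonneg)
  have C0: "0 \<le> C" unfolding C_def by (intro sum_nonneg) auto
  have K0: "0 \<le> K" using order_trans[OF norm_ge_zero K[OF i, of 0]] True by simp
  show ?thesis
  proof (rule Weierstrass_m_test)
    fix n and X :: "real \<times> real" assume X: "X \<in> {-S..S} \<times> UNIV"
    obtain s r where sr: "X = (s, r)" by (cases X)
    with X have s: "\<bar>s\<bar> \<le> S" by auto
    have "norm (tser N a B F n i X) \<le> K * C ^ n * \<bar>s\<bar> ^ Suc n / fact (Suc n)"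
      unfolding sr by (rule tser_bound[of N F S K B C]) (use F K C C0 i s in auto)
    \<comment> \<open>Weakening (n + 1)! to n! turns the bound into a multiple of a term of the
      exponential series.\<close>
    also have "\<dots> \<le> K * C ^ n * S ^ Suc n / fact n"
      using s C0 K0 by (intro frac_le mult_mono power_mono fact_mono) auto
    also have "\<dots> = K * S * ((C * S) ^ n /\<^sub>R fact n)"
      by (simp add: power_mult_distrib divide_inverse)
    finally show "norm (tser N a B F n i X) \<le> K * S * ((C * S) ^ n /\<^sub>R fact n)" .
  qed (intro summable_mult summable_exp_generic)
qed simp

lemma uniform_limit_sum:
  fixes f :: "'i \<Rightarrow> 'n \<Rightarrow> 'a \<Rightarrow> 'b::real_normed_vector"
  assumes "\<And>i. i \<in> I \<Longrightarrow> uniform_limit X (f i) (l i) F"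
  shows "uniform_limit X (\<lambda>n x. \<Sum>i\<in>I. f i n x) (\<lambda>x. \<Sum>i\<in>I. l i x) F"
  using assms
  by (induction I rule: infinite_finite_induct) (auto intro!: uniform_limit_add uniform_limit_const)

text \<open>
  A source-free set for a first-order hyperbolic system stays solution-free as soon as it contains,
  with each point, the backward characteristics of every family down to \<open>s = 0\<close>.
\<close>

definition backward_closed :: "nat \<Rightarrow> (nat \<Rightarrow> real) \<Rightarrow> (real \<times> real) set \<Rightarrow> bool" where
  "backward_closed N a E \<longleftrightarrow>
     (\<forall>(s, r)\<in>E. \<forall>i<N. \<forall>\<tau>\<in>{0..1}. (s * \<tau>, r - a i * s * (1 - \<tau>)) \<in> E)"

lemma tser_eq_0:
  assumes "backward_closed N a E" "\<And>i X. i < N \<Longrightarrow> X \<in> E \<Longrightarrow> F i X = 0"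
  shows "i < N \<Longrightarrow> X \<in> E \<Longrightarrow> tser N a B F n i X = 0"
proof (induction n arbitrary: i X)
  case 0
  then have z: "F i (fst X * \<tau>, snd X - a i * fst X * (1 - \<tau>)) = 0" if "\<tau> \<in> {0..1}" for \<tau>
    using assms that unfolding backward_closed_def by (auto simp: split_beta)
  have "integral {0..1} (\<lambda>\<tau>. F i (fst X * \<tau>, snd X - a i * fst X * (1 - \<tau>))) = integral {0..1} (\<lambda>_::real. 0)"
    by (rule Henstock_Kurzweil_Integration.integral_cong) (rule z)
  then show ?case by (simp add: tint_def)
next
  case (Suc n)
  then have z: "tser N a B F n j (fst X * \<tau>, snd X - a i * fst X * (1 - \<tau>)) = 0"
    if "\<tau> \<in> {0..1}" "j < N" for \<tau> j
    using assms(1) that unfolding backward_closed_def by (auto simp: split_beta)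
  have "integral {0..1} (\<lambda>\<tau>. \<Sum>j<N. B i j * tser N a B F n j (fst X * \<tau>, snd X - a i * fst X * (1 - \<tau>)))
      = integral {0..1} (\<lambda>_::real. 0)"
    by (intro Henstock_Kurzweil_Integration.integral_cong sum.neutral ballI) (simp add: z)
  then show ?case by (simp add: tint_def)
qed

text \<open>The sum of the Neumann series solves w = tint (B w + F), and \<open>C1_tint\<close>
  applied to the right-hand side upgrades w to C^1: only the r-derivative of w enters there, and it
  is obtained termwise. The last conclusion is finite propagation, from which all later support
  statements are drawn.\<close>

theorem transport_system:
  fixes a :: "nat \<Rightarrow> real" and B :: "nat \<Rightarrow> nat \<Rightarrow> real" and F Fr :: "nat \<Rightarrow> real \<times> real \<Rightarrow> complex"
  assumes F: "\<And>i. i < N \<Longrightarrow> continuous_on UNIV (F i)" and Fr: "\<And>i. i < N \<Longrightarrow> continuous_on UNIV (Fr i)"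
    and d: "\<And>i s r. i < N \<Longrightarrow> ((\<lambda>r. F i (s, r)) has_vector_derivative Fr i (s, r)) (at r)"
    and bd: "\<And>S. \<exists>K. \<forall>i<N. \<forall>s r. \<bar>s\<bar> \<le> S \<longrightarrow> norm (F i (s, r)) \<le> K \<and> norm (Fr i (s, r)) \<le> K"
  obtains w ws wr :: "nat \<Rightarrow> real \<times> real \<Rightarrow> complex" where
    "\<And>i. i < N \<Longrightarrow> C1 (w i) (ws i) (wr i)"
    "\<And>i X. i < N \<Longrightarrow> ws i X + a i * wr i X = (\<Sum>j<N. B i j * w j X) + F i X"
    "\<And>i r. i < N \<Longrightarrow> w i (0, r) = 0"
    "\<And>E i X. backward_closed N a E \<Longrightarrow> (\<And>i X. i < N \<Longrightarrow> X \<in> E \<Longrightarrow> F i X = 0) \<Longrightarrow>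
       i < N \<Longrightarrow> X \<in> E \<Longrightarrow> w i X = 0"
proof -
  define P where "P F n i X = (\<Sum>m<n. tser N a B F m i X)" for F n i X
  define w where "w F i X = (\<Sum>m. tser N a B F m i X)" for F i X
  have ul: "uniform_limit ({-S..S} \<times> UNIV) (\<lambda>n. P F n i) (w F i) sequentially"
           "uniform_limit ({-S..S} \<times> UNIV) (\<lambda>n. P Fr n i) (w Fr i) sequentially" if "i < N" for i S
  proof -
    obtain K where "\<forall>i<N. \<forall>s r. \<bar>s\<bar> \<le> S \<longrightarrow> norm (F i (s, r)) \<le> K \<and> norm (Fr i (s, r)) \<le> K"
      using bd by blast
    then show "uniform_limit ({-S..S} \<times> UNIV) (\<lambda>n. P F n i) (w F i) sequentially"
      "uniform_limit ({-S..S} \<times> UNIV) (\<lambda>n. P Fr n i) (w Fr i) sequentially"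
      unfolding P_def w_def using that
      by (auto intro!: tser_uniform_limit[of N _ S K] F Fr)
  qed
  have Pc: "continuous_on UNIV (P F n i)" "continuous_on UNIV (P Fr n i)" if "i < N" for n i
    unfolding P_def using that by (auto intro!: continuous_intros continuous_on_tser F Fr)
  \<comment> \<open>Convergence is uniform only for bounded s, but the range |s| \<le> S with S
    exceeding the given value by 1 contains a neighbourhood of the point.\<close>
  have cont: "continuous_on UNIV v" if v: "\<And>S. uniform_limit ({-S..S} \<times> UNIV) Q v sequentially"
      and Q: "\<And>n. continuous_on UNIV (Q n)" for Q :: "nat \<Rightarrow> real \<times> real \<Rightarrow> complex" and v
  proof (rule continuous_at_imp_continuous_on, rule ballI)
    fix X :: "real \<times> real"
    define S where "S = \<bar>fst X\<bar> + 1"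
    have "continuous_on ({-S..S} \<times> UNIV) v"
      by (rule uniform_limit_theorem[OF _ v]) (auto intro!: always_eventually continuous_on_subset[OF Q])
    then have "continuous_on ({-S<..<S} \<times> UNIV) v"
      by (rule continuous_on_subset) auto
    moreover have "open ({-S<..<S} \<times> (UNIV :: real set))" by (intro open_Times) auto
    moreover have "X \<in> {-S<..<S} \<times> UNIV" by (cases X) (auto simp: S_def)
    ultimately show "isCont v X" by (auto simp: continuous_on_eq_continuous_at)
  qed
  have wc: "continuous_on UNIV (w F i)" "continuous_on UNIV (w Fr i)" if "i < N" for i
    using cont[OF ul(1)[OF that] Pc(1)[OF that]] cont[OF ul(2)[OF that] Pc(2)[OF that]] by auto
  have lim: "(\<lambda>n. P F n i X) \<longlonglongrightarrow> w F i X" if "i < N" for i X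
    by (rule tendsto_uniform_limitI[OF ul(1)[OF that, of "\<bar>fst X\<bar>"]]) (cases X, auto)
  define G where "G i X = (\<Sum>j<N. B i j * w F j X) + F i X" for i X
  define Gr where "Gr i X = (\<Sum>j<N. B i j * w Fr j X) + Fr i X" for i X
  \<comment> \<open>Termwise differentiation: on each line s = const the differentiated series
    converges uniformly in r.\<close>
  have wd: "((\<lambda>r. w F i (s, r)) has_vector_derivative w Fr i (s, r)) (at r)" if i: "i < N" for i s r
  proof -
    have "\<exists>g. \<forall>x\<in>UNIV. (\<lambda>n. tser N a B F n i (s, x)) sums g x \<and>
        (g has_derivative (\<lambda>h. h *\<^sub>R w Fr i (s, x))) (at x within UNIV)"
    proof (rule has_derivative_series)
      show "((\<lambda>x. tser N a B F n i (s, x)) has_derivative (\<lambda>h. h *\<^sub>R tser N a B Fr n i (s, x))) (at x within UNIV)" for n x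
        using tser_partial_snd[of N F Fr i a B n s x] F Fr d i by (simp add: has_vector_derivative_def)
      fix e :: real assume "e > 0"
      from uniform_limitD[OF ul(2)[OF i, of "\<bar>s\<bar>"] this]
      show "\<forall>\<^sub>F n in sequentially. \<forall>x\<in>UNIV. \<forall>h. norm ((\<Sum>m<n. h *\<^sub>R tser N a B Fr m i (s, x)) - h *\<^sub>R w Fr i (s, x)) \<le> e * norm h"
      proof eventually_elim
        case (elim n)
        have "norm ((\<Sum>m<n. h *\<^sub>R tser N a B Fr m i (s, x)) - h *\<^sub>R w Fr i (s, x)) \<le> e * norm h" for x h
        proof -
          have "dist (P Fr n i (s, x)) (w Fr i (s, x)) < e" using bspec[OF elim, of "(s, x)"] abs_le_iff[of s "\<bar>s\<bar>"] by auto
          then have "norm h * norm (P Fr n i (s, x) - w Fr i (s, x)) \<le> norm h * e"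
            by (intro mult_left_mono) (auto simp: dist_norm)
          then show ?thesis
            by (simp add: P_def scaleR_sum_right[symmetric] scaleR_diff_right[symmetric] mult.commute)
        qed
        then show ?case by blast
      qed
    next
      show "(\<lambda>n. tser N a B F n i (s, 0)) sums w F i (s, 0)"
        using lim[OF i, of "(s, 0)"] by (simp add: sums_def P_def)
    qed auto
    then obtain g where g: "\<And>x. (\<lambda>n. tser N a B F n i (s, x)) sums g x"
       "\<And>x. (g has_derivative (\<lambda>h. h *\<^sub>R w Fr i (s, x))) (at x)" by auto
    have "g = (\<lambda>x. w F i (s, x))"
      using g(1) by (auto simp: w_def sums_iff)
    with g(2) show ?thesis by (simp add: has_vector_derivative_def)
  qed
  have Gc: "continuous_on UNIV (G i)" "continuous_on UNIV (Gr i)" if "i < N" for i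
    unfolding G_def Gr_def using that by (auto intro!: continuous_intros wc F Fr)
  have Gd: "((\<lambda>r. G i (s, r)) has_vector_derivative Gr i (s, r)) (at r)" if "i < N" for i s r
    unfolding G_def Gr_def using that
    by (intro has_vector_derivative_add has_vector_derivative_sum has_vector_derivative_mult_right wd d) auto
  \<comment> \<open>Partial sums are Picard iterates, one index apart: the sum of n + 1 terms is the
    integral operator applied to the sum of n terms.\<close>
  have PSuc: "P F (Suc n) i X = tint (a i) (\<lambda>X. (\<Sum>j<N. B i j * P F n j X) + F i X) X" if i: "i < N" for i n X
  proof (induction n)
    case 0
    then show ?case by (simp add: P_def)
  next
    case (Suc n)
    have 1: "continuous_on UNIV (\<lambda>X. (\<Sum>j<N. complex_of_real (B i j) * P F n j X) + F i X)"
      "continuous_on UNIV (\<lambda>X. \<Sum>j<N. complex_of_real (B i j) * tser N a B F n j X)"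
      using i by (auto intro!: continuous_intros Pc F continuous_on_tser)
    have "P F (Suc (Suc n)) i X = P F (Suc n) i X + tser N a B F (Suc n) i X"
      by (simp add: P_def)
    also have "\<dots> = tint (a i) (\<lambda>X. ((\<Sum>j<N. B i j * P F n j X) + F i X) + (\<Sum>j<N. B i j * tser N a B F n j X)) X"
      unfolding Suc tser.simps using tint_add[OF 1] by simp
    also have "(\<lambda>X. ((\<Sum>j<N. B i j * P F n j X) + F i X) + (\<Sum>j<N. B i j * tser N a B F n j X))
       = (\<lambda>X. (\<Sum>j<N. B i j * P F (Suc n) j X) + F i X)"
      by (rule ext) (simp add: P_def sum.distrib algebra_simps)
    finally show ?case .
  qed
  \<comment> \<open>The limit of the Picard recursion. Convergence is uniform along a compact piece
    of a characteristic, so it passes through the integral.\<close>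
  have eq: "w F i X = tint (a i) (G i) X" if i: "i < N" for i X
  proof -
    let ?Y = "\<lambda>\<tau>. (fst X * \<tau>, snd X - a i * fst X * (1 - \<tau>))"
    have "uniform_limit {0..1} (\<lambda>n \<tau>. (\<Sum>j<N. B i j * P F n j (?Y \<tau>)) + F i (?Y \<tau>)) (\<lambda>\<tau>. G i (?Y \<tau>)) sequentially"
      unfolding G_def
    proof (intro uniform_limit_add uniform_limit_sum bounded_linear_uniform_limit_intros uniform_limit_const)
      fix j assume "j \<in> {..<N}"
      then have ulj: "uniform_limit ({-\<bar>fst X\<bar>..\<bar>fst X\<bar>} \<times> UNIV) (\<lambda>n. P F n j) (w F j) sequentially"
        using ul by auto
      have Y: "?Y \<tau> \<in> {-\<bar>fst X\<bar>..\<bar>fst X\<bar>} \<times> UNIV" if "\<tau> \<in> {0..1}" for \<tau>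
      proof -
        have "\<bar>fst X * \<tau>\<bar> \<le> \<bar>fst X\<bar> * 1" using that unfolding abs_mult by (intro mult_left_mono) auto
        then show ?thesis by auto
      qed
      show "uniform_limit {0..1} (\<lambda>n \<tau>. P F n j (?Y \<tau>)) (\<lambda>\<tau>. w F j (?Y \<tau>)) sequentially"
        using ulj Y unfolding uniform_limit_iff by (fastforce elim: eventually_mono)
    qed
    then have "((\<lambda>n. integral {0..1} (\<lambda>\<tau>. (\<Sum>j<N. B i j * P F n j (?Y \<tau>)) + F i (?Y \<tau>))) \<longlongrightarrow>
        integral {0..1} (\<lambda>\<tau>. G i (?Y \<tau>))) sequentially"
    proof -
      assume u: "uniform_limit {0..1} (\<lambda>n \<tau>. (\<Sum>j<N. B i j * P F n j (?Y \<tau>)) + F i (?Y \<tau>)) (\<lambda>\<tau>. G i (?Y \<tau>)) sequentially"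
      have c: "continuous_on {0..1} (\<lambda>\<tau>. (\<Sum>j<N. complex_of_real (B i j) * P F n j (?Y \<tau>)) + F i (?Y \<tau>))" for n
        using i by (intro continuous_intros continuous_on_tint_integrand Pc F) auto
      from uniform_limit_integral[OF u c] obtain I J where
        I: "\<And>n. ((\<lambda>\<tau>. (\<Sum>j<N. B i j * P F n j (?Y \<tau>)) + F i (?Y \<tau>)) has_integral I n) {0..1}"
        and J: "((\<lambda>\<tau>. G i (?Y \<tau>)) has_integral J) {0..1}" and IJ: "I \<longlonglongrightarrow> J" by auto
      show ?thesis unfolding integral_unique[OF I] integral_unique[OF J] by (rule IJ)
    qed
    then have "(\<lambda>n. P F (Suc n) i X) \<longlonglongrightarrow> tint (a i) (G i) X"
      unfolding PSuc[OF i] unfolding tint_def by (intro tendsto_intros)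
    moreover have "(\<lambda>n. P F (Suc n) i X) \<longlonglongrightarrow> w F i X"
      using lim[OF i] by (rule LIMSEQ_Suc)
    ultimately show ?thesis by (metis LIMSEQ_unique)
  qed
  show thesis
  proof (rule that[of "w F" "\<lambda>i X. G i X - a i * tint (a i) (Gr i) X" "\<lambda>i. tint (a i) (Gr i)"])
    fix i assume i: "i < N"
    have "C1 (tint (a i) (G i)) (\<lambda>X. G i X - a i * tint (a i) (Gr i) X) (tint (a i) (Gr i))"
      by (rule C1_tint) (use Gc Gd i in auto)
    then show "C1 (w F i) (\<lambda>X. G i X - a i * tint (a i) (Gr i) X) (tint (a i) (Gr i))"
      by (rule C1_cong) (simp_all add: eq[OF i])
    show "w F i (0, r) = 0" for r by (simp add: eq[OF i] tint_def)
  next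
    fix E and i :: nat and X :: "real \<times> real"
    assume "backward_closed N a E" "\<And>i X. i < N \<Longrightarrow> X \<in> E \<Longrightarrow> F i X = 0" "i < N" "X \<in> E"
    then show "w F i X = 0" unfolding w_def by (simp add: tser_eq_0)
  qed (auto simp: G_def)
qed

subsection \<open>The wave equation with memory as a transport system\<close>

text \<open>
  With \<open>h = z\<^sub>t\<^sub>t - z\<^sub>x\<^sub>x + M z\<^sub>t + M\<^sup>2 z\<close>, the third-order equation for \<open>z = \<integral> y\<close> is the first-order
  system for the components \<open>z\<^sub>t + z\<^sub>x\<close>, \<open>z\<^sub>t - z\<^sub>x\<close>, \<open>z\<close>, \<open>h\<close>, in this order.
\<close>

definition spd :: "nat \<Rightarrow> real" where
  "spd i = (if i = 0 then -1 else if i = 1 then 1 else 0)"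

text \<open>The first two rows are the two factorizations of z_tt - z_xx = h - M z_t - M^2 z into
  transport operators, with z_t written as half the sum of the first two components. The third row
  is that formula for z_t, the fourth is h_t = M h - M^3 z.\<close>

definition cpl :: "real \<Rightarrow> nat \<Rightarrow> nat \<Rightarrow> real" where
  "cpl M i j = [[-M/2, -M/2, -(M^2), 1], [-M/2, -M/2, -(M^2), 1], [1/2, 1/2, 0, 0], [0, 0, -(M^3), M]] ! i ! j"

definition wave_system ::
    "real \<Rightarrow> (nat \<Rightarrow> real \<times> real \<Rightarrow> complex) \<Rightarrow> (nat \<Rightarrow> real \<times> real \<Rightarrow> complex) \<Rightarrow>
     (nat \<Rightarrow> real \<times> real \<Rightarrow> complex) \<Rightarrow> (nat \<Rightarrow> real \<times> real \<Rightarrow> complex) \<Rightarrow> bool" where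
  "wave_system M F w wt wx \<longleftrightarrow> (\<forall>i<4. C1 (w i) (wt i) (wx i) \<and>
     (\<forall>X. wt i X + complex_of_real (spd i) * wx i X =
       (\<Sum>j<4. complex_of_real (cpl M i j) * w j X) + F i X))"

lemma lessThan_4: "{..<4::nat} = {0, 1, 2, 3}"
  by auto

lemma all_less_4: "(\<forall>i<4::nat. P i) \<longleftrightarrow> P 0 \<and> P 1 \<and> P 2 \<and> P 3"
  by (auto simp: less_Suc_eq numeral_eq_Suc)

lemma wave_system_iff:
  "wave_system M F w wt wx \<longleftrightarrow> (\<forall>i<4. C1 (w i) (wt i) (wx i)) \<and>
     (\<forall>X. wt 0 X - wx 0 X = w 3 X - M / 2 * (w 0 X + w 1 X) - M^2 * w 2 X + F 0 X) \<and>
     (\<forall>X. wt 1 X + wx 1 X = w 3 X - M / 2 * (w 0 X + w 1 X) - M^2 * w 2 X + F 1 X) \<and>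
     (\<forall>X. wt 2 X = (w 0 X + w 1 X) / 2 + F 2 X) \<and>
     (\<forall>X. wt 3 X = M * w 3 X - M^3 * w 2 X + F 3 X)"
  unfolding wave_system_def all_less_4 lessThan_4 spd_def cpl_def
  by (auto simp: numeral_2_eq_2 numeral_3_eq_3 algebra_simps)

lemma wave_system_add:
  assumes "wave_system M F w wt wx" "wave_system M G u ut ux"
  shows "wave_system M (\<lambda>i X. F i X + G i X) (\<lambda>i X. w i X + u i X) (\<lambda>i X. wt i X + ut i X) (\<lambda>i X. wx i X + ux i X)"
  unfolding wave_system_def
proof (intro allI impI conjI)
  fix i :: nat and X assume i: "i < 4"
  with assms show "C1 (\<lambda>X. w i X + u i X) (\<lambda>X. wt i X + ut i X) (\<lambda>X. wx i X + ux i X)"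
    unfolding wave_system_def by (intro C1_add) auto
  have e: "wt i X + spd i * wx i X = (\<Sum>j<4. cpl M i j * w j X) + F i X"
    "ut i X + spd i * ux i X = (\<Sum>j<4. cpl M i j * u j X) + G i X"
    using assms i unfolding wave_system_def by blast+
  have "wt i X + ut i X + spd i * (wx i X + ux i X) = (wt i X + spd i * wx i X) + (ut i X + spd i * ux i X)"
    by (simp add: algebra_simps)
  also have "\<dots> = (\<Sum>j<4. cpl M i j * (w j X + u j X)) + (F i X + G i X)"
    unfolding e by (simp add: algebra_simps sum.distrib)
  finally show "wt i X + ut i X + spd i * (wx i X + ux i X) = (\<Sum>j<4. cpl M i j * (w j X + u j X)) + (F i X + G i X)" .
qed

section \<open>Evolution in time, and evolution across a strip in the comoving variable\<close>

text \<open>Free transport \<open>G\<close> carries the initial values. What remains has zero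
  initial data and the coupling applied to \<open>G\<close> as its source, which is the situation of
  \<open>transport_system\<close>.\<close>

lemma time_evolution:
  fixes g g' :: "nat \<Rightarrow> real \<Rightarrow> complex"
  assumes g: "\<And>i x. i < 4 \<Longrightarrow> (g i has_vector_derivative g' i x) (at x)"
    and g': "\<And>i. i < 4 \<Longrightarrow> continuous_on UNIV (g' i)"
    and bd: "\<And>i x. i < 4 \<Longrightarrow> norm (g i x) \<le> K \<and> norm (g' i x) \<le> K"
  obtains w wt wx where "wave_system M (\<lambda>_ _. 0) w wt wx" "\<And>i x. i < 4 \<Longrightarrow> w i (0, x) = g i x"
proof -
  define G where "G i X = g i (snd X - spd i * fst X)" for i X
  define G' where "G' i X = g' i (snd X - spd i * fst X)" for i X
  have CG: "C1 (G i) (\<lambda>X. - spd i * G' i X) (G' i)" if "i < 4" for i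
    by (rule C1_cong[OF C1_plane_wave[OF g[OF that] g'[OF that], of "- spd i" 1 0]])
      (simp_all add: G_def G'_def)
  have Gd: "((\<lambda>r. G i (s, r)) has_vector_derivative G' i (s, r)) (at r)" if "i < 4" for i s r
    using C1_partial_snd[OF CG[OF that]] .
  define F where "F i X = (\<Sum>j<4. cpl M i j * G j X)" for i X
  define F' where "F' i X = (\<Sum>j<4. cpl M i j * G' j X)" for i X
  have "\<exists>(w :: nat \<Rightarrow> real \<times> real \<Rightarrow> complex) (wt :: nat \<Rightarrow> real \<times> real \<Rightarrow> complex) (wx :: nat \<Rightarrow> real \<times> real \<Rightarrow> complex). (\<forall>i<4. C1 (w i) (wt i) (wx i)) \<and>
    (\<forall>i<4. \<forall>X. wt i X + spd i * wx i X = (\<Sum>j<4. cpl M i j * w j X) + F i X) \<and>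
    (\<forall>i<4. \<forall>r. w i (0, r) = 0)"
  proof (rule transport_system[of 4 F F' spd "cpl M"])
    fix i :: nat assume "i < 4"
    show "continuous_on UNIV (F i)" "continuous_on UNIV (F' i)"
      unfolding F_def F'_def
      by (intro continuous_intros C1_continuous[OF CG] C1_continuous_partials[OF CG]; simp)+
    show "((\<lambda>r. F i (s, r)) has_vector_derivative F' i (s, r)) (at r)" for s r
      unfolding F_def F'_def
      by (intro has_vector_derivative_sum has_vector_derivative_mult_right Gd) auto
  next
    define C where "C = (\<Sum>i<4. \<Sum>j<4. \<bar>cpl M i j\<bar> * K)"
    have K0: "0 \<le> K" using order_trans[OF norm_ge_zero, of "g 0 0" K] bd[of 0 0] by simp
    have "norm (F i X) \<le> C \<and> norm (F' i X) \<le> C" if "i < 4" for i X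
    proof -
      have "norm (F i X) \<le> (\<Sum>j<4. \<bar>cpl M i j\<bar> * K)" "norm (F' i X) \<le> (\<Sum>j<4. \<bar>cpl M i j\<bar> * K)"
        unfolding F_def F'_def G_def G'_def using bd
        by (auto intro!: sum_norm_le mult_left_mono simp: norm_mult)
      moreover have "(\<Sum>j<4. \<bar>cpl M i j\<bar> * K) \<le> C"
        unfolding C_def using that K0 by (intro member_le_sum[of i "{..<4}"] sum_nonneg) auto
      ultimately show ?thesis by linarith
    qed
    then show "\<exists>K. \<forall>i<4. \<forall>s r. \<bar>s\<bar> \<le> S \<longrightarrow> norm (F i (s, r)) \<le> K \<and> norm (F' i (s, r)) \<le> K" for S
      by blast
  qed blast
  then obtain w wt wx :: "nat \<Rightarrow> real \<times> real \<Rightarrow> complex"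
    where w: "\<And>i. i < 4 \<Longrightarrow> C1 (w i) (wt i) (wx i)"
    "\<And>i X. i < 4 \<Longrightarrow> wt i X + spd i * wx i X = (\<Sum>j<4. cpl M i j * w j X) + F i X"
    "\<And>i r. i < 4 \<Longrightarrow> w i (0, r) = 0" by blast
  show thesis
  proof (rule that)
    show "wave_system M (\<lambda>_ _. 0) (\<lambda>i X. w i X + G i X) (\<lambda>i X. wt i X + (- spd i * G' i X)) (\<lambda>i X. wx i X + G' i X)"
      unfolding wave_system_def
    proof (intro allI impI conjI C1_add)
      fix i :: nat and X assume i: "i < 4"
      show "wt i X + (- spd i * G' i X) + spd i * (wx i X + G' i X) = (\<Sum>j<4. cpl M i j * (w j X + G j X)) + 0"
        using w(2)[OF i, of X] by (simp add: F_def algebra_simps sum.distrib)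
    qed (use w CG in auto)
    show "w i (0, x) + G i (0, x) = g i x" if "i < 4" for i x
      using w(3) that by (simp add: G_def)
  qed
qed

text \<open>In the coordinates s = x + c t - x0 and r = t the operator w_t + spd w_x becomes (c +
  spd) w_s + w_r. Dividing by c + spd, which the hypotheses on c make nonzero, gives a transport
  system in s; its speed 1/(c + spd) is the time elapsed per unit of s. For s \<ge> 0 a source in
  the window [T1, T2] therefore spreads backwards at rate at most p and forwards at rate at most
  q.\<close>

lemma space_evolution:
  assumes c: "c \<noteq> 0" "c \<noteq> 1" "c \<noteq> -1"
    and F: "\<And>i. i < 4 \<Longrightarrow> C1 (F i) (Ft i) (Fx i)"
    and F0: "\<And>i t x. i < 4 \<Longrightarrow> t \<notin> {T1..T2} \<Longrightarrow> F i (t, x) = 0"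
    and pq: "\<And>i. i < 4 \<Longrightarrow> - p \<le> 1 / (c + spd i) \<and> 1 / (c + spd i) \<le> q" and p: "0 \<le> p" and q: "0 \<le> q"
  obtains w wt wx where "wave_system M F w wt wx"
    "\<And>i t x. i < 4 \<Longrightarrow> x + c * t = x0 \<Longrightarrow> w i (t, x) = 0"
    "\<And>i t x. i < 4 \<Longrightarrow> x + c * t \<ge> x0 \<Longrightarrow> t < T1 - p * (x + c * t - x0) \<or> t > T2 + q * (x + c * t - x0) \<Longrightarrow>
       w i (t, x) = 0"
proof -
  have ne: "c + spd i \<noteq> 0" for i using c by (auto simp: spd_def)
  define a where "a i = 1 / (c + spd i)" for i
  \<comment> \<open>The divided source in the new coordinates: the second coordinate is t, and x = s
    + x0 - c t.\<close>
  define G where "G i X = a i * F i (snd X, fst X + x0 - c * snd X)" for i X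
  define Gr where "Gr i X = a i * (Ft i (snd X, fst X + x0 - c * snd X) - c * Fx i (snd X, fst X + x0 - c * snd X))" for i X
  have CG: "C1 (G i) (\<lambda>X. a i * Fx i (snd X, fst X + x0 - c * snd X)) (Gr i)" if "i < 4" for i
    by (rule C1_cong[OF C1_cmul[OF C1_affine[OF F[OF that], of 0 1 0 1 "-c" x0], of "a i"]])
      (simp_all add: G_def Gr_def algebra_simps)
  have G0: "G i X = 0" if "i < 4" "snd X \<notin> {T1..T2}" for i X
    using F0 that by (simp add: G_def)
  have Gr0: "Gr i X = 0" if "i < 4" "snd X \<notin> {T1..T2}" for i X
  proof (rule C1_unique(2)[OF CG[OF that(1)] C1_const[of 0]])
    show "open (snd -` (- {T1..T2}) :: (real \<times> real) set)"
      by (intro open_vimage_snd open_Compl closed_atLeastAtMost)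
  qed (use that G0 in auto)
  have "\<exists>(w :: nat \<Rightarrow> real \<times> real \<Rightarrow> complex) (wt :: nat \<Rightarrow> real \<times> real \<Rightarrow> complex) (wx :: nat \<Rightarrow> real \<times> real \<Rightarrow> complex). (\<forall>i<4. C1 (w i) (wt i) (wx i)) \<and>
    (\<forall>i<4. \<forall>X. wt i X + a i * wx i X = (\<Sum>j<4. (a i * cpl M i j) * w j X) + G i X) \<and>
    (\<forall>i<4. \<forall>r. w i (0, r) = 0) \<and>
    (\<forall>E. backward_closed 4 a E \<longrightarrow> (\<forall>i<4. \<forall>X\<in>E. G i X = 0) \<longrightarrow> (\<forall>i<4. \<forall>X\<in>E. w i X = 0))"
  proof (rule transport_system[of 4 G Gr a "\<lambda>i j. a i * cpl M i j"])
    fix i :: nat assume i: "i < 4"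
    show "continuous_on UNIV (G i)" "continuous_on UNIV (Gr i)"
      using C1_continuous[OF CG[OF i]] C1_continuous_partials[OF CG[OF i]] by auto
    show "((\<lambda>r. G i (s, r)) has_vector_derivative Gr i (s, r)) (at r)" for s r
      by (rule C1_partial_snd[OF CG[OF i]])
  next
    fix S :: real
    \<comment> \<open>The bound uniform in r comes from compactness, since source and derivative
      vanish unless r lies in [T1, T2].\<close>
    have "\<exists>K. \<forall>s r. \<bar>s\<bar> \<le> S \<longrightarrow> norm (H (s, r)) \<le> K"
      if H: "continuous_on UNIV H" "\<And>X. snd X \<notin> {T1..T2} \<Longrightarrow> H X = 0" for H :: "real \<times> real \<Rightarrow> complex"
    proof -
      have "bounded (H ` ({-S..S} \<times> {T1..T2}))"
        by (intro compact_imp_bounded compact_continuous_image continuous_on_subset[OF H(1)] compact_Times) auto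
      then obtain K where K: "\<And>X. X \<in> {-S..S} \<times> {T1..T2} \<Longrightarrow> norm (H X) \<le> K"
        unfolding bounded_iff by auto
      show ?thesis
      proof (intro exI allI impI)
        fix s r :: real assume "\<bar>s\<bar> \<le> S"
        then show "norm (H (s, r)) \<le> max K 0"
          using K[of "(s, r)"] H(2)[of "(s, r)"] max.cobounded1[of K 0] by (cases "r \<in> {T1..T2}") (auto simp: abs_le_iff)
      qed
    qed
    from this[OF C1_continuous[OF CG] G0] this[OF C1_continuous_partials(2)[OF CG] Gr0]
    have "\<forall>i. \<exists>K. i < 4 \<longrightarrow> (\<forall>s r. \<bar>s\<bar> \<le> S \<longrightarrow> norm (G i (s, r)) \<le> K)"
      "\<forall>i. \<exists>K. i < 4 \<longrightarrow> (\<forall>s r. \<bar>s\<bar> \<le> S \<longrightarrow> norm (Gr i (s, r)) \<le> K)" by blast+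
    then obtain K K' where K: "\<And>i s r. i < 4 \<Longrightarrow> \<bar>s\<bar> \<le> S \<Longrightarrow> norm (G i (s, r)) \<le> K i"
      "\<And>i s r. i < 4 \<Longrightarrow> \<bar>s\<bar> \<le> S \<Longrightarrow> norm (Gr i (s, r)) \<le> K' i" by metis
    let ?C = "\<Sum>i<4. \<bar>K i\<bar> + \<bar>K' i\<bar>"
    have le: "\<bar>K i\<bar> + \<bar>K' i\<bar> \<le> ?C" if "i < 4" for i
      using that by (intro member_le_sum[of i "{..<4}" "\<lambda>i. \<bar>K i\<bar> + \<bar>K' i\<bar>"]) auto
    show "\<exists>K. \<forall>i<4. \<forall>s r. \<bar>s\<bar> \<le> S \<longrightarrow> norm (G i (s, r)) \<le> K \<and> norm (Gr i (s, r)) \<le> K"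
    proof (intro exI allI impI)
      fix i :: nat and s r :: real assume "i < 4" "\<bar>s\<bar> \<le> S"
      then show "norm (G i (s, r)) \<le> ?C \<and> norm (Gr i (s, r)) \<le> ?C"
        using K(1)[of i s r] K(2)[of i s r] le[of i] by linarith
    qed
  qed blast
  then obtain w ws wr :: "nat \<Rightarrow> real \<times> real \<Rightarrow> complex"
    where W: "\<forall>i<4. C1 (w i) (ws i) (wr i)"
      "\<forall>i<4. \<forall>X. ws i X + a i * wr i X = (\<Sum>j<4. (a i * cpl M i j) * w j X) + G i X"
      "\<forall>i<4. \<forall>r. w i (0, r) = 0"
      "\<forall>E. backward_closed 4 a E \<longrightarrow> (\<forall>i<4. \<forall>X\<in>E. G i X = 0) \<longrightarrow> (\<forall>i<4. \<forall>X\<in>E. w i X = 0)"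
    by (elim exE conjE) (rule that)
  have w: "\<And>i. i < 4 \<Longrightarrow> C1 (w i) (ws i) (wr i)"
    "\<And>i X. i < 4 \<Longrightarrow> ws i X + a i * wr i X = (\<Sum>j<4. (a i * cpl M i j) * w j X) + G i X"
    "\<And>i r. i < 4 \<Longrightarrow> w i (0, r) = 0"
    "\<And>E. backward_closed 4 a E \<Longrightarrow> \<forall>i<4. \<forall>X\<in>E. G i X = 0 \<Longrightarrow> \<forall>i<4. \<forall>X\<in>E. w i X = 0"
    using W by blast+
  define u where "u i X = w i (c * fst X + snd X - x0, fst X)" for i X
  define us where "us i X = ws i (c * fst X + snd X - x0, fst X)" for i X
  define ur where "ur i X = wr i (c * fst X + snd X - x0, fst X)" for i X
  have G_u: "G i (c * fst X + snd X - x0, fst X) = a i * F i X" for i X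
    by (simp add: G_def)
  show thesis
  proof (rule that)
    show "wave_system M F u (\<lambda>i X. c * us i X + ur i X) us"
      unfolding wave_system_def
    proof (intro allI impI conjI)
      fix i :: nat assume i: "i < 4"
      show "C1 (u i) (\<lambda>X. c * us i X + ur i X) (us i)"
        by (rule C1_cong[OF C1_affine[OF w(1)[OF i], of c 1 "-x0" 1 0 0]])
          (simp_all add: u_def us_def ur_def)
      fix X
      have "us i X + a i * ur i X = a i * ((\<Sum>j<4. cpl M i j * u j X) + F i X)"
        using w(2)[OF i, of "(c * fst X + snd X - x0, fst X)"]
        unfolding us_def[symmetric] ur_def[symmetric] u_def[symmetric] G_u
        by (simp add: sum_distrib_left algebra_simps)
      moreover have 1: "complex_of_real (c + spd i) * a i = 1" using ne[of i]
        unfolding a_def of_real_mult[symmetric] by simp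
      ultimately have "complex_of_real (c + spd i) * (us i X + a i * ur i X) = (\<Sum>j<4. cpl M i j * u j X) + F i X"
        unfolding mult.assoc[symmetric] by simp
      moreover have "complex_of_real (c + spd i) * (us i X + a i * ur i X)
          = complex_of_real (c + spd i) * us i X + (complex_of_real (c + spd i) * a i) * ur i X"
        by (simp only: distrib_left mult.assoc)
      moreover have "\<dots> = c * us i X + ur i X + spd i * us i X"
        unfolding 1 by (simp add: distrib_right)
      ultimately show "c * us i X + ur i X + spd i * us i X = (\<Sum>j<4. cpl M i j * u j X) + F i X"
        by simp
    qed
    show "u i (t, x) = 0" if "i < 4" "x + c * t = x0" for i t x
      using w(3) that by (simp add: u_def algebra_simps)
    fix i :: nat and t x :: real assume i: "i < 4" and x: "x + c * t \<ge> x0"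
      and t: "t < T1 - p * (x + c * t - x0) \<or> t > T2 + q * (x + c * t - x0)"
    have p0: "- p \<le> a j" "a j \<le> q" if "j < 4" for j using pq[OF that] by (auto simp: a_def)
    from t show "u i (t, x) = 0"
    proof
      assume t: "t < T1 - p * (x + c * t - x0)"
      \<comment> \<open>The region below the line r = T1 - p s. Going backwards along a
        characteristic, r gains at most p per unit of s, so that line is never crossed.\<close>
      define E where "E = {(s, r). s \<ge> 0 \<and> r < T1 - p * s}"
      have "backward_closed 4 a E"
        unfolding backward_closed_def E_def
      proof safe
        fix s r \<tau> :: real and j :: nat assume *: "0 \<le> s" "r < T1 - p * s" "j < 4" "\<tau> \<in> {0..1}"
        then show "0 \<le> s * \<tau>" by simp
        have "(- p) * (s * (1 - \<tau>)) \<le> a j * (s * (1 - \<tau>))"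
          using * p0 by (intro mult_right_mono) auto
        then show "r - a j * s * (1 - \<tau>) < T1 - p * (s * \<tau>)"
          using * by (simp add: algebra_simps)
      qed
      moreover have "G j X = 0" if "j < 4" "X \<in> E" for j X
        using that p by (intro G0) (auto simp: E_def dest: mult_nonneg_nonneg[OF p])
      ultimately have "\<forall>X\<in>E. w i X = 0" using w(4)[of E] i by blast
      then show ?thesis unfolding u_def using x t by (auto simp: E_def algebra_simps)
    next
      assume t: "t > T2 + q * (x + c * t - x0)"
      define E where "E = {(s, r). s \<ge> 0 \<and> r > T2 + q * s}"
      have "backward_closed 4 a E"
        unfolding backward_closed_def E_def
      proof safe
        fix s r \<tau> :: real and j :: nat assume *: "0 \<le> s" "T2 + q * s < r" "j < 4" "\<tau> \<in> {0..1}"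
        then show "0 \<le> s * \<tau>" by simp
        have "a j * (s * (1 - \<tau>)) \<le> q * (s * (1 - \<tau>))"
          using * p0 by (intro mult_right_mono) auto
        then show "T2 + q * (s * \<tau>) < r - a j * s * (1 - \<tau>)"
          using * by (simp add: algebra_simps)
      qed
      moreover have "G j X = 0" if "j < 4" "X \<in> E" for j X
        using that q by (intro G0) (auto simp: E_def dest: mult_nonneg_nonneg[OF q])
      ultimately have "\<forall>X\<in>E. w i X = 0" using w(4)[of E] i by blast
      then show ?thesis unfolding u_def using x t by (auto simp: E_def algebra_simps)
    qed
  qed
qed

text \<open>The system treats z_t + z_x, z_t - z_x and z as independent unknowns, so their
  compatibility has to be propagated. As z is so far only C^1, mixed derivatives cannot be compared
  directly; instead the equation for z is integrated in t and the integral is differentiated in x.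
  The time in \<open>init\<close> may depend on x, which admits data on a slanted line.\<close>

lemma wave_system_constraint:
  assumes ws: "wave_system M F w wt wx" and F: "\<And>X. F 0 X = F 1 X" "\<And>X. F 2 X = 0"
    and init: "\<And>x. \<exists>t. wx 2 (t, x) = (w 0 (t, x) - w 1 (t, x)) / 2"
  shows "wx 2 X = (w 0 X - w 1 X) / 2"
proof -
  obtain t x where X: "X = (t, x)" by (cases X)
  have C: "C1 (w 0) (wt 0) (wx 0)" "C1 (w 1) (wt 1) (wx 1)" "C1 (w 2) (wt 2) (wx 2)"
    using ws by (auto simp: wave_system_iff)
  have eqs: "wt 0 X - wx 0 X = wt 1 X + wx 1 X" "wt 2 X = (w 0 X + w 1 X) / 2" for X
    using ws F(1) unfolding wave_system_iff
    by (metis, metis F(2) add.right_neutral)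
  have *: "wx 2 (t2, x) - wx 2 (t1, x) = (w 0 (t2, x) - w 1 (t2, x)) / 2 - (w 0 (t1, x) - w 1 (t1, x)) / 2"
    if le: "t1 \<le> t2" for t1 t2
  proof -
    let ?yx = "\<lambda>X. (wx 0 X + wx 1 X) / 2"
    have cyx: "continuous_on UNIV ?yx"
      using C by (auto simp: C1_def intro!: continuous_intros)
    have z: "w 2 (t2, \<xi>) - w 2 (t1, \<xi>) = integral (cbox t1 t2) (\<lambda>t. wt 2 (t, \<xi>))" for \<xi>
    proof -
      have "((\<lambda>t. wt 2 (t, \<xi>)) has_integral w 2 (t2, \<xi>) - w 2 (t1, \<xi>)) {t1..t2}"
        by (rule fundamental_theorem_of_calculus[OF le]) (rule C1_partial_fst[OF C(3)])
      then show ?thesis by (simp add: integral_unique)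
    qed
    have "((\<lambda>\<xi>. integral (cbox t1 t2) (\<lambda>t. wt 2 (t, \<xi>))) has_vector_derivative
      integral (cbox t1 t2) (\<lambda>t. ?yx (t, x))) (at x within UNIV)"
    proof (rule leibniz_rule_vector_derivative)
      show "((\<lambda>\<xi>. wt 2 (t, \<xi>)) has_vector_derivative ?yx (t, \<xi>)) (at \<xi> within UNIV)" for \<xi> t
        unfolding eqs(2)
        by (intro has_vector_derivative_divide has_vector_derivative_add C1_partial_snd[OF C(1)] C1_partial_snd[OF C(2)])
      show "(\<lambda>t. wt 2 (t, \<xi>)) integrable_on cbox t1 t2" for \<xi>
        by (intro integrable_continuous continuous_on_slice C1_continuous_partials(1)[OF C(3)])
      show "continuous_on (UNIV \<times> cbox t1 t2) (\<lambda>(\<xi>, t). ?yx (t, \<xi>))"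
        unfolding split_beta
        by (rule continuous_on_compose2[OF cyx]) (auto intro!: continuous_intros)
    qed auto
    moreover have "((\<lambda>\<xi>. w 2 (t2, \<xi>) - w 2 (t1, \<xi>)) has_vector_derivative wx 2 (t2, x) - wx 2 (t1, x)) (at x)"
      by (intro has_vector_derivative_diff C1_partial_snd[OF C(3)])
    ultimately have "wx 2 (t2, x) - wx 2 (t1, x) = integral (cbox t1 t2) (\<lambda>t. ?yx (t, x))"
      unfolding z using vector_derivative_unique_at by fastforce
    also have "((\<lambda>t. ?yx (t, x)) has_integral
      (w 0 (t2, x) - w 1 (t2, x)) / 2 - (w 0 (t1, x) - w 1 (t1, x)) / 2) {t1..t2}"
    proof (rule fundamental_theorem_of_calculus[OF le])
      fix t
      have "((\<lambda>t. (w 0 (t, x) - w 1 (t, x)) / 2) has_vector_derivative (wt 0 (t, x) - wt 1 (t, x)) / 2) (at t within {t1..t2})"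
        by (intro has_vector_derivative_divide has_vector_derivative_diff C1_partial_fst[OF C(1)] C1_partial_fst[OF C(2)])
      moreover have "wt 0 (t, x) - wt 1 (t, x) = wx 0 (t, x) + wx 1 (t, x)"
        using eqs(1)[of "(t, x)"] by (simp add: algebra_simps)
      ultimately show "((\<lambda>t. (w 0 (t, x) - w 1 (t, x)) / 2) has_vector_derivative ?yx (t, x)) (at t within {t1..t2})"
        by simp
    qed
    then have "integral (cbox t1 t2) (\<lambda>t. ?yx (t, x)) =
        (w 0 (t2, x) - w 1 (t2, x)) / 2 - (w 0 (t1, x) - w 1 (t1, x)) / 2"
      unfolding cbox_interval by (rule integral_unique)
    finally show ?thesis .
  qed
  from init obtain t0 where t0: "wx 2 (t0, x) = (w 0 (t0, x) - w 1 (t0, x)) / 2" by blast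
  show ?thesis
    using *[of t0 t] *[of t t0] t0 by (cases "t0 \<le> t") (auto simp: X)
qed

subsection \<open>Smooth cutoffs\<close>

text \<open>Smoothness is certified by one sequence containing all derivatives. The cutoffs are
  produced in this form, so that their higher derivatives have names.\<close>

lemma smooth_chain:
  assumes "\<And>n x. (g n has_vector_derivative g (Suc n) x) (at x)"
  shows "nderiv n (g 0) = g n" "smooth (g 0)"
proof -
  show *: "nderiv n (g 0) = g n" for n
  proof (induction n)
    case (Suc n)
    have "nderiv (Suc n) (g 0) = (\<lambda>x. vector_derivative (nderiv n (g 0)) (at x))"
      by (simp add: nderiv_def)
    also have "\<dots> = g (Suc n)"
      unfolding Suc using vector_derivative_at[OF assms] by auto
    finally show ?case .
  qed (simp add: nderiv_def)
  show "smooth (g 0)"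
    unfolding smooth_def * using assms differentiableI_vector by blast
qed

lemma smooth_nderiv: "smooth f \<Longrightarrow> (nderiv n f has_vector_derivative nderiv (Suc n) f x) (at x within S)"
proof -
  assume "smooth f"
  then have "(nderiv n f has_vector_derivative vector_derivative (nderiv n f) (at x)) (at x)"
    unfolding smooth_def by (simp add: vector_derivative_works[symmetric])
  then show ?thesis
    by (simp add: nderiv_def has_vector_derivative_at_within)
qed

lemma power_div_fact_le_exp:
  fixes x :: real
  assumes "0 \<le> x"
  shows "x ^ n / fact n \<le> exp x"
proof -
  have "(\<Sum>m\<in>{n}. x ^ m /\<^sub>R fact m) \<le> (\<Sum>m. x ^ m /\<^sub>R fact m)"
    using assms by (intro sum_le_suminf summable_exp_generic) auto
  then show ?thesis by (simp add: exp_def divide_inverse mult.commute)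
qed

text \<open>The functions P(x) w^(-m) exp(-1/w) with w = (x - a)(b - x), extended by zero. P = 1 and
  m = 0 give the standard bump, and the class is closed under differentiation.\<close>

definition flat :: "real \<Rightarrow> real \<Rightarrow> real poly \<Rightarrow> nat \<Rightarrow> real \<Rightarrow> real" where
  "flat a b P m x =
     (if a < x \<and> x < b then poly P x / ((x - a) * (b - x)) ^ m * exp (- 1 / ((x - a) * (b - x))) else 0)"

text \<open>The exponential beats every power: exp(-1/w) \<le> (m+2)! w^(m+2) leaves w^2 after
  division by w^m. Vanishing to second order at both ends forces derivative zero there.\<close>

lemma flat_quadratic_bound:
  assumes "a < b"
  obtains C where "C \<ge> 0" "\<And>x. \<bar>flat a b P m x\<bar> \<le> C * (x - a)\<^sup>2" "\<And>x. \<bar>flat a b P m x\<bar> \<le> C * (b - x)\<^sup>2"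
proof -
  have "bounded (poly P ` {a..b})"
    by (intro compact_imp_bounded compact_continuous_image continuous_intros) auto
  then obtain K where K: "\<And>x. x \<in> {a..b} \<Longrightarrow> \<bar>poly P x\<bar> \<le> K"
    unfolding bounded_iff by (metis image_eqI real_norm_def)
  have K0: "0 \<le> K" using K[of a] assms by auto
  define C where "C = K * fact (m + 2) * (b - a)\<^sup>2"
  have main: "\<bar>flat a b P m x\<bar> \<le> K * fact (m + 2) * ((x - a)\<^sup>2 * (b - x)\<^sup>2)" if x: "a < x" "x < b" for x
  proof -
    define w where "w = (x - a) * (b - x)"
    have w: "w > 0" using x by (simp add: w_def)
    have "(1 / w) ^ (m + 2) / fact (m + 2) \<le> exp (1 / w)"
      by (rule power_div_fact_le_exp) (use w in auto)
    then have "exp (- 1 / w) \<le> fact (m + 2) * w ^ (m + 2)"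
      using w by (simp add: exp_minus divide_simps power_one_over mult_ac del: fact_Suc)
    then have "\<bar>poly P x\<bar> / w ^ m * exp (- 1 / w) \<le> K / w ^ m * (fact (m + 2) * w ^ (m + 2))"
      using w K[of x] x K0 by (intro mult_mono divide_right_mono) auto
    also have "\<dots> = K * fact (m + 2) * w\<^sup>2"
      using w by (simp add: power_add power2_eq_square del: fact_Suc)
    finally show ?thesis
      using x w unfolding flat_def w_def[symmetric]
      by (simp add: abs_mult power_mult_distrib w_def del: fact_Suc)
  qed
  show thesis
  proof (rule that)
    show "C \<ge> 0" unfolding C_def using K0 by (intro mult_nonneg_nonneg) auto
    show "\<bar>flat a b P m x\<bar> \<le> C * (x - a)\<^sup>2" for x
    proof (cases "a < x \<and> x < b")
      case True
      have "(x - a)\<^sup>2 * (b - x)\<^sup>2 \<le> (x - a)\<^sup>2 * (b - a)\<^sup>2"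
        using True by (intro mult_left_mono power_mono) auto
      then have "K * fact (m + 2) * ((x - a)\<^sup>2 * (b - x)\<^sup>2) \<le> K * fact (m + 2) * ((x - a)\<^sup>2 * (b - a)\<^sup>2)"
        by (rule mult_left_mono) (use K0 in auto)
      moreover have "K * fact (m + 2) * ((x - a)\<^sup>2 * (b - a)\<^sup>2) = C * (x - a)\<^sup>2" by (simp add: C_def mult_ac)
      ultimately show ?thesis using main[of x] True by linarith
    qed (use \<open>C \<ge> 0\<close> in \<open>auto simp: flat_def\<close>)
    show "\<bar>flat a b P m x\<bar> \<le> C * (b - x)\<^sup>2" for x
    proof (cases "a < x \<and> x < b")
      case True
      have "(x - a)\<^sup>2 * (b - x)\<^sup>2 \<le> (b - a)\<^sup>2 * (b - x)\<^sup>2"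
        using True by (intro mult_right_mono power_mono) auto
      then have "K * fact (m + 2) * ((x - a)\<^sup>2 * (b - x)\<^sup>2) \<le> K * fact (m + 2) * ((b - a)\<^sup>2 * (b - x)\<^sup>2)"
        by (rule mult_left_mono) (use K0 in auto)
      moreover have "K * fact (m + 2) * ((b - a)\<^sup>2 * (b - x)\<^sup>2) = C * (b - x)\<^sup>2" by (simp add: C_def mult_ac)
      ultimately show ?thesis using main[of x] True by linarith
    qed (use \<open>C \<ge> 0\<close> in \<open>auto simp: flat_def\<close>)
  qed
qed

lemma DERIV_zero_quadratic:
  fixes f :: "real \<Rightarrow> real"
  assumes "\<And>x. \<bar>f x\<bar> \<le> C * (x - a)\<^sup>2"
  shows "(f has_real_derivative 0) (at a)"
proof -
  have fa: "f a = 0" using assms[of a] by simp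
  have "((\<lambda>h. (f (a + h) - f a) / h) \<longlongrightarrow> 0) (at 0)"
  proof (rule Lim_null_comparison)
    show "\<forall>\<^sub>F h in at 0. norm ((f (a + h) - f a) / h) \<le> \<bar>C\<bar> * \<bar>h\<bar>"
      unfolding eventually_at_filter
    proof (rule always_eventually, intro allI impI)
      fix h :: real assume "h \<noteq> 0"
      have "\<bar>f (a + h)\<bar> \<le> C * h\<^sup>2" using assms[of "a + h"] by simp
      also have "\<dots> \<le> \<bar>C\<bar> * \<bar>h\<bar> * \<bar>h\<bar>" by (simp add: power2_eq_square abs_mult_self_eq mult.assoc mult_right_mono)
      finally show "norm ((f (a + h) - f a) / h) \<le> \<bar>C\<bar> * \<bar>h\<bar>"
        using \<open>h \<noteq> 0\<close> by (simp add: fa divide_simps)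
    qed
    show "((\<lambda>h. \<bar>C\<bar> * \<bar>h\<bar>) \<longlongrightarrow> 0) (at 0)"
      by (auto intro!: tendsto_eq_intros)
  qed
  then show ?thesis by (simp add: DERIV_def)
qed

text \<open>The numerator in (P w^(-m) exp(-1/w))' = (P' w^2 - m P w' w + P w') w^(-m-2)
  exp(-1/w).\<close>

definition flat_num :: "real \<Rightarrow> real \<Rightarrow> real poly \<Rightarrow> nat \<Rightarrow> real poly" where
  "flat_num a b P m = (let w = [:- a, 1:] * [:b, -1:] in
     pderiv P * w\<^sup>2 - smult (real m) (P * pderiv w * w) + P * pderiv w)"

lemma flat_deriv:
  assumes "a < b"
  shows "(flat a b P m has_real_derivative flat a b (flat_num a b P m) (m + 2) x) (at x)"
proof -
  consider "a < x" "x < b" | "x = a" | "x = b" | "x < a" | "x > b" by linarith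
  then show ?thesis
  proof cases
    case 1
    define W where "W = [:- a, 1:] * [:b, -1:]"
    have W: "poly W y = (y - a) * (b - y)" for y by (simp add: W_def algebra_simps)
    have Wx: "poly W x > 0" using 1 by (simp add: W)
    have "((\<lambda>y. poly P y / poly W y ^ m * exp (- 1 / poly W y)) has_real_derivative
       poly (flat_num a b P m) x / poly W x ^ (m + 2) * exp (- 1 / poly W x)) (at x)"
    proof -
      let ?p = "poly P x" and ?p' = "poly (pderiv P) x" and ?w' = "poly (pderiv W) x"
      define v E where "v = inverse (poly W x)" and "E = exp (- v)"
      have Wv: "poly W x * v = 1" using Wx by (simp add: v_def)
      have iW: "((\<lambda>y. inverse (poly W y)) has_real_derivative - (?w' * v\<^sup>2)) (at x)"
        using Wx by (auto intro!: derivative_eq_intros poly_DERIV simp: v_def power2_eq_square)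
      have "((\<lambda>y. poly P y * inverse (poly W y) ^ m * exp (- inverse (poly W y))) has_real_derivative
          (?p' * v ^ m + ?p * (m * v ^ (m - 1) * - (?w' * v\<^sup>2))) * E + ?p * v ^ m * (E * (?w' * v\<^sup>2))) (at x)"
      proof -
        have 1: "((\<lambda>y. inverse (poly W y) ^ m) has_real_derivative m * v ^ (m - 1) * - (?w' * v\<^sup>2)) (at x)"
          using DERIV_power[OF iW, of m] by (simp add: v_def mult_ac)
        have 2: "((\<lambda>y. exp (- inverse (poly W y))) has_real_derivative E * (?w' * v\<^sup>2)) (at x)"
          using DERIV_fun_exp[OF DERIV_minus[OF iW]] by (simp add: v_def E_def)
        from DERIV_mult[OF DERIV_mult[OF poly_DERIV 1] 2]
        show ?thesis by (simp add: v_def E_def algebra_simps)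
      qed
      moreover have "(?p' * v ^ m + ?p * (m * v ^ (m - 1) * - (?w' * v\<^sup>2))) * E + ?p * v ^ m * (E * (?w' * v\<^sup>2))
          = poly (flat_num a b P m) x * v ^ (m + 2) * E"
      proof -
        \<comment> \<open>The factor m takes care of the case m = 0, where the exponent m - 1 is
          truncated.\<close>
        have k: "real m * v ^ (m - 1) * v\<^sup>2 = real m * v ^ (m + 1)"
          by (cases m) (simp_all add: power2_eq_square)
        have "poly W x * v ^ (m + 2) = (poly W x * v) * v ^ (m + 1)"
          by (simp add: power_add power2_eq_square)
        then have k1: "poly W x * v ^ (m + 2) = v ^ (m + 1)" unfolding Wv by simp
        have "(poly W x)\<^sup>2 * v ^ (m + 2) = (poly W x * v)\<^sup>2 * v ^ m"
          by (simp add: power_add power_mult_distrib power2_eq_square)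
        then have k2: "(poly W x)\<^sup>2 * v ^ (m + 2) = v ^ m" unfolding Wv by simp
        have fn: "flat_num a b P m = pderiv P * W\<^sup>2 - smult (real m) (P * pderiv W * W) + P * pderiv W"
          by (simp only: flat_num_def Let_def W_def)
        have "poly (flat_num a b P m) x * v ^ (m + 2) =
            ?p' * ((poly W x)\<^sup>2 * v ^ (m + 2)) - m * ?p * ?w' * (poly W x * v ^ (m + 2)) + ?p * ?w' * v ^ (m + 2)"
          unfolding fn poly_add poly_diff poly_mult poly_smult poly_power
          by (simp only: ring_distribs mult_ac)
        also have "\<dots> = ?p' * v ^ m - ?p * ?w' * (m * v ^ (m + 1)) + ?p * ?w' * v ^ (m + 2)"
          unfolding k1 k2 by (simp add: algebra_simps)
        also have "\<dots> = ?p' * v ^ m - ?p * ?w' * (m * v ^ (m - 1) * v\<^sup>2) + ?p * ?w' * (v ^ m * v\<^sup>2)"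
          unfolding k by (simp add: power_add power2_eq_square)
        finally have e: "poly (flat_num a b P m) x * v ^ (m + 2) =
            ?p' * v ^ m - ?p * ?w' * (m * v ^ (m - 1) * v\<^sup>2) + ?p * ?w' * (v ^ m * v\<^sup>2)" .
        show ?thesis unfolding e by (simp only: ring_distribs mult_ac mult_minus_left mult_minus_right)
      qed
      moreover have "(\<lambda>y. poly P y / poly W y ^ m * exp (- 1 / poly W y)) =
          (\<lambda>y. poly P y * inverse (poly W y) ^ m * exp (- inverse (poly W y)))"
        by (simp only: divide_inverse power_inverse mult_minus_left mult_1_left)
      moreover have "poly (flat_num a b P m) x / poly W x ^ (m + 2) * exp (- 1 / poly W x) =
          poly (flat_num a b P m) x * v ^ (m + 2) * E"
        by (simp only: v_def E_def divide_inverse power_inverse mult_minus_left mult_1_left)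
      ultimately show ?thesis by (simp only:)
    qed
    then have "((\<lambda>y. poly P y / poly W y ^ m * exp (- 1 / poly W y)) has_real_derivative
       flat a b (flat_num a b P m) (m + 2) x) (at x)"
      using 1 by (simp add: flat_def W)
    then show ?thesis
      by (rule has_field_derivative_transform_within_open[of _ _ _ "{a<..<b}"]) (use 1 in \<open>auto simp: flat_def W\<close>)
  next
    case 2
    obtain C where "\<And>x. \<bar>flat a b P m x\<bar> \<le> C * (x - a)\<^sup>2" by (rule flat_quadratic_bound[OF assms, of P m]) blast
    from DERIV_zero_quadratic[of "flat a b P m", OF this] show ?thesis using 2 by (simp add: flat_def)
  next
    case 3
    obtain C where "\<And>x. \<bar>flat a b P m x\<bar> \<le> C * (b - x)\<^sup>2" by (rule flat_quadratic_bound[OF assms, of P m]) blast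
    then have "\<And>x. \<bar>flat a b P m x\<bar> \<le> C * (x - b)\<^sup>2" by (simp add: power2_commute)
    from DERIV_zero_quadratic[of "flat a b P m", OF this] show ?thesis using 3 by (simp add: flat_def)
  next
    case 4
    have "((\<lambda>_. 0) has_real_derivative 0) (at x)" by simp
    then have "(flat a b P m has_real_derivative 0) (at x)"
      by (rule has_field_derivative_transform_within_open[of _ _ _ "{..<a}"]) (use 4 in \<open>auto simp: flat_def\<close>)
    then show ?thesis using 4 by (simp add: flat_def)
  next
    case 5
    have "((\<lambda>_. 0) has_real_derivative 0) (at x)" by simp
    then have "(flat a b P m has_real_derivative 0) (at x)"
      by (rule has_field_derivative_transform_within_open[of _ _ _ "{b<..}"]) (use 5 in \<open>auto simp: flat_def\<close>)
    then show ?thesis using 5 by (simp add: flat_def)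
  qed
qed

lemma smooth_bump:
  fixes a b :: real
  assumes "a < b"
  obtains \<beta> :: "nat \<Rightarrow> real \<Rightarrow> real" where
    "\<And>n x. (\<beta> n has_real_derivative \<beta> (Suc n) x) (at x)"
    "\<And>n x. x \<notin> {a<..<b} \<Longrightarrow> \<beta> n x = 0" "\<And>x. x \<in> {a<..<b} \<Longrightarrow> \<beta> 0 x > 0"
proof -
  \<comment> \<open>Each differentiation raises the power of w in the denominator by 2, so the nth
    derivative carries the exponent 2 n.\<close>
  define \<beta> where "\<beta> n = flat a b (rec_nat 1 (\<lambda>k P. flat_num a b P (2 * k)) n) (2 * n)" for n
  show thesis
  proof (rule that)
    show "(\<beta> n has_real_derivative \<beta> (Suc n) x) (at x)" for n x
      using flat_deriv[OF assms, of _ "2 * n" x] by (simp add: \<beta>_def)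
  qed (auto simp: \<beta>_def flat_def)
qed

text \<open>A primitive of the bump, normalized to rise from 0 to 1. The sign of its first
  derivative is recorded because that derivative later serves as an approximate Dirac mass.\<close>

lemma smooth_step:
  fixes a b :: real
  assumes "a < b"
  obtains \<sigma> :: "nat \<Rightarrow> real \<Rightarrow> real" where
    "\<And>n x. (\<sigma> n has_real_derivative \<sigma> (Suc n) x) (at x)"
    "\<And>x. x \<le> a \<Longrightarrow> \<sigma> 0 x = 0" "\<And>x. x \<ge> b \<Longrightarrow> \<sigma> 0 x = 1"
    "\<And>n x. x \<notin> {a<..<b} \<Longrightarrow> \<sigma> (Suc n) x = 0" "\<And>x. \<sigma> (Suc 0) x \<ge> 0"
proof -
  obtain \<beta> :: "nat \<Rightarrow> real \<Rightarrow> real" where \<beta>: "\<And>n x. (\<beta> n has_real_derivative \<beta> (Suc n) x) (at x)"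
    "\<And>n x. x \<notin> {a<..<b} \<Longrightarrow> \<beta> n x = 0" "\<And>x. x \<in> {a<..<b} \<Longrightarrow> \<beta> 0 x > 0"
    by (rule smooth_bump[OF assms]) (rule that)
  have "continuous_on UNIV (\<beta> 0)"
    by (rule continuous_at_imp_continuous_on) (use DERIV_isCont[OF \<beta>(1)[of 0]] in blast)
  define I where "I s = s *\<^sub>R integral {0..1} (\<lambda>\<tau>. \<beta> 0 (s * \<tau>))" for s
  have I: "(I has_real_derivative \<beta> 0 x) (at x)" for x
    using has_vector_derivative_integral_scaled[OF \<open>continuous_on UNIV (\<beta> 0)\<close>, of x]
    unfolding I_def by (simp add: has_real_derivative_iff_has_vector_derivative)
  have cI: "continuous_on A I" for A
    by (rule continuous_at_imp_continuous_on) (use DERIV_isCont[OF I] in blast)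
  have I0: "(I has_real_derivative 0) (at x)" if "x \<notin> {a<..<b}" for x
    using I[of x] \<beta>(2)[OF that] by simp
  have left: "I x = I a" if "x \<le> a" for x
  proof (cases "x = a")
    case False
    have "I a = I x"
      by (rule DERIV_isconst_end[OF _ cI I0]) (use that False in auto)
    then show ?thesis by simp
  qed simp
  have right: "I x = I b" if "x \<ge> b" for x
  proof (cases "x = b")
    case False
    show "I x = I b"
      by (rule DERIV_isconst_end[OF _ cI I0]) (use that False in auto)
  qed simp
  have pos: "I a < I b"
  proof (rule DERIV_pos_imp_increasing_open[OF assms _ cI])
    fix x assume "a < x" "x < b"
    then show "\<exists>y. (I has_real_derivative y) (at x) \<and> 0 < y"
      using I[of x] \<beta>(3)[of x] by auto
  qed
  define \<sigma> where "\<sigma> n = (case n of 0 \<Rightarrow> \<lambda>x. (I x - I a) / (I b - I a) | Suc k \<Rightarrow> \<lambda>x. \<beta> k x / (I b - I a))" for n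
  show thesis
  proof (rule that)
    show "(\<sigma> n has_real_derivative \<sigma> (Suc n) x) (at x)" for n x
      unfolding \<sigma>_def using pos by (cases n) (auto intro!: derivative_eq_intros I \<beta>(1))
    show "\<sigma> 0 x = 0" if "x \<le> a" for x using left[OF that] by (simp add: \<sigma>_def)
    show "\<sigma> 0 x = 1" if "x \<ge> b" for x using right[OF that] pos by (simp add: \<sigma>_def)
    show "\<sigma> (Suc n) x = 0" if "x \<notin> {a<..<b}" for n x using \<beta>(2)[OF that] by (simp add: \<sigma>_def)
    show "\<sigma> (Suc 0) x \<ge> 0" for x
      using \<beta>(2)[of x 0] \<beta>(3)[of x] pos by (cases "x \<in> {a<..<b}") (simp_all add: \<sigma>_def less_imp_le del: greaterThanLessThan_iff)
  qed
qed

subsection \<open>Steering on a strip\<close>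

text \<open>
  \<open>z = \<integral> y\<close> is a classical solution with control \<open>f\<close>; the remaining arguments are
  \<open>y = z\<^sub>t\<close>, \<open>p = z\<^sub>x\<close>, \<open>v = z\<^sub>t\<^sub>t\<close>, \<open>q = z\<^sub>t\<^sub>x\<close>, \<open>r = z\<^sub>x\<^sub>x\<close>, \<open>h\<close> as above, \<open>k = h\<^sub>t\<close>, \<open>l = h\<^sub>x\<close>.
  The function \<open>z\<close> itself is only twice differentiable.
\<close>

definition strong_sol ::
  "real \<Rightarrow> (real \<times> real \<Rightarrow> complex) \<Rightarrow> (real \<times> real \<Rightarrow> complex) \<Rightarrow> (real \<times> real \<Rightarrow> complex) \<Rightarrow>
   (real \<times> real \<Rightarrow> complex) \<Rightarrow> (real \<times> real \<Rightarrow> complex) \<Rightarrow> (real \<times> real \<Rightarrow> complex) \<Rightarrow>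
   (real \<times> real \<Rightarrow> complex) \<Rightarrow> (real \<times> real \<Rightarrow> complex) \<Rightarrow> (real \<times> real \<Rightarrow> complex) \<Rightarrow>
   (real \<times> real \<Rightarrow> complex) \<Rightarrow> bool" where
  "strong_sol M z y p v q r h k l f \<longleftrightarrow> C1 z y p \<and> C1 y v q \<and> C1 p q r \<and> C1 h k l \<and>
     (\<forall>X. h X = v X - r X + complex_of_real M * y X + (complex_of_real M)\<^sup>2 * z X) \<and>
     (\<forall>X. f X = k X - complex_of_real M * h X + (complex_of_real M) ^ 3 * z X)"

lemma has_vector_derivative_of_real:
  "(g has_real_derivative g') F \<Longrightarrow> ((\<lambda>x. complex_of_real (g x)) has_vector_derivative of_real g') F"
  using bounded_linear.has_vector_derivative[OF bounded_linear_of_real, of g g' F]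
  by (simp add: has_real_derivative_iff_has_vector_derivative)

lemma C1_real_plane_wave:
  assumes "\<And>x. (g has_real_derivative g' x) (at x)" "\<And>x. (g' has_real_derivative g'' x) (at x)"
  shows "C1 (\<lambda>X. complex_of_real (g (k * fst X + l * snd X + d)))
    (\<lambda>X. k * complex_of_real (g' (k * fst X + l * snd X + d)))
    (\<lambda>X. l * complex_of_real (g' (k * fst X + l * snd X + d)))"
proof (rule C1_plane_wave)
  show "((\<lambda>x. complex_of_real (g x)) has_vector_derivative complex_of_real (g' x)) (at x)" for x
    by (rule has_vector_derivative_of_real[OF assms(1)])
  show "continuous_on UNIV (\<lambda>x. complex_of_real (g' x))"
    by (intro continuous_on_of_real continuous_at_imp_continuous_on) (use DERIV_isCont[OF assms(2)] in blast)
qed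

lemma C1_divide2: "C1 F Ft Fx \<Longrightarrow> C1 (\<lambda>X. F X / 2) (\<lambda>X. Ft X / 2) (\<lambda>X. Fx X / 2)"
  using C1_cmul[of F Ft Fx "1 / 2"] by simp

text \<open>Second derivatives of z are first derivatives of the components. The constraint
  identifies z_x, and the common right-hand side of the first two equations makes the mixed
  derivatives of z agree.\<close>

lemma wave_system_strong_sol:
  assumes ws: "wave_system M (\<lambda>_ _. 0) w wt wx" and cs: "\<And>X. wx 2 X = (w 0 X - w 1 X) / 2"
  shows "strong_sol M (w 2) (\<lambda>X. (w 0 X + w 1 X) / 2) (\<lambda>X. (w 0 X - w 1 X) / 2)
    (\<lambda>X. (wt 0 X + wt 1 X) / 2) (\<lambda>X. (wx 0 X + wx 1 X) / 2) (\<lambda>X. (wx 0 X - wx 1 X) / 2)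
    (w 3) (wt 3) (wx 3) (\<lambda>_. 0)"
proof -
  have C: "C1 (w 0) (wt 0) (wx 0)" "C1 (w 1) (wt 1) (wx 1)" "C1 (w 2) (wt 2) (wx 2)" "C1 (w 3) (wt 3) (wx 3)"
    and e: "\<And>X. wt 0 X - wx 0 X = w 3 X - M / 2 * (w 0 X + w 1 X) - M^2 * w 2 X"
      "\<And>X. wt 1 X + wx 1 X = w 3 X - M / 2 * (w 0 X + w 1 X) - M^2 * w 2 X"
      "\<And>X. wt 2 X = (w 0 X + w 1 X) / 2" "\<And>X. wt 3 X = M * w 3 X - M^3 * w 2 X"
    using ws by (auto simp: wave_system_iff simp del: split_paired_All)
  have e01: "wt 0 X = wx 0 X + (w 3 X - M / 2 * (w 0 X + w 1 X) - M^2 * w 2 X)"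
    "wt 1 X = (w 3 X - M / 2 * (w 0 X + w 1 X) - M^2 * w 2 X) - wx 1 X" for X
    subgoal unfolding e(1)[of X, symmetric] by simp
    subgoal unfolding e(2)[of X, symmetric] by simp
    done
  show ?thesis
    unfolding strong_sol_def
  proof (intro conjI allI)
    show "C1 (w 2) (\<lambda>X. (w 0 X + w 1 X) / 2) (\<lambda>X. (w 0 X - w 1 X) / 2)"
      by (rule C1_cong[OF C(3)]) (simp_all add: e cs)
    show "C1 (\<lambda>X. (w 0 X + w 1 X) / 2) (\<lambda>X. (wt 0 X + wt 1 X) / 2) (\<lambda>X. (wx 0 X + wx 1 X) / 2)"
      by (intro C1_divide2 C1_add C)
    show "C1 (\<lambda>X. (w 0 X - w 1 X) / 2) (\<lambda>X. (wx 0 X + wx 1 X) / 2) (\<lambda>X. (wx 0 X - wx 1 X) / 2)"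
      by (rule C1_cong[OF C1_divide2[OF C1_diff[OF C(1,2)]]]) (simp_all add: e01 field_simps del: One_nat_def)
    show "w 3 X = (wt 0 X + wt 1 X) / 2 - (wx 0 X - wx 1 X) / 2 + M * ((w 0 X + w 1 X) / 2) + (complex_of_real M)\<^sup>2 * w 2 X" for X
      unfolding e01 by (simp add: field_simps)
    show "0 = wt 3 X - M * w 3 X + (complex_of_real M) ^ 3 * w 2 X" for X
      unfolding e by simp
  qed (rule C)
qed

text \<open>The cutoff multiplies z, so z_t \<plusminus> z_x acquire the extra term \<eta>' z. The
  resulting sources are equal in the first two equations and zero in the third, as
  \<open>wave_system_constraint\<close> demands. The component h is multiplied by \<eta> and not
  recomputed from \<eta> z: recomputing would bring 2 \<eta>' z_tt, which is merely continuous, into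
  the source, whereas here the source stays C^1.\<close>

lemma wave_system_time_cutoff:
  assumes ws: "wave_system M (\<lambda>_ _. 0) w wt wx" and cs: "\<And>X. wx 2 X = (w 0 X - w 1 X) / 2"
    and der: "\<And>n t. (\<eta> n has_real_derivative \<eta> (Suc n) t) (at t)"
  shows "wave_system M
    (\<lambda>i X. if i < 2 then \<eta> 1 (fst X) * (w 0 X + w 1 X) + (\<eta> 2 (fst X) + M * \<eta> 1 (fst X)) * w 2 X
       else if i = 2 then 0 else \<eta> 1 (fst X) * w i X)
    (\<lambda>i X. \<eta> 0 (fst X) * w i X + (if i < 2 then \<eta> 1 (fst X) * w 2 X else 0))
    (\<lambda>i X. \<eta> 1 (fst X) * w i X + \<eta> 0 (fst X) * wt i X
       + (if i < 2 then \<eta> 2 (fst X) * w 2 X + \<eta> 1 (fst X) * wt 2 X else 0))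
    (\<lambda>i X. \<eta> 0 (fst X) * wx i X + (if i < 2 then \<eta> 1 (fst X) * wx 2 X else 0))"
    (is "wave_system M ?F ?u ?ut ?ux")
proof -
  have C: "\<And>i. i < 4 \<Longrightarrow> C1 (w i) (wt i) (wx i)"
    and e: "\<And>X. wt 0 X - wx 0 X = w 3 X - M / 2 * (w 0 X + w 1 X) - M^2 * w 2 X"
      "\<And>X. wt 1 X + wx 1 X = w 3 X - M / 2 * (w 0 X + w 1 X) - M^2 * w 2 X"
      "\<And>X. wt 2 X = (w 0 X + w 1 X) / 2" "\<And>X. wt 3 X = M * w 3 X - M^3 * w 2 X"
    using ws by (auto simp: wave_system_iff simp del: split_paired_All)
  have e01: "wt 0 X = wx 0 X + (w 3 X - M / 2 * (w 0 X + w 1 X) - M^2 * w 2 X)"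
    "wt 1 X = (w 3 X - M / 2 * (w 0 X + w 1 X) - M^2 * w 2 X) - wx 1 X" for X
    subgoal unfolding e(1)[of X, symmetric] by simp
    subgoal unfolding e(2)[of X, symmetric] by simp
    done
  have C\<eta>: "C1 (\<lambda>X. complex_of_real (\<eta> n (fst X))) (\<lambda>X. complex_of_real (\<eta> (Suc n) (fst X))) (\<lambda>_. 0)" for n
    using C1_real_plane_wave[OF der[of n] der[of "Suc n"], of 1 0 0] by simp
  have "C1 (?u i) (?ut i) (?ux i)" if i: "i < 4" for i
  proof (cases "i < 2")
    case True
    show ?thesis
      by (rule C1_cong[OF C1_add[OF C1_mult[OF C\<eta>[of 0] C[OF i]] C1_mult[OF C\<eta>[of 1] C[of 2]]]])
        (use True in \<open>simp_all add: numeral_2_eq_2\<close>)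
  next
    case False
    show ?thesis
      by (rule C1_cong[OF C1_mult[OF C\<eta>[of 0] C[OF i]]]) (use False in simp_all)
  qed
  then show ?thesis
    unfolding wave_system_iff
    by (auto simp: e01 e(3,4) cs field_simps simp del: split_paired_All One_nat_def)
qed

text \<open>Everything depends on where the window [T1, T2] of the time cutoff is placed: T1 has to
  exceed the backward spread over a strip of width L, and T2 has to stay below T by more than the
  forward spread.\<close>

lemma strip_solution:
  fixes c T M x0 \<epsilon> :: real and Y0 Y1 Y0' Y1' :: "real \<Rightarrow> complex"
  assumes c: "c \<notin> {-1, 0, 1}"
    and T: "T > 2 * pi * (1 / \<bar>c\<bar> + 1 / \<bar>1 - c\<bar> + 1 / \<bar>1 + c\<bar>)"
    and Y0: "\<And>x. (Y0 has_vector_derivative Y0' x) (at x)" "continuous_on UNIV Y0'"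
    and Y1: "\<And>x. (Y1 has_vector_derivative Y1' x) (at x)" "continuous_on UNIV Y1'"
    and bd: "\<And>x. norm (Y0 x) \<le> K" "\<And>x. norm (Y0' x) \<le> K" "\<And>x. norm (Y1 x) \<le> K" "\<And>x. norm (Y1' x) \<le> K"
    and \<epsilon>: "\<epsilon> > 0"
  obtains \<epsilon>' \<delta> z y p v q r h k l where "0 < \<epsilon>'" "\<epsilon>' \<le> \<epsilon>" "0 < \<delta>" "\<delta> < T"
    "strong_sol M z y p v q r h k l (\<lambda>_. 0)"
    "\<And>x. x0 < x \<Longrightarrow> x < x0 + 2 * pi + \<epsilon>' \<Longrightarrow> z (0, x) = 0 \<and> y (0, x) = Y0 x \<and> v (0, x) = Y1 x"
    "\<And>t x. x0 < x + c * t \<Longrightarrow> x + c * t < x0 + 2 * pi + \<epsilon>' \<Longrightarrow> T - \<delta> < t \<Longrightarrow> z (t, x) = 0"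
proof -
  define S where "S = 1 / \<bar>c\<bar> + 1 / \<bar>1 - c\<bar> + 1 / \<bar>1 + c\<bar>"
  \<comment> \<open>Each family drifts in one direction of time only. P adds the backward rates and
    Q the forward ones; every reciprocal contributes to exactly one of them, so that P + Q =
    S.\<close>
  define P where "P = max 0 (- 1 / (c - 1)) + max 0 (- 1 / (c + 1)) + max 0 (- 1 / c)"
  define Q where "Q = max 0 (1 / (c - 1)) + max 0 (1 / (c + 1)) + max 0 (1 / c)"
  have c': "c \<noteq> 0" "c \<noteq> 1" "c \<noteq> -1" using c by auto
  have mm: "max 0 (- 1 / a) + max 0 (1 / a) = 1 / \<bar>a\<bar>" for a :: real
    by (cases "a \<ge> 0") (auto simp: max_def divide_simps)
  have PQ: "P + Q = S"
    using mm[of "c - 1"] mm[of "c + 1"] mm[of c]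
    unfolding P_def Q_def S_def by (simp add: abs_minus_commute add.commute)
  have P0: "P \<ge> 0" and Q0: "Q \<ge> 0" by (auto simp: P_def Q_def)
  have pq: "- P \<le> 1 / (c + spd i) \<and> 1 / (c + spd i) \<le> Q" for i
  proof -
    have aux: "a \<le> max 0 a + max 0 b + max 0 d" "b \<le> max 0 a + max 0 b + max 0 d" "d \<le> max 0 a + max 0 b + max 0 d"
      for a b d :: real by (auto simp: max_def)
    show ?thesis
      using aux[where a = "1 / (c - 1)" and b = "1 / (c + 1)" and d = "1 / c"]
        aux[where a = "- 1 / (c - 1)" and b = "- 1 / (c + 1)" and d = "- 1 / c"]
      unfolding P_def Q_def spd_def by auto
  qed
  have S0: "S > 0" using c' by (auto simp: S_def intro!: add_pos_pos)
  \<comment> \<open>An eighth of the spare time. One share pays for the overlap of the strip, one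
    for a positive starting time, one for the width of the window, and the final interval on which z
    vanishes has length g.\<close>
  define g where "g = (T - 2 * pi * S) / 8"
  have g0: "g > 0" using T by (simp add: g_def S_def)
  \<comment> \<open>The excess of the strip over one period, small enough to cost at most g of
    time.\<close>
  define \<epsilon>' where "\<epsilon>' = min \<epsilon> (g / S)"
  have \<epsilon>': "0 < \<epsilon>'" "\<epsilon>' \<le> \<epsilon>" "\<epsilon>' * S \<le> g"
    using \<epsilon> g0 S0 by (auto simp: \<epsilon>'_def min_def field_simps)
  define L where "L = 2 * pi + \<epsilon>'"
  define T1 where "T1 = P * L + g"
  define T2 where "T2 = T1 + g"
  have LS: "L * S \<le> T - 7 * g" 
  proof -
    have "2 * pi * S = T - 8 * g" by (simp add: g_def field_simps)
    moreover have "L * S = 2 * pi * S + \<epsilon>' * S" by (simp add: L_def distrib_right)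
    ultimately show ?thesis using \<epsilon>'(3) by linarith
  qed
  have L0: "L > 0" using \<epsilon>' by (auto simp: L_def intro: add_pos_pos)
  have T2: "T2 + Q * L \<le> T - 5 * g" using LS unfolding T2_def T1_def PQ[symmetric] by (simp add: algebra_simps)
  have T10: "T1 > 0" unfolding T1_def using P0 L0 g0 by (intro add_nonneg_pos mult_nonneg_nonneg) auto
  have QL: "0 \<le> Q * L" using Q0 L0 by simp
  have gT: "g < T" using QL T2 T10 g0 by (simp add: T2_def)

  \<comment> \<open>z(0) = 0 entails z_x(0) = 0, so both of the first components start from Y0, and
    h(0) = Y1 + M Y0.\<close>
  define gg where "gg i = (if i < 2 then Y0 else if i = 2 then (\<lambda>_. 0) else (\<lambda>x. Y1 x + M * Y0 x))" for i :: nat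
  define gg' where "gg' i = (if i < 2 then Y0' else if i = 2 then (\<lambda>_. 0) else (\<lambda>x. Y1' x + M * Y0' x))" for i :: nat
  have K0: "0 \<le> K" using order_trans[OF norm_ge_zero bd(1)] .
  obtain w wt wx where w: "wave_system M (\<lambda>_ _. 0) w wt wx" "\<And>i x. i < 4 \<Longrightarrow> w i (0, x) = gg i x"
  proof (rule time_evolution[of gg gg' "K + \<bar>M\<bar> * K"])
    show "(gg i has_vector_derivative gg' i x) (at x)" for i x
      unfolding gg_def gg'_def using Y0 Y1 by (auto intro!: derivative_eq_intros)
    show "continuous_on UNIV (gg' i)" for i
      unfolding gg'_def using Y0 Y1 by (auto intro!: continuous_intros)
    have "norm (a + complex_of_real M * b) \<le> K + \<bar>M\<bar> * K" if "norm a \<le> K" "norm b \<le> K" for a b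
      using that by (intro norm_triangle_mono) (auto simp: norm_mult intro: mult_left_mono)
    moreover have "K \<le> K + \<bar>M\<bar> * K" using K0 by simp
    ultimately show "norm (gg i x) \<le> K + \<bar>M\<bar> * K \<and> norm (gg' i x) \<le> K + \<bar>M\<bar> * K" for i x
      using bd K0 order_trans[OF bd(1)[of x]] order_trans[OF bd(2)[of x]] by (auto simp: gg_def gg'_def)
  qed (rule that)
  have Cw: "C1 (w i) (wt i) (wx i)" if "i < 4" for i
    using w(1) that by (auto simp: wave_system_def)
  have wx0: "wx i (0, x) = gg' i x" if "i < 4" for i x
  proof -
    have "((\<lambda>x. w i (0, x)) has_vector_derivative gg' i x) (at x)"
      unfolding w(2)[OF that] gg_def gg'_def using Y0 Y1 by (auto intro!: derivative_eq_intros)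
    then show ?thesis
      using C1_partial_snd[OF Cw[OF that], of 0 x UNIV] vector_derivative_unique_at by blast
  qed
  have cs: "wx 2 X = (w 0 X - w 1 X) / 2" for X
  proof (rule wave_system_constraint[OF w(1)])
    show "\<exists>t. wx 2 (t, x) = (w 0 (t, x) - w 1 (t, x)) / 2" for x
      using wx0[of 2 x] w(2)[of 0 x] w(2)[of 1 x] by (intro exI[of _ 0]) (simp add: gg_def gg'_def)
  qed auto

  obtain \<sigma> :: "nat \<Rightarrow> real \<Rightarrow> real" where \<sigma>:
    "\<And>n x. (\<sigma> n has_real_derivative \<sigma> (Suc n) x) (at x)"
    "\<And>x. x \<le> T1 \<Longrightarrow> \<sigma> 0 x = 0" "\<And>x. x \<ge> T2 \<Longrightarrow> \<sigma> 0 x = 1"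
    "\<And>n x. x \<notin> {T1<..<T2} \<Longrightarrow> \<sigma> (Suc n) x = 0"
    by (rule smooth_step[of T1 T2]) (use g0 in \<open>simp add: T2_def\<close>, rule that)
  define \<eta> where "\<eta> n = (case n of 0 \<Rightarrow> \<lambda>t. 1 - \<sigma> 0 t | Suc m \<Rightarrow> \<lambda>t. - \<sigma> (Suc m) t)" for n
  have \<eta>: "(\<eta> n has_real_derivative \<eta> (Suc n) x) (at x)" for n x
    unfolding \<eta>_def by (cases n) (auto intro!: derivative_eq_intros \<sigma>(1))
  have \<eta>0: "\<eta> (Suc n) t = 0" if "t \<notin> {T1<..<T2}" for n t
    using \<sigma>(4)[OF that] by (simp add: \<eta>_def)
  note cut = wave_system_time_cutoff[where w = w and wt = wt and wx = wx and \<eta> = \<eta>, OF w(1) cs \<eta>]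
  \<comment> \<open>The source created by the cutoff. It vanishes outside [T1, T2]; the correction
    is driven by its negative, so that the sum of both solutions is free of sources on the whole
    plane.\<close>
  define F where "F i X = (if i < 2 then \<eta> 1 (fst X) * (w 0 X + w 1 X) + (complex_of_real (\<eta> 2 (fst X)) + complex_of_real M * complex_of_real (\<eta> 1 (fst X))) * w 2 X
       else if i = 2 then 0 else \<eta> 1 (fst X) * w i X)" for i :: nat and X
  have C\<eta>: "C1 (\<lambda>X. complex_of_real (\<eta> n (fst X))) (\<lambda>X. complex_of_real (\<eta> (Suc n) (fst X))) (\<lambda>_. 0)" for n
    using C1_real_plane_wave[OF \<eta>[of n] \<eta>[of "Suc n"], of 1 0 0] by simp
  have "\<exists>Ft Fx. C1 (\<lambda>X. - F i X) Ft Fx" if "i < 4" for i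
  proof -
    consider "i < 2" | "i = 2" | "i > 2" by linarith
    then have "\<exists>Ft Fx. C1 (F i) Ft Fx"
    proof cases
      case 1
      then have "F i = (\<lambda>X. \<eta> 1 (fst X) * (w 0 X + w 1 X) + (complex_of_real (\<eta> 2 (fst X)) + complex_of_real M * complex_of_real (\<eta> 1 (fst X))) * w 2 X)"
        by (simp add: F_def fun_eq_iff)
      then show ?thesis
        using C1_add[OF C1_mult[OF C\<eta>[of 1] C1_add[OF Cw[of 0] Cw[of 1]]]
            C1_mult[OF C1_add[OF C\<eta>[of 2] C1_cmul[OF C\<eta>[of 1], of M]] Cw[of 2]]] by auto
    next
      case 2
      then have "F i = (\<lambda>X. 0)" by (simp add: F_def fun_eq_iff)
      then show ?thesis using C1_const[of 0] by auto
    next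
      case 3
      then have "F i = (\<lambda>X. \<eta> 1 (fst X) * w i X)" by (simp add: F_def fun_eq_iff)
      then show ?thesis using C1_mult[OF C\<eta>[of 1] Cw[OF that]] by auto
    qed
    then obtain Ft Fx where "C1 (F i) Ft Fx" by blast
    from C1_cmul[OF this, of "-1"] show ?thesis by auto
  qed
  then have "\<forall>i. \<exists>Ft Fx. i < 4 \<longrightarrow> C1 (\<lambda>X. - F i X) Ft Fx" by blast
  then obtain Ft Fx where CF: "\<And>i. i < 4 \<Longrightarrow> C1 (\<lambda>X. - F i X) (Ft i) (Fx i)" by metis
  obtain u ut ux where u: "wave_system M (\<lambda>i X. - F i X) u ut ux"
    "\<And>i t x. i < 4 \<Longrightarrow> x + c * t = x0 \<Longrightarrow> u i (t, x) = 0"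
    "\<And>i t x. i < 4 \<Longrightarrow> x + c * t \<ge> x0 \<Longrightarrow> t < T1 - P * (x + c * t - x0) \<or> t > T2 + Q * (x + c * t - x0) \<Longrightarrow> u i (t, x) = 0"
  proof (rule space_evolution[where ?T1.0 = T1 and ?T2.0 = T2 and p = P and q = Q and ?x0.0 = x0 and M = M, OF c' CF])
    show "- F i (t, x) = 0" if "t \<notin> {T1..T2}" for i t x
      using \<eta>0[of t 0] \<eta>0[of t 1] that by (auto simp: F_def numeral_2_eq_2)
  qed (use pq P0 Q0 in \<open>auto intro: that\<close>)
  have F01: "F 0 X = F 1 X" "F 2 X = 0" for X by (simp_all add: F_def)
  define hw where "hw i X = \<eta> 0 (fst X) * w i X + (if i < 2 then \<eta> 1 (fst X) * w 2 X else 0)" for i :: nat and X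
  define ht where "ht i X = \<eta> 1 (fst X) * w i X + \<eta> 0 (fst X) * wt i X
       + (if i < 2 then \<eta> 2 (fst X) * w 2 X + \<eta> 1 (fst X) * wt 2 X else 0)" for i :: nat and X
  define hx where "hx i X = \<eta> 0 (fst X) * wx i X + (if i < 2 then \<eta> 1 (fst X) * wx 2 X else 0)" for i :: nat and X
  have "wave_system M F hw ht hx"
    using cut unfolding F_def[abs_def] hw_def[abs_def] ht_def[abs_def] hx_def[abs_def] .
  from wave_system_add[OF this u(1)]
  have sys: "wave_system M (\<lambda>_ _. 0) (\<lambda>i X. hw i X + u i X) (\<lambda>i X. ht i X + ut i X) (\<lambda>i X. hx i X + ux i X)"
    by simp
  have Cu: "C1 (u i) (ut i) (ux i)" if "i < 4" for i
    using u(1) that by (auto simp: wave_system_def)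
  \<comment> \<open>The compatibility is checked on the line x + c t = x0. The correction vanishes
    there, hence so does its derivative along the line, \<open>ut 2 - c * ux 2\<close>; the third
    equation gives \<open>ut 2 = 0\<close>, and c \<noteq> 0 leaves \<open>ux 2 = 0\<close>.\<close>
  have csW: "hx 2 X + ux 2 X = ((hw 0 X + u 0 X) - (hw 1 X + u 1 X)) / 2" for X
  proof (rule wave_system_constraint[where w = "\<lambda>i X. hw i X + u i X" and wt = "\<lambda>i X. ht i X + ut i X" and wx = "\<lambda>i X. hx i X + ux i X", OF sys])
    fix x
    define t where "t = (x0 - x) / c"
    have line: "x + c * t = x0" using c' by (simp add: t_def)
    have u0: "u i (t, x) = 0" if "i < 4" for i using u(2)[OF that line] .
    have "C1 (\<lambda>X. u 2 (1 * fst X + 0 * snd X + 0, - c * fst X + 0 * snd X + x0))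
       (\<lambda>X. 1 * ut 2 (1 * fst X + 0 * snd X + 0, - c * fst X + 0 * snd X + x0)
         + (- c) * ux 2 (1 * fst X + 0 * snd X + 0, - c * fst X + 0 * snd X + x0))
       (\<lambda>X. 0 * ut 2 (1 * fst X + 0 * snd X + 0, - c * fst X + 0 * snd X + x0)
         + 0 * ux 2 (1 * fst X + 0 * snd X + 0, - c * fst X + 0 * snd X + x0))"
      using C1_affine[OF Cu[of 2], of 1 0 0 "- c" 0 x0] by simp
    from C1_unique(1)[OF this C1_const[of 0] open_UNIV, of "(t, 0)"]
    have "ut 2 (t, - c * t + x0) - c * ux 2 (t, - c * t + x0) = 0"
      using u(2)[of 2] by simp
    moreover have "- c * t + x0 = x" using line by simp
    moreover have "ut 2 (t, x) = (u 0 (t, x) + u 1 (t, x)) / 2 + - F 2 (t, x)"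
      using u(1) unfolding wave_system_iff by blast
    ultimately have "ux 2 (t, x) = 0" using c' u0[of 0] u0[of 1] F01(2) by simp
    then have "hx 2 (t, x) + ux 2 (t, x) = ((hw 0 (t, x) + u 0 (t, x)) - (hw 1 (t, x) + u 1 (t, x))) / 2"
      using u0[of 0] u0[of 1] by (simp add: hx_def hw_def cs field_simps)
    then show "\<exists>t. hx 2 (t, x) + ux 2 (t, x) = ((hw 0 (t, x) + u 0 (t, x)) - (hw 1 (t, x) + u 1 (t, x))) / 2"
      by blast
  qed auto
  show thesis
  proof (rule that[OF \<epsilon>'(1,2) g0 gT wave_system_strong_sol[where w = "\<lambda>i X. hw i X + u i X" and wt = "\<lambda>i X. ht i X + ut i X" and wx = "\<lambda>i X. hx i X + ux i X", OF sys csW]])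
    fix x assume x: "x0 < x" "x < x0 + 2 * pi + \<epsilon>'"
    \<comment> \<open>A region around the initial segment where the cutoff is still 1 and which the
      correction has not reached. Being open, it allows the time derivatives to be compared too, as
      the value of z_tt at t = 0 requires.\<close>
    define U where "U = {X :: real \<times> real. fst X < T1 - P * (snd X + c * fst X - x0) \<and> x0 < snd X + c * fst X}"
    have "open U" unfolding U_def
      by (intro open_Collect_conj open_Collect_less continuous_intros)
    have eqU: "hw i X + u i X = w i X" if "X \<in> U" "i < 4" for i X
    proof -
      obtain t x where X: "X = (t, x)" by (cases X)
      have t: "t < T1 - P * (x + c * t - x0)" "x0 < x + c * t" using that by (auto simp: U_def X)
      have "u i (t, x) = 0" using u(3)[OF \<open>i < 4\<close>] t by auto
      moreover have "t \<le> T1" using t mult_nonneg_nonneg[OF P0, of "x + c * t - x0"] by simp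
      then have "\<eta> 0 t = 1" "\<eta> 1 t = 0" using \<sigma>(2) \<eta>0[of t 0] by (auto simp: \<eta>_def)
      ultimately show ?thesis by (simp add: X hw_def)
    qed
    have "P * (x - x0) \<le> P * L" using x P0 by (intro mult_left_mono) (auto simp: L_def)
    then have mem: "(0, x) \<in> U" using x g0 by (simp add: U_def T1_def)
    have tt: "ht i (0, x) + ut i (0, x) = wt i (0, x)" if "i < 4" for i
    proof (rule C1_unique(1)[OF _ Cw[OF that] \<open>open U\<close> mem])
      show "C1 (\<lambda>X. hw i X + u i X) (\<lambda>X. ht i X + ut i X) (\<lambda>X. hx i X + ux i X)"
        using sys that by (auto simp: wave_system_def)
    qed (rule eqU[OF _ that])
    have e: "wt 0 (0, x) - wx 0 (0, x) = w 3 (0, x) - M / 2 * (w 0 (0, x) + w 1 (0, x)) - M^2 * w 2 (0, x) + 0"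
      "wt 1 (0, x) + wx 1 (0, x) = w 3 (0, x) - M / 2 * (w 0 (0, x) + w 1 (0, x)) - M^2 * w 2 (0, x) + 0"
      using w(1) unfolding wave_system_iff by blast+
    have "wt 0 (0, x) + wt 1 (0, x) = (wt 0 (0, x) - wx 0 (0, x)) + (wt 1 (0, x) + wx 1 (0, x)) + (wx 0 (0, x) - wx 1 (0, x))"
      by simp
    also have "\<dots> = 2 * Y1 x"
      unfolding e using w(2)[of 0 x] w(2)[of 1 x] w(2)[of 2 x] w(2)[of 3 x] wx0[of 0 x] wx0[of 1 x]
      by (simp add: gg_def gg'_def)
    finally show "hw 2 (0, x) + u 2 (0, x) = 0 \<and>
        (hw 0 (0, x) + u 0 (0, x) + (hw 1 (0, x) + u 1 (0, x))) / 2 = Y0 x \<and>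
        (ht 0 (0, x) + ut 0 (0, x) + (ht 1 (0, x) + ut 1 (0, x))) / 2 = Y1 x"
      using eqU[OF mem] tt[of 0] tt[of 1] w(2)[of 0 x] w(2)[of 1 x] w(2)[of 2 x]
      by (simp add: gg_def)
  next
    fix t x assume x: "x0 < x + c * t" "x + c * t < x0 + 2 * pi + \<epsilon>'" and t: "T - g < t"
    have "Q * (x + c * t - x0) \<le> Q * L" using x Q0 by (intro mult_left_mono) (auto simp: L_def)
    then have "u 2 (t, x) = 0" using u(3)[of 2 x t] x t T2 g0 by auto
    moreover have "t \<ge> T2" using t T2 g0 QL by simp
    then have "\<eta> 0 t = 0" using \<sigma>(3) by (simp add: \<eta>_def)
    ultimately show "hw 2 (t, x) + u 2 (t, x) = 0" by (simp add: hw_def)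
  qed
qed

subsection \<open>Periodization\<close>

text \<open>
  The sum over all translates by \<open>2\<pi>\<close>: the omitted terms vanish if \<open>F\<close> is supported in \<open>|x + c t| \<le> R\<close>.
\<close>

definition per :: "real \<Rightarrow> real \<Rightarrow> (real \<times> real \<Rightarrow> complex) \<Rightarrow> real \<times> real \<Rightarrow> complex" where
  "per c R F X = (\<Sum>n \<in> {- \<lceil>\<bar>snd X + c * fst X\<bar> + R\<rceil> .. \<lceil>\<bar>snd X + c * fst X\<bar> + R\<rceil>}. F (fst X, snd X + 2 * pi * of_int n))"

text \<open>Bounded support in x + c t, uniformly in t, is what makes the sum over translates
  locally finite. With c = 0 the notion also covers a fixed bump in x.\<close>

definition slab :: "real \<Rightarrow> real \<Rightarrow> (real \<times> real \<Rightarrow> complex) \<Rightarrow> bool" where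
  "slab c R F \<longleftrightarrow> (\<forall>t x. \<bar>x + c * t\<bar> > R \<longrightarrow> F (t, x) = 0)"

text \<open>A translation by 2 pi n moves a point by at least |n|, so the summation range can be
  chosen without dividing by the period.\<close>

lemma slab_shift_eq_0:
  assumes "slab c R F" "\<bar>of_int n\<bar> > \<bar>x + c * t\<bar> + R"
  shows "F (t, x + 2 * pi * of_int n) = 0"
proof -
  have "\<bar>of_int n\<bar> * 1 \<le> \<bar>of_int n\<bar> * (2 * pi)" using pi_gt3 by (intro mult_left_mono) auto
  then have "\<bar>2 * pi * of_int n\<bar> \<ge> \<bar>of_int n :: real\<bar>" by (simp add: abs_mult mult.commute)
  then have "\<bar>x + 2 * pi * of_int n + c * t\<bar> > R" using assms(2) by linarith
  then show ?thesis using assms(1) by (simp add: slab_def)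
qed

lemma per_eq:
  assumes "slab c R F" "finite E" "\<And>n. n \<notin> E \<Longrightarrow> F (t, x + 2 * pi * of_int n) = 0"
  shows "per c R F (t, x) = (\<Sum>n\<in>E. F (t, x + 2 * pi * of_int n))"
proof -
  let ?N = "\<lceil>\<bar>x + c * t\<bar> + R\<rceil>"
  have "F (t, x + 2 * pi * of_int n) = 0" if "n \<notin> {- ?N .. ?N}" for n
  proof (rule slab_shift_eq_0[OF assms(1)])
    have "?N < \<bar>n\<bar>" using that by auto
    then have "\<bar>x + c * t\<bar> + R < of_int \<bar>n\<bar>" by (simp add: ceiling_less_iff)
    then show "\<bar>of_int n\<bar> > \<bar>x + c * t\<bar> + R" by simp
  qed
  then have "per c R F (t, x) = (\<Sum>n\<in>E \<union> {- ?N .. ?N}. F (t, x + 2 * pi * of_int n))"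
    unfolding per_def fst_conv snd_conv using assms(2) by (intro sum.mono_neutral_left) auto
  also have "\<dots> = (\<Sum>n\<in>E. F (t, x + 2 * pi * of_int n))"
    using assms(2,3) by (intro sum.mono_neutral_right) auto
  finally show ?thesis .
qed

text \<open>The range in \<open>per\<close> depends on the point, so both sides are first rewritten
  over fixed larger ranges; a shift of the index by one then matches them.\<close>

lemma per_periodic:
  assumes "slab c R F"
  shows "per c R F (t, x + 2 * pi) = per c R F (t, x)"
proof -
  let ?N = "\<lceil>\<bar>x + c * t\<bar> + R + 2 * pi\<rceil> + 1"
  have out: "F (t, x + 2 * pi * of_int n) = 0" if "n \<notin> {- ?N .. ?N}" for n
  proof (rule slab_shift_eq_0[OF assms(1)])
    have "?N < \<bar>n\<bar>" using that by auto
    then have "\<lceil>\<bar>x + c * t\<bar> + R + 2 * pi\<rceil> < \<bar>n\<bar>" by linarith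
    then have "\<bar>x + c * t\<bar> + R + 2 * pi < \<bar>of_int n\<bar>" by (simp add: ceiling_less_iff)
    then show "\<bar>of_int n\<bar> > \<bar>x + c * t\<bar> + R" using pi_gt_zero by linarith
  qed
  have shift: "x + 2 * pi + 2 * pi * of_int n = x + 2 * pi * of_int (n + 1)" for n :: int
    by (simp add: algebra_simps)
  have "per c R F (t, x + 2 * pi) = (\<Sum>n\<in>{- ?N - 1 .. ?N - 1}. F (t, x + 2 * pi + 2 * pi * of_int n))"
    by (rule per_eq[OF assms]) (auto simp: shift simp del: of_int_add intro!: out)
  also have "\<dots> = (\<Sum>n\<in>{- ?N .. ?N}. F (t, x + 2 * pi * of_int n))"
    unfolding shift
    by (rule sum.reindex_bij_witness[of _ "\<lambda>n. n - 1" "\<lambda>n. n + 1"]) auto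
  also have "\<dots> = per c R F (t, x)"
    by (rule per_eq[OF assms, symmetric]) (auto intro!: out)
  finally show ?thesis .
qed

lemma per_locally_finite:
  assumes "slab c R F" "\<bar>snd X + c * fst X\<bar> < b"
  shows "per c R F X = (\<Sum>n \<in> {- \<lceil>b + R\<rceil> .. \<lceil>b + R\<rceil>}. F (fst X, snd X + 2 * pi * of_int n))"
proof -
  obtain t x where X: "X = (t, x)" by (cases X)
  show ?thesis unfolding X fst_conv snd_conv
  proof (rule per_eq[OF assms(1)])
    fix n assume "n \<notin> {- \<lceil>b + R\<rceil> .. \<lceil>b + R\<rceil>}"
    then have "\<lceil>b + R\<rceil> < \<bar>n\<bar>" by auto
    then have "b + R < of_int \<bar>n\<bar>" by (simp add: ceiling_less_iff)
    then show "F (t, x + 2 * pi * of_int n) = 0"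
      using assms by (intro slab_shift_eq_0[OF assms(1)]) (auto simp: X)
  qed simp
qed

text \<open>Near each point the sum runs over one fixed finite index set, so it may be
  differentiated term by term.\<close>

lemma C1_per:
  assumes C: "C1 F Ft Fx" and s: "slab c R F" "slab c R Ft" "slab c R Fx"
  shows "C1 (per c R F) (per c R Ft) (per c R Fx)"
proof -
  have loc: "\<exists>U. open U \<and> X \<in> U \<and>
      (\<exists>G Gt Gx. C1 G Gt Gx \<and> (\<forall>Y\<in>U. per c R F Y = G Y \<and> per c R Ft Y = Gt Y \<and> per c R Fx Y = Gx Y))" for X
  proof -
    define b where "b = \<bar>snd X + c * fst X\<bar> + 1"
    let ?E = "{- \<lceil>b + R\<rceil> .. \<lceil>b + R\<rceil>}"
    let ?S = "\<lambda>F X. \<Sum>n \<in> ?E. F (fst X, snd X + 2 * pi * of_int n)"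
    have "open {Y :: real \<times> real. \<bar>snd Y + c * fst Y\<bar> < b}"
      by (intro open_Collect_less continuous_intros)
    moreover have "C1 (?S F) (?S Ft) (?S Fx)"
    proof (rule C1_sum)
      show "C1 (\<lambda>X. F (fst X, snd X + 2 * pi * of_int n)) (\<lambda>X. Ft (fst X, snd X + 2 * pi * of_int n))
         (\<lambda>X. Fx (fst X, snd X + 2 * pi * of_int n))" for n
        using C1_affine[OF C, of 1 0 0 0 1 "2 * pi * of_int n"] by simp
    qed
    moreover have "X \<in> {Y :: real \<times> real. \<bar>snd Y + c * fst Y\<bar> < b}" by (simp add: b_def)
    moreover have "\<forall>Y\<in>{Y :: real \<times> real. \<bar>snd Y + c * fst Y\<bar> < b}.
        per c R F Y = ?S F Y \<and> per c R Ft Y = ?S Ft Y \<and> per c R Fx Y = ?S Fx Y"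
      using per_locally_finite[OF s(1)] per_locally_finite[OF s(2)] per_locally_finite[OF s(3)] by blast
    ultimately show ?thesis by (intro exI conjI)
  qed
  show ?thesis
    unfolding C1_def
  proof (intro conjI allI continuous_at_imp_continuous_on ballI)
    fix X
    obtain U G Gt Gx where U: "open U" "X \<in> U" "C1 G Gt Gx"
      and "\<forall>Y\<in>U. per c R F Y = G Y \<and> per c R Ft Y = Gt Y \<and> per c R Fx Y = Gx Y"
      using loc[of X] by (elim exE conjE) (rule that)
    note U4 = bspec[OF this(4)]
    have "(G has_derivative (\<lambda>h. fst h *\<^sub>R per c R Ft X + snd h *\<^sub>R per c R Fx X)) (at X)"
      using U(3) U4[OF U(2)] unfolding C1_def by metis
    then show "(per c R F has_derivative (\<lambda>h. fst h *\<^sub>R per c R Ft X + snd h *\<^sub>R per c R Fx X)) (at X)"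
      by (rule has_derivative_transform_within_open[OF _ U(1,2)]) (simp add: U4)
    have "continuous_on U (per c R Ft)"
      by (rule continuous_on_eq[OF continuous_on_subset[OF C1_continuous_partials(1)[OF U(3)] subset_UNIV]]) (simp add: U4)
    moreover have "continuous_on U (per c R Fx)"
      by (rule continuous_on_eq[OF continuous_on_subset[OF C1_continuous_partials(2)[OF U(3)] subset_UNIV]]) (simp add: U4)
    ultimately show "isCont (per c R Ft) X" "isCont (per c R Fx) X"
      using U by (auto simp: continuous_on_eq_continuous_at)
  qed
qed

lemma strong_sol_per:
  assumes S: "strong_sol M z y p v q r h k l f"
    and s: "slab c R z" "slab c R y" "slab c R p" "slab c R v" "slab c R q" "slab c R r"
      "slab c R h" "slab c R k" "slab c R l"
  shows "strong_sol M (per c R z) (per c R y) (per c R p) (per c R v) (per c R q) (per c R r)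
    (per c R h) (per c R k) (per c R l) (per c R f)"
proof -
  have C: "C1 z y p" "C1 y v q" "C1 p q r" "C1 h k l"
    and eh: "h = (\<lambda>X. v X - r X + complex_of_real M * y X + (complex_of_real M)\<^sup>2 * z X)"
    and ef: "f = (\<lambda>X. k X - complex_of_real M * h X + (complex_of_real M) ^ 3 * z X)"
    using S by (auto simp: strong_sol_def fun_eq_iff simp del: split_paired_All)
  show ?thesis
    unfolding strong_sol_def
  proof (intro conjI allI)
    show "per c R h X = per c R v X - per c R r X + complex_of_real M * per c R y X + (complex_of_real M)\<^sup>2 * per c R z X" for X
      unfolding eh per_def by (simp only: sum.distrib sum_subtractf sum_distrib_left)
    show "per c R f X = per c R k X - complex_of_real M * per c R h X + (complex_of_real M) ^ 3 * per c R z X" for X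
      unfolding ef per_def by (simp only: sum.distrib sum_subtractf sum_distrib_left)
  qed (intro C1_per C s)+
qed

text \<open>Leibniz's rule for a cutoff that depends on x + c t only, so that each of its time
  derivatives is c times an x-derivative. The new control differs from g f only by terms containing
  one of the first three derivatives of the cutoff.\<close>

lemma strong_sol_moving_cutoff:
  fixes g :: "nat \<Rightarrow> real \<times> real \<Rightarrow> complex"
  assumes S: "strong_sol M z y p v q r h k l f"
    and Cg: "\<And>n. C1 (g n) (\<lambda>X. complex_of_real c * g (Suc n) X) (g (Suc n))"
    and slab: "\<And>n. slab c R (g n)"
  obtains p' q' r' h' k' l' f' where
    "strong_sol M (\<lambda>X. g 0 X * z X) (\<lambda>X. complex_of_real c * g 1 X * z X + g 0 X * y X) p'
      (\<lambda>X. (complex_of_real c)\<^sup>2 * g 2 X * z X + 2 * complex_of_real c * g 1 X * y X + g 0 X * v X) q' r' h' k' l' f'"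
    "slab c R p'" "slab c R q'" "slab c R r'" "slab c R h'" "slab c R k'" "slab c R l'"
    "\<And>X. g 1 X = 0 \<Longrightarrow> g 2 X = 0 \<Longrightarrow> g 3 X = 0 \<Longrightarrow> f' X = g 0 X * f X"
proof -
  have C: "C1 z y p" "C1 y v q" "C1 p q r" "C1 h k l"
    and eh: "h = (\<lambda>X. v X - r X + complex_of_real M * y X + (complex_of_real M)\<^sup>2 * z X)"
    and ef: "f = (\<lambda>X. k X - complex_of_real M * h X + (complex_of_real M) ^ 3 * z X)"
    using S by (auto simp: strong_sol_def fun_eq_iff simp del: split_paired_All)
  let ?c = "complex_of_real c" and ?M = "complex_of_real M"
  define p' where "p' X = g 1 X * z X + g 0 X * p X" for X
  define q' where "q' X = ?c * g 2 X * z X + ?c * g 1 X * p X + g 1 X * y X + g 0 X * q X" for X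
  define r' where "r' X = g 2 X * z X + 2 * g 1 X * p X + g 0 X * r X" for X
  \<comment> \<open>Second derivatives of z enter only through h, with the factor g; all other terms
    contain at most first derivatives of z. Hence h' is again C^1 and no third derivative of z is
    needed.\<close>
  define h' where "h' X = g 0 X * h X + ((?c\<^sup>2 - 1) * (g 2 X * z X) + (2 * ?c * (g 1 X * y X) + (- 2 * (g 1 X * p X) + ?M * ?c * (g 1 X * z X))))" for X
  define k' where "k' X = (?c * g 1 X * h X + g 0 X * k X) + ((?c\<^sup>2 - 1) * (?c * g 3 X * z X + g 2 X * y X) + (2 * ?c * (?c * g 2 X * y X + g 1 X * v X) + (- 2 * (?c * g 2 X * p X + g 1 X * q X) + ?M * ?c * (?c * g 2 X * z X + g 1 X * y X))))" for X
  define l' where "l' X = (g 1 X * h X + g 0 X * l X) + ((?c\<^sup>2 - 1) * (g 3 X * z X + g 2 X * p X) + (2 * ?c * (g 2 X * y X + g 1 X * q X) + (- 2 * (g 2 X * p X + g 1 X * r X) + ?M * ?c * (g 2 X * z X + g 1 X * p X))))" for X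
  have n: "Suc 0 = 1" "Suc 1 = 2" "Suc 2 = 3" by simp_all
  have "strong_sol M (\<lambda>X. g 0 X * z X) (\<lambda>X. ?c * g 1 X * z X + g 0 X * y X) p'
      (\<lambda>X. ?c\<^sup>2 * g 2 X * z X + 2 * ?c * g 1 X * y X + g 0 X * v X)
      q' r' h' k' l' (\<lambda>X. k' X - ?M * h' X + ?M ^ 3 * (g 0 X * z X))"
    unfolding strong_sol_def
  proof (intro conjI allI)
    show "C1 (\<lambda>X. g 0 X * z X) (\<lambda>X. ?c * g 1 X * z X + g 0 X * y X) p'"
      by (rule C1_cong[OF C1_mult[OF Cg[of 0] C(1)]]) (simp_all add: p'_def)
    show "C1 (\<lambda>X. ?c * g 1 X * z X + g 0 X * y X)
      (\<lambda>X. ?c\<^sup>2 * g 2 X * z X + 2 * ?c * g 1 X * y X + g 0 X * v X) q'"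
    proof (rule C1_cong[OF C1_add[OF C1_cmul[OF C1_mult[OF Cg[of 1] C(1)], of c] C1_mult[OF Cg[of 0] C(2)]]])
      show "?c * (?c * g (Suc 1) X * z X + g 1 X * y X) + (?c * g (Suc 0) X * y X + g 0 X * v X)
          = ?c\<^sup>2 * g 2 X * z X + 2 * ?c * g 1 X * y X + g 0 X * v X" for X
        unfolding n by (simp add: algebra_simps power2_eq_square)
      show "?c * (g (Suc 1) X * z X + g 1 X * p X) + (g (Suc 0) X * y X + g 0 X * q X) = q' X" for X
        unfolding n q'_def by (simp add: algebra_simps)
    qed (simp add: mult.assoc)
    show "C1 p' q' r'"
    proof (rule C1_cong[OF C1_add[OF C1_mult[OF Cg[of 1] C(1)] C1_mult[OF Cg[of 0] C(3)]]])
      show "?c * g (Suc 1) X * z X + g 1 X * y X + (?c * g (Suc 0) X * p X + g 0 X * q X) = q' X" for X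
        unfolding n q'_def by (simp add: algebra_simps)
      show "g (Suc 1) X * z X + g 1 X * p X + (g (Suc 0) X * p X + g 0 X * r X) = r' X" for X
        unfolding n r'_def by (simp add: algebra_simps)
    qed (simp add: p'_def)
    show "C1 h' k' l'"
      using C1_add[OF C1_mult[OF Cg[of 0] C(4)] C1_add[OF C1_cmul[OF C1_mult[OF Cg[of 2] C(1)], of "?c\<^sup>2 - 1"]
            C1_add[OF C1_cmul[OF C1_mult[OF Cg[of 1] C(2)], of "2 * ?c"]
              C1_add[OF C1_cmul[OF C1_mult[OF Cg[of 1] C(3)], of "-2"] C1_cmul[OF C1_mult[OF Cg[of 1] C(1)], of "?M * ?c"]]]]]
      unfolding n h'_def[abs_def] k'_def[abs_def] l'_def[abs_def] .
    show "h' X = (?c\<^sup>2 * g 2 X * z X + 2 * ?c * g 1 X * y X + g 0 X * v X) - r' X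
        + ?M * (?c * g 1 X * z X + g 0 X * y X) + ?M\<^sup>2 * (g 0 X * z X)" for X
      unfolding h'_def r'_def eh by (simp add: algebra_simps)
  qed simp
  then show thesis
  proof (rule that)
    fix X assume "g 1 X = 0" "g 2 X = 0" "g 3 X = 0"
    then show "k' X - ?M * h' X + ?M ^ 3 * (g 0 X * z X) = g 0 X * f X"
      unfolding ef h'_def k'_def by (simp add: algebra_simps)
  qed (use slab in \<open>simp_all add: slab_def p'_def q'_def r'_def h'_def k'_def l'_def\<close>)
qed

definition x_periodic :: "(real \<times> real \<Rightarrow> complex) \<Rightarrow> bool" where
  "x_periodic F \<longleftrightarrow> (\<forall>t x. F (t, x + 2 * pi) = F (t, x))"

lemma shift_2pi_int:
  assumes "\<And>x. P (x + 2 * pi) = P (x :: real)"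
  shows "P (x + 2 * pi * of_int n) = P x"
proof (induction n)
  case (nonneg m)
  show ?case
  proof (induction m)
    case (Suc m)
    have "x + 2 * pi * of_int (int (Suc m)) = (x + 2 * pi * of_int (int m)) + 2 * pi"
      by (simp add: algebra_simps)
    then show ?case using assms[of "x + 2 * pi * of_int (int m)"] Suc by metis
  qed simp
next
  case (neg m)
  show ?case
  proof (induction m)
    case 0
    have "x = (x + 2 * pi * of_int (- int (Suc 0))) + 2 * pi" by simp
    then show ?case using assms[of "x + 2 * pi * of_int (- int (Suc 0))"] by metis
  next
    case (Suc m)
    have "x + 2 * pi * of_int (- int (Suc m)) = (x + 2 * pi * of_int (- int (Suc (Suc m)))) + 2 * pi"
      by (simp add: algebra_simps)
    then show ?case using assms[of "x + 2 * pi * of_int (- int (Suc (Suc m)))"] Suc by metis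
  qed
qed

text \<open>Meant for s(n) the value of a step function at the nth translate: the differences of
  neighbouring values then add up to the total rise of the step.\<close>

lemma telescope_int:
  fixes s :: "int \<Rightarrow> 'a::ab_group_add"
  shows "(\<Sum>n\<in>{- int m..int m}. s n - s (n - 1)) = s (int m) - s (- int m - 1)"
proof (induction m)
  case (Suc m)
  have "(\<Sum>n\<in>{- int (Suc m)..int (Suc m)}. s n - s (n - 1)) =
      (\<Sum>n\<in>insert (- int m - 1) (insert (int m + 1) {- int m..int m}). s n - s (n - 1))"
    by (rule sum.cong) auto
  also have "\<dots> = (s (- int m - 1) - s (- int m - 2)) + ((s (int m + 1) - s (int m)) + (s (int m) - s (- int m - 1)))"
  proof -
    have "s (- 2 - int m) = s (- int m - 2)" by (rule arg_cong[of _ _ s]) simp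
    then show ?thesis using Suc by simp
  qed
  also have "\<dots> = s (int m + 1) - s (- int m - 2)" by simp
  also have "\<dots> = s (int (Suc m)) - s (- int (Suc m) - 1)"
  proof -
    have e: "int (Suc m) = int m + 1" "- (int m + 1) - 1 = - int m - 2" by simp_all
    show ?thesis by (simp only: e)
  qed
  finally show ?case .
qed simp

lemma glued_solution:
  fixes c T M x0 \<epsilon> K :: real and Y0 Y1 Y0' Y1' :: "real \<Rightarrow> complex"
  assumes c: "c \<notin> {-1, 0, 1}"
    and T: "T > 2 * pi * (1 / \<bar>c\<bar> + 1 / \<bar>1 - c\<bar> + 1 / \<bar>1 + c\<bar>)"
    and Y0: "\<And>x. (Y0 has_vector_derivative Y0' x) (at x)" "continuous_on UNIV Y0'"
    and Y1: "\<And>x. (Y1 has_vector_derivative Y1' x) (at x)" "continuous_on UNIV Y1'"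
    and bd: "\<And>x. norm (Y0 x) \<le> K" "\<And>x. norm (Y0' x) \<le> K" "\<And>x. norm (Y1 x) \<le> K" "\<And>x. norm (Y1' x) \<le> K"
    and per: "periodic Y0" "periodic Y1"
    and W: "torus_set W" "{x0<..<x0 + \<epsilon>} \<subseteq> W" and \<epsilon>: "\<epsilon> > 0"
  obtains \<delta> z y p v q r h k l f where "0 < \<delta>" "\<delta> < T"
    "strong_sol M z y p v q r h k l f"
    "\<forall>F\<in>{z, y, p, v, q, r, h, k, l, f}. x_periodic F"
    "\<And>x. z (0, x) = 0 \<and> y (0, x) = Y0 x \<and> v (0, x) = Y1 x"
    "\<And>t x. T - \<delta> < t \<Longrightarrow> z (t, x) = 0"
    "\<And>t x. f (t, x) \<noteq> 0 \<Longrightarrow> x + c * t \<in> W"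
proof -
  obtain \<epsilon>' \<delta> z y p v q r h k l where e: "0 < \<epsilon>'" "\<epsilon>' \<le> \<epsilon>" and \<delta>: "0 < \<delta>" "\<delta> < T"
    and S: "strong_sol M z y p v q r h k l (\<lambda>_. 0)"
    and init: "\<And>x. x0 < x \<Longrightarrow> x < x0 + 2 * pi + \<epsilon>' \<Longrightarrow> z (0, x) = 0 \<and> y (0, x) = Y0 x \<and> v (0, x) = Y1 x"
    and fin: "\<And>t x. x0 < x + c * t \<Longrightarrow> x + c * t < x0 + 2 * pi + \<epsilon>' \<Longrightarrow> T - \<delta> < t \<Longrightarrow> z (t, x) = 0"
    by (rule strip_solution[OF c T Y0 Y1 bd \<epsilon>, of M x0]) (rule that)
  \<comment> \<open>The step rises in the middle third of the overlap, which keeps the support of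
    the cutoff strictly inside the strip.\<close>
  define a where "a = x0 + \<epsilon>' / 3"
  define b where "b = x0 + 2 * \<epsilon>' / 3"
  have ab: "x0 < a" "a < b" "b < x0 + \<epsilon>'" using e by (auto simp: a_def b_def field_simps)
  obtain \<sigma> :: "nat \<Rightarrow> real \<Rightarrow> real" where \<sigma>:
    "\<And>n x. (\<sigma> n has_real_derivative \<sigma> (Suc n) x) (at x)"
    "\<And>x. x \<le> a \<Longrightarrow> \<sigma> 0 x = 0" "\<And>x. x \<ge> b \<Longrightarrow> \<sigma> 0 x = 1"
    "\<And>n x. x \<notin> {a<..<b} \<Longrightarrow> \<sigma> (Suc n) x = 0"
    by (rule smooth_step[OF ab(2)]) (rule that)
  \<comment> \<open>A step up near x0 and the same step down one period later. The translates by
    multiples of 2 pi add up to 1, and all derivatives live in (a, b) and its translate by 2 pi,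
    inside W.\<close>
  define \<psi> where "\<psi> n x = \<sigma> n x - \<sigma> n (x - 2 * pi)" for n x
  have \<psi>: "(\<psi> n has_real_derivative \<psi> (Suc n) x) (at x)" for n x
    unfolding \<psi>_def using DERIV_diff[OF \<sigma>(1)[of n x] DERIV_shift[THEN iffD1, of "\<sigma> n" "\<sigma> (Suc n) (x - 2 * pi)" x "- 2 * pi"]] \<sigma>(1)[of n "x - 2 * pi"]
    by simp
  have \<psi>_strip: "a < x \<and> x < b + 2 * pi" if "\<psi> n x \<noteq> 0" for n x
  proof (rule ccontr)
    assume "\<not> (a < x \<and> x < b + 2 * pi)"
    then consider "x \<le> a" | "x \<ge> b + 2 * pi" by linarith
    then have "\<psi> n x = 0"
    proof cases
      case 1
      then show ?thesis using \<sigma>(2)[of x] \<sigma>(2)[of "x - 2 * pi"] \<sigma>(4)[of x] \<sigma>(4)[of "x - 2 * pi"]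
        using pi_gt_zero by (cases n) (auto simp: \<psi>_def)
    next
      case 2
      then show ?thesis using \<sigma>(3)[of x] \<sigma>(3)[of "x - 2 * pi"] \<sigma>(4)[of x] \<sigma>(4)[of "x - 2 * pi"]
        using pi_gt_zero by (cases n) (auto simp: \<psi>_def)
    qed
    with that show False by simp
  qed
  have \<psi>_W: "x \<in> W" if "\<psi> (Suc n) x \<noteq> 0" for n x
  proof -
    have "x \<in> {a<..<b} \<or> x - 2 * pi \<in> {a<..<b}"
      by (rule ccontr) (use that \<sigma>(4) in \<open>auto simp: \<psi>_def simp del: greaterThanLessThan_iff\<close>)
    moreover have "{a<..<b} \<subseteq> W" using W(2) ab e by auto
    moreover have "x - 2 * pi \<in> W \<longleftrightarrow> x \<in> W" using W(1) unfolding torus_set_def by (metis diff_add_cancel)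
    ultimately show ?thesis by blast
  qed
  define R where "R = \<bar>x0\<bar> + \<epsilon>' + 2 * pi"
  define g where "g n X = complex_of_real (\<psi> n (c * fst X + snd X))" for n and X :: "real \<times> real"
  have Cg: "C1 (g n) (\<lambda>X. complex_of_real c * g (Suc n) X) (g (Suc n))" for n
    using C1_real_plane_wave[OF \<psi>[of n] \<psi>[of "Suc n"], of c 1 0] by (simp add: g_def[abs_def])
  have slabg: "slab c R (g n)" for n
    unfolding slab_def
  proof (intro allI impI)
    fix t x assume *: "\<bar>x + c * t\<bar> > R"
    have "\<psi> n (c * t + x) = 0"
    proof (rule ccontr)
      assume "\<psi> n (c * t + x) \<noteq> 0"
      from \<psi>_strip[OF this] have "a < x + c * t \<and> x + c * t < b + 2 * pi" by (simp add: add.commute)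
      then show False using * ab e pi_gt_zero unfolding R_def by linarith
    qed
    then show "g n (t, x) = 0" by (simp add: g_def)
  qed
  obtain p' q' r' h' k' l' f' where S': "strong_sol M (\<lambda>X. g 0 X * z X) (\<lambda>X. complex_of_real c * g 1 X * z X + g 0 X * y X) p'
      (\<lambda>X. (complex_of_real c)\<^sup>2 * g 2 X * z X + 2 * complex_of_real c * g 1 X * y X + g 0 X * v X) q' r' h' k' l' f'"
    and slabs: "slab c R p'" "slab c R q'" "slab c R r'" "slab c R h'" "slab c R k'" "slab c R l'"
    and f': "\<And>X. g 1 X = 0 \<Longrightarrow> g 2 X = 0 \<Longrightarrow> g 3 X = 0 \<Longrightarrow> f' X = g 0 X * 0"
    by (rule strong_sol_moving_cutoff[where g = g and c = c and R = R, OF S Cg slabg]) (rule that)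
  define z' where "z' X = g 0 X * z X" for X
  define y' where "y' X = complex_of_real c * g 1 X * z X + g 0 X * y X" for X
  define v' where "v' X = (complex_of_real c)\<^sup>2 * g 2 X * z X + 2 * complex_of_real c * g 1 X * y X + g 0 X * v X" for X
  note S'' = S'[folded z'_def[abs_def] y'_def[abs_def] v'_def[abs_def]]
  have slabs': "slab c R z'" "slab c R y'" "slab c R v'"
    using slabg by (auto simp: slab_def z'_def y'_def v'_def)
  have slabf: "slab c R f'"
    using S'' slabs(4,5) slabs'(1) by (auto simp: strong_sol_def slab_def)
  \<comment> \<open>One end of the telescope lies beyond b and the other before a, so the sum is 1
    for the cutoff itself and 0 for each of its derivatives.\<close>
  have sum\<psi>: "(\<Sum>n\<in>{- \<lceil>\<bar>x\<bar> + R\<rceil>..\<lceil>\<bar>x\<bar> + R\<rceil>}. complex_of_real (\<psi> i (x + 2 * pi * of_int n))) = (if i = 0 then 1 else 0)" for i x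
  proof -
    define m where "m = nat \<lceil>\<bar>x\<bar> + R\<rceil>"
    have R0: "R \<ge> 0" using e by (simp add: R_def)
    then have m: "\<lceil>\<bar>x\<bar> + R\<rceil> = int m" by (simp add: m_def)
    have mR: "real m \<ge> \<bar>x\<bar> + R" using m by linarith
    have m1: "real m * 1 \<le> real m * (2 * pi)" using pi_gt3 by (intro mult_left_mono) auto
    have hi: "x + 2 * pi * of_int (int m) \<ge> b" 
    proof -
      have "x + 2 * pi * of_int (int m) = x + real m * (2 * pi)" by simp
      then show ?thesis
        using mR m1 ab e pi_gt_zero abs_ge_self[of x0] abs_ge_minus_self[of x] unfolding R_def by linarith
    qed
    have lo: "x + 2 * pi * of_int (- int m - 1) \<le> a"
    proof -
      have "x + 2 * pi * of_int (- int m - 1) = x - real m * (2 * pi) - 2 * pi" by (simp add: algebra_simps)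
      then show ?thesis
        using mR m1 ab e pi_gt_zero abs_ge_minus_self[of x0] abs_ge_self[of x] unfolding R_def by linarith
    qed
    let ?s = "\<lambda>n. complex_of_real (\<sigma> i (x + 2 * pi * of_int n))"
    have "complex_of_real (\<psi> i (x + 2 * pi * of_int n)) = ?s n - ?s (n - 1)" for n
      by (simp add: \<psi>_def algebra_simps)
    then have "(\<Sum>n\<in>{- int m..int m}. complex_of_real (\<psi> i (x + 2 * pi * of_int n))) = ?s (int m) - ?s (- int m - 1)"
      using telescope_int[of ?s m] by simp
    also have "\<dots> = (if i = 0 then 1 else 0)"
      using \<sigma>(2)[OF lo] \<sigma>(3)[OF hi] \<sigma>(4) hi lo ab by (cases i) auto
    finally show ?thesis unfolding m .
  qed
  have gz: "g i (t, x) * u = 0" if "\<And>n. \<psi> n (c * t + x) = 0" for i t x u using that by (simp add: g_def)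
  have P0: "Y0 (x + 2 * pi * of_int n) = Y0 x" "Y1 (x + 2 * pi * of_int n) = Y1 x" for x n
    using per shift_2pi_int[of Y0 x n] shift_2pi_int[of Y1 x n] by (auto simp: periodic_def)
  \<comment> \<open>As z(0) = 0, a derivative of the cutoff enters the initial data only through the
    term 2 c \<psi>' Y0 of v, and summation over the translates removes it.\<close>
  have at0: "z' (0, x) = 0 \<and> y' (0, x) = complex_of_real (\<psi> 0 x) * Y0 x \<and>
      v' (0, x) = 2 * complex_of_real c * complex_of_real (\<psi> 1 x) * Y0 x + complex_of_real (\<psi> 0 x) * Y1 x" for x
  proof (cases "x0 < x \<and> x < x0 + 2 * pi + \<epsilon>'")
    case True
    then show ?thesis using init by (simp add: z'_def y'_def v'_def g_def)
  next
    case False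
    then have "\<psi> n x = 0" for n using \<psi>_strip[of n x] ab by force
    then show ?thesis by (simp add: z'_def y'_def v'_def g_def)
  qed
  show thesis
  proof (rule that[OF \<delta> strong_sol_per[OF S'' slabs'(1,2) slabs(1) slabs'(3) slabs(2-6)]])
    show "\<forall>F\<in>{per c R z', per c R y', per c R p', per c R v', per c R q', per c R r',
       per c R h', per c R k', per c R l', per c R f'}. x_periodic F"
      using slabs slabs' slabf by (auto simp: x_periodic_def intro!: per_periodic)
    show "per c R z' (0, x) = 0 \<and> per c R y' (0, x) = Y0 x \<and> per c R v' (0, x) = Y1 x" for x
    proof (intro conjI)
      let ?E = "{- \<lceil>\<bar>x\<bar> + R\<rceil>..\<lceil>\<bar>x\<bar> + R\<rceil>}"
      show "per c R z' (0, x) = 0" by (simp add: per_def at0)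
      have "per c R y' (0, x) = (\<Sum>n\<in>?E. complex_of_real (\<psi> 0 (x + 2 * pi * of_int n))) * Y0 x"
        by (simp add: per_def at0 P0 sum_distrib_right)
      then show "per c R y' (0, x) = Y0 x" by (simp add: sum\<psi>)
      have "per c R v' (0, x) = 2 * complex_of_real c * (\<Sum>n\<in>?E. complex_of_real (\<psi> 1 (x + 2 * pi * of_int n))) * Y0 x
         + (\<Sum>n\<in>?E. complex_of_real (\<psi> 0 (x + 2 * pi * of_int n))) * Y1 x"
        by (simp add: per_def at0 P0 sum_distrib_right sum_distrib_left sum.distrib)
      then show "per c R v' (0, x) = Y1 x" by (simp add: sum\<psi>)
    qed
    show "per c R z' (t, x) = 0" if "T - \<delta> < t" for t x
    proof -
      have "z' (t, x) = 0" for x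
      proof (cases "\<psi> 0 (c * t + x) = 0")
        case False
        then have "z (t, x) = 0"
          using fin[of x t] \<psi>_strip[OF False] ab that by (simp add: add.commute)
        then show ?thesis by (simp add: z'_def)
      qed (simp add: z'_def g_def)
      then show ?thesis by (simp add: per_def)
    qed
    show "x + c * t \<in> W" if nz: "per c R f' (t, x) \<noteq> 0" for t x
    proof -
      obtain n where "f' (t, x + 2 * pi * of_int n) \<noteq> 0"
        using nz unfolding per_def by (metis (no_types, lifting) fst_conv snd_conv sum.neutral)
      \<comment> \<open>The source on the strip is zero, so the new source can only come from one of
        the first three derivatives of the cutoff.\<close>
      then obtain i where "\<psi> (Suc i) (c * t + (x + 2 * pi * of_int n)) \<noteq> 0"
        using f'[of "(t, x + 2 * pi * of_int n)"]
        by (auto simp: g_def numeral_2_eq_2 numeral_3_eq_3)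
      then have "(x + c * t) + 2 * pi * of_int n \<in> W" using \<psi>_W by (fastforce simp: algebra_simps)
      then show ?thesis using shift_2pi_int[of "\<lambda>x. x \<in> W" "x + c * t" n] W(1) by (simp add: torus_set_def)
    qed
  qed
qed

section \<open>Removing the spatial mean of the control\<close>

lemma C1_integral_has_vector_derivative:
  assumes "C1 F Ft Fx"
  shows "((\<lambda>t. integral {a..b} (\<lambda>x. F (t, x))) has_vector_derivative integral {a..b} (\<lambda>x. Ft (t, x))) (at t)"
proof -
  have "((\<lambda>t. integral (cbox a b) (\<lambda>x. F (t, x))) has_vector_derivative integral (cbox a b) (\<lambda>x. Ft (t, x))) (at t within UNIV)"
  proof (rule leibniz_rule_vector_derivative)
    show "((\<lambda>t. F (t, x)) has_vector_derivative Ft (t, x)) (at t within UNIV)" for t x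
      by (rule C1_partial_fst[OF assms])
    show "(\<lambda>x. F (t, x)) integrable_on cbox a b" for t
      by (intro integrable_continuous continuous_on_slice C1_continuous[OF assms])
    show "continuous_on (UNIV \<times> cbox a b) (\<lambda>(t, x). Ft (t, x))"
      using C1_continuous_partials(1)[OF assms] by (auto intro: continuous_on_subset)
  qed auto
  then show ?thesis by simp
qed

lemma continuous_on_integral_slice:
  fixes F :: "real \<times> real \<Rightarrow> complex"
  assumes "continuous_on UNIV F"
  shows "continuous_on UNIV (\<lambda>t. integral {a..b} (\<lambda>x. F (t, x)))"
proof -
  have "continuous_on (UNIV \<times> cbox a b) (\<lambda>(t, x). F (t, x))"
    using assms by (auto intro: continuous_on_subset)
  from integral_continuous_on_param[OF this] show ?thesis by simp
qed

lemma integral_x_derivative_eq_0: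
  assumes "C1 F Ft Fx" "x_periodic F"
  shows "integral {-pi..pi} (\<lambda>x. Fx (t, x)) = 0"
proof -
  have "((\<lambda>x. Fx (t, x)) has_integral F (t, pi) - F (t, - pi)) {-pi..pi}"
    by (rule fundamental_theorem_of_calculus) (auto intro: C1_partial_snd[OF assms(1)])
  moreover have "F (t, pi) = F (t, - pi)"
    using assms(2)[unfolded x_periodic_def, rule_format, of t "- pi"] by simp
  ultimately show ?thesis by (simp add: integral_unique)
qed

text \<open>The derivative with respect to the shift is a difference of two values of B one period
  apart, which is zero.\<close>

lemma integral_shift_periodic:
  fixes B :: "real \<Rightarrow> complex"
  assumes "continuous_on UNIV B" "\<And>x. B (x + 2 * pi) = B x"
  shows "integral {-pi..pi} (\<lambda>x. B (s + x)) = integral {-pi..pi} B"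
proof -
  define G where "G s = s *\<^sub>R integral {0..1} (\<lambda>\<tau>. B (s * \<tau>))" for s
  have G: "(G has_vector_derivative B s) (at s within A)" for s A
    unfolding G_def by (rule has_vector_derivative_at_within[OF has_vector_derivative_integral_scaled[OF assms(1)]])
  have i: "integral {-pi..pi} (\<lambda>x. B (s + x)) = G (s + pi) - G (s - pi)" for s
  proof -
    have "((\<lambda>x. B (s + x)) has_integral G (s + pi) - G (s + - pi)) {-pi..pi}"
    proof (rule fundamental_theorem_of_calculus)
      fix x
      have "((\<lambda>x. s + x) has_vector_derivative 1) (at x within {-pi..pi})"
        by (auto intro!: derivative_eq_intros)
      from vector_diff_chain_within[OF this G]
      show "((\<lambda>x. G (s + x)) has_vector_derivative B (s + x)) (at x within {-pi..pi})"
        by (simp add: o_def)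
    qed simp
    then show ?thesis by (simp add: integral_unique)
  qed
  have "((\<lambda>s. G (s + pi) - G (s - pi)) has_vector_derivative 0) (at s within UNIV)" for s
  proof -
    have "((\<lambda>s. s + pi) has_vector_derivative 1) (at s)" "((\<lambda>s. s - pi) has_vector_derivative 1) (at s)"
      by (auto intro!: derivative_eq_intros)
    from has_vector_derivative_diff[OF vector_diff_chain_at[OF this(1) G] vector_diff_chain_at[OF this(2) G]]
    show ?thesis using assms(2)[of "s - pi"] by (simp add: o_def algebra_simps)
  qed
  then obtain k where k: "\<And>s. G (s + pi) - G (s - pi) = k"
    using has_vector_derivative_zero_constant[OF convex_UNIV, of "\<lambda>s. G (s + pi) - G (s - pi)"] by auto
  show ?thesis using i[of s] i[of 0] k[of s] k[of 0] by simp
qed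

lemma strong_sol_diff:
  assumes "strong_sol M z y p v q r h k l f" "strong_sol M z' y' p' v' q' r' h' k' l' f'"
  shows "strong_sol M (\<lambda>X. z X - z' X) (\<lambda>X. y X - y' X) (\<lambda>X. p X - p' X) (\<lambda>X. v X - v' X)
    (\<lambda>X. q X - q' X) (\<lambda>X. r X - r' X) (\<lambda>X. h X - h' X) (\<lambda>X. k X - k' X) (\<lambda>X. l X - l' X) (\<lambda>X. f X - f' X)"
proof -
  have C: "C1 z y p" "C1 y v q" "C1 p q r" "C1 h k l" "C1 z' y' p'" "C1 y' v' q'" "C1 p' q' r'" "C1 h' k' l'"
    using assms unfolding strong_sol_def by blast+
  have e: "h = (\<lambda>X. v X - r X + complex_of_real M * y X + (complex_of_real M)\<^sup>2 * z X)"
    "f = (\<lambda>X. k X - complex_of_real M * h X + (complex_of_real M) ^ 3 * z X)"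
    "h' = (\<lambda>X. v' X - r' X + complex_of_real M * y' X + (complex_of_real M)\<^sup>2 * z' X)"
    "f' = (\<lambda>X. k' X - complex_of_real M * h' X + (complex_of_real M) ^ 3 * z' X)"
    using assms by (auto simp: strong_sol_def fun_eq_iff simp del: split_paired_All)
  show ?thesis
    unfolding strong_sol_def
  proof (intro conjI allI)
    show "h X - h' X = v X - v' X - (r X - r' X) + complex_of_real M * (y X - y' X) + (complex_of_real M)\<^sup>2 * (z X - z' X)" for X
      unfolding e(1) e(3) by (simp add: algebra_simps)
    show "f X - f' X = k X - k' X - complex_of_real M * (h X - h' X) + (complex_of_real M) ^ 3 * (z X - z' X)" for X
      unfolding e(2) e(4) by (simp add: algebra_simps)
  qed (intro C1_diff C)+
qed

text \<open>A bump on (x0, x0 + \<epsilon>) is periodized with \<open>per\<close> at c = 0 and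
  divided by its integral. The unit integral makes m(t) B(x + c t) have mean m(t) exactly.\<close>

lemma periodic_bump:
  assumes W: "torus_set W" "{x0<..<x0 + \<epsilon>} \<subseteq> W" and \<epsilon>: "\<epsilon> > 0"
  obtains B :: "nat \<Rightarrow> real \<Rightarrow> complex" where
    "\<And>n x. (B n has_vector_derivative B (Suc n) x) (at x)"
    "\<And>n x. B n (x + 2 * pi) = B n x" "\<And>n x. B n x \<noteq> 0 \<Longrightarrow> x \<in> W"
    "integral {-pi..pi} (B 0) = 1"
proof -
  obtain \<beta> :: "nat \<Rightarrow> real \<Rightarrow> real" where \<beta>: "\<And>n x. (\<beta> n has_real_derivative \<beta> (Suc n) x) (at x)"
    "\<And>n x. x \<notin> {x0<..<x0 + \<epsilon>} \<Longrightarrow> \<beta> n x = 0" "\<And>x. x \<in> {x0<..<x0 + \<epsilon>} \<Longrightarrow> \<beta> 0 x > 0"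
    by (rule smooth_bump[of x0 "x0 + \<epsilon>"]) (use \<epsilon> in simp, rule that)
  define R where "R = \<bar>x0\<bar> + \<epsilon>"
  define G where "G n X = complex_of_real (\<beta> n (snd X))" for n and X :: "real \<times> real"
  have CG: "C1 (G n) (\<lambda>_. 0) (G (Suc n))" for n
    using C1_real_plane_wave[OF \<beta>(1)[of n] \<beta>(1)[of "Suc n"], of 0 1 0] by (simp add: G_def[abs_def])
  have slab: "slab 0 R (G n)" for n
    unfolding slab_def
  proof (intro allI impI)
    fix t x :: real assume "R < \<bar>x + 0 * t\<bar>"
    then have "x \<notin> {x0<..<x0 + \<epsilon>}" by (auto simp: R_def)
    then show "G n (t, x) = 0" using \<beta>(2)[of x n] by (simp add: G_def del: greaterThanLessThan_iff)
  qed
  have slab0: "slab 0 R (\<lambda>_. 0)" by (simp add: slab_def)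
  define b where "b n x = per 0 R (G n) (0, x)" for n x
  have b: "(b n has_vector_derivative b (Suc n) x) (at x)" for n x
  proof -
    have "C1 (per 0 R (G n)) (per 0 R (\<lambda>_. 0)) (per 0 R (G (Suc n)))"
      by (intro C1_per CG slab slab0)
    from C1_partial_snd[OF this, of 0 x UNIV] show ?thesis by (simp add: b_def[abs_def])
  qed
  have bper: "b n (x + 2 * pi) = b n x" for n x
    by (simp add: b_def per_periodic[OF slab])
  have bW: "x \<in> W" if nz: "b n x \<noteq> 0" for n x
  proof -
    have "\<exists>i. G n (0, x + 2 * pi * of_int i) \<noteq> 0"
      by (rule ccontr) (use nz in \<open>simp add: b_def per_def\<close>)
    then obtain i where "G n (0, x + 2 * pi * of_int i) \<noteq> 0" ..
    then have "\<beta> n (x + 2 * pi * of_int i) \<noteq> 0" by (simp add: G_def)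
    then have "x + 2 * pi * of_int i \<in> W" using \<beta>(2) W(2) by blast
    then show ?thesis using shift_2pi_int[of "\<lambda>x. x \<in> W" x i] W(1) by (simp add: torus_set_def)
  qed
  have bc: "continuous_on A (b n)" for n A
    by (rule continuous_at_imp_continuous_on) (simp add: has_vector_derivative_continuous[OF b])
  have Re_b: "Re (b 0 x) = (\<Sum>n \<in> {- \<lceil>\<bar>x\<bar> + R\<rceil> .. \<lceil>\<bar>x\<bar> + R\<rceil>}. \<beta> 0 (x + 2 * pi * of_int n))" for x
    by (simp add: b_def per_def G_def)
  have \<beta>0: "\<beta> 0 x \<ge> 0" for x using \<beta>(2)[of x 0] \<beta>(3)[of x] by (cases "x \<in> {x0<..<x0+\<epsilon>}") (simp_all add: less_imp_le del: greaterThanLessThan_iff)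
  have nonneg: "Re (b 0 x) \<ge> 0" for x
    unfolding Re_b by (intro sum_nonneg \<beta>0)
  define I where "I = integral {-pi..pi} (b 0)"
  \<comment> \<open>Otherwise the nonnegative continuous sum would vanish on the fundamental domain,
    and hence, by periodicity, at the midpoint of the original bump.\<close>
  have "I \<noteq> 0"
  proof
    assume "I = 0"
    have "(b 0 has_integral I) {-pi..pi}"
      unfolding I_def by (intro integrable_integral integrable_continuous_real bc)
    from has_integral_Re[OF this] have "integral {-pi..pi} (\<lambda>x. Re (b 0 x)) = 0"
      using \<open>I = 0\<close> by (simp add: integral_unique)
    then have z: "\<forall>x\<in>{-pi..pi}. Re (b 0 x) = 0"
      using nonneg by (subst (asm) integral_eq_0_iff) (auto intro!: continuous_intros bc)
    define x1 where "x1 = x0 + \<epsilon> / 2"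
    define w where "w = (x1 + pi) / (2 * pi)"
    define n where "n = - \<lfloor>w\<rfloor>"
    have "x1 + 2 * pi * of_int n = 2 * pi * (w - of_int \<lfloor>w\<rfloor>) - pi"
      by (simp add: w_def n_def right_diff_distrib)
    moreover have "0 \<le> w - of_int \<lfloor>w\<rfloor>" "w - of_int \<lfloor>w\<rfloor> \<le> 1"
      by linarith+
    then have "0 \<le> 2 * pi * (w - of_int \<lfloor>w\<rfloor>)" "2 * pi * (w - of_int \<lfloor>w\<rfloor>) \<le> 2 * pi * 1"
      by (intro mult_nonneg_nonneg mult_left_mono; simp)+
    ultimately have "x1 + 2 * pi * of_int n \<in> {-pi..pi}" by simp
    then have "Re (b 0 (x1 + 2 * pi * of_int n)) = 0" using z by blast
    then have "Re (b 0 x1) = 0" using shift_2pi_int[of "b 0" x1 n, OF bper] by simp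
    moreover have "\<beta> 0 (x1 + 2 * pi * of_int 0) \<le> Re (b 0 x1)"
      unfolding Re_b using \<epsilon> by (intro member_le_sum \<beta>0) (auto simp: R_def)
    moreover have "\<beta> 0 x1 > 0" using \<epsilon> by (intro \<beta>(3)) (auto simp: x1_def)
    ultimately show False by simp
  qed
  show thesis
  proof (rule that[of "\<lambda>n x. b n x / I"])
    show "((\<lambda>x. b n x / I) has_vector_derivative b (Suc n) x / I) (at x)" for n x
      by (intro has_vector_derivative_divide b)
    show "integral {-pi..pi} (\<lambda>x. b 0 x / I) = 1"
      using \<open>I \<noteq> 0\<close> by (simp add: I_def)
  qed (use bper bW in auto)
qed

text \<open>Subtracting m(t) B(x + c t), where m is the integral of z over a period, changes the
  control only inside the moving set. It respects both ends: m vanishes near T together with z, and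
  m, m' and m'' vanish at t = 0 because the data have mean zero.\<close>

lemma controlled_solution:
  fixes c T M x0 \<epsilon> K :: real and Y0 Y1 Y0' Y1' :: "real \<Rightarrow> complex"
  assumes c: "c \<notin> {-1, 0, 1}"
    and T: "T > 2 * pi * (1 / \<bar>c\<bar> + 1 / \<bar>1 - c\<bar> + 1 / \<bar>1 + c\<bar>)"
    and Y0: "\<And>x. (Y0 has_vector_derivative Y0' x) (at x)" "continuous_on UNIV Y0'"
    and Y1: "\<And>x. (Y1 has_vector_derivative Y1' x) (at x)" "continuous_on UNIV Y1'"
    and bd: "\<And>x. norm (Y0 x) \<le> K" "\<And>x. norm (Y0' x) \<le> K" "\<And>x. norm (Y1 x) \<le> K" "\<And>x. norm (Y1' x) \<le> K"
    and per: "periodic Y0" "periodic Y1"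
    and mean: "integral {-pi..pi} Y0 = 0" "integral {-pi..pi} Y1 = 0"
    and W: "torus_set W" "{x0<..<x0 + \<epsilon>} \<subseteq> W" and \<epsilon>: "\<epsilon> > 0"
  obtains \<delta> z y p v q r h k l f where "0 < \<delta>" "\<delta> < T"
    "strong_sol M z y p v q r h k l f"
    "\<forall>F\<in>{z, y, p, v, q, r, h, k, l, f}. x_periodic F"
    "\<And>x. z (0, x) = 0 \<and> y (0, x) = Y0 x \<and> v (0, x) = Y1 x"
    "\<And>t x. T - \<delta> < t \<Longrightarrow> z (t, x) = 0"
    "\<And>t x. f (t, x) \<noteq> 0 \<Longrightarrow> x + c * t \<in> W"
    "\<And>t. integral {-pi..pi} (\<lambda>x. z (t, x)) = 0"
proof -
  obtain \<delta> z y p v q r h k l f where \<delta>: "0 < \<delta>" "\<delta> < T"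
    and S: "strong_sol M z y p v q r h k l f"
    and xp: "\<forall>F\<in>{z, y, p, v, q, r, h, k, l, f}. x_periodic F"
    and init: "\<And>x. z (0, x) = 0 \<and> y (0, x) = Y0 x \<and> v (0, x) = Y1 x"
    and fin: "\<And>t x. T - \<delta> < t \<Longrightarrow> z (t, x) = 0"
    and fW: "\<And>t x. f (t, x) \<noteq> 0 \<Longrightarrow> x + c * t \<in> W"
    by (rule glued_solution[OF c T Y0 Y1 bd per W \<epsilon>, of M]) (rule that)
  obtain B :: "nat \<Rightarrow> real \<Rightarrow> complex" where B:
    "\<And>n x. (B n has_vector_derivative B (Suc n) x) (at x)"
    "\<And>n x. B n (x + 2 * pi) = B n x" "\<And>n x. B n x \<noteq> 0 \<Longrightarrow> x \<in> W"
    "integral {-pi..pi} (B 0) = 1"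
    by (rule periodic_bump[OF W \<epsilon>]) (rule that)
  have C: "C1 z y p" "C1 y v q" "C1 p q r" "C1 h k l"
    and eh: "\<And>X. h X = v X - r X + complex_of_real M * y X + (complex_of_real M)\<^sup>2 * z X"
    using S by (auto simp: strong_sol_def simp del: split_paired_All)
  have Bc: "continuous_on A (B n)" for n A
    by (rule continuous_at_imp_continuous_on) (simp add: has_vector_derivative_continuous[OF B(1)])
  let ?c = "complex_of_real c" and ?M = "complex_of_real M"
  let ?I = "\<lambda>F t. integral {-pi..pi} (\<lambda>x. F (t, x))"
  \<comment> \<open>m and its first three derivatives. The third is not taken from z, which is only
    C^2, but from h: since z_xx has mean zero, z_tt has the same mean as h - M y - M^2 z, and these
    three functions are C^1.\<close>
  define m where "m i = (if i = 0 then ?I z else if i = 1 then ?I y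
    else if i = 2 then ?I v else (\<lambda>t. ?I k t - ?M * ?I v t - ?M\<^sup>2 * ?I y t))" for i :: nat
  have "?I v t = ?I h t - ?M * ?I y t - ?M\<^sup>2 * ?I z t" for t
  proof -
    have cs: "continuous_on {-pi..pi} (\<lambda>x. F (t, x))" if "F \<in> {z, y, h, r}" for F
      using that C C1_continuous_partials[OF C(3)]
      by (auto intro!: continuous_on_slice intro: C1_continuous)
    have "v (t, x) = h (t, x) + r (t, x) - ?M * y (t, x) - ?M\<^sup>2 * z (t, x)" for x
      by (simp add: eh)
    then have "?I v t = integral {-pi..pi} (\<lambda>x. h (t, x) + r (t, x) - ?M * y (t, x) - ?M\<^sup>2 * z (t, x))"
      by simp
    also have "\<dots> = ?I h t + ?I r t - ?M * ?I y t - ?M\<^sup>2 * ?I z t"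
      using cs[of h] cs[of r] cs[of y] cs[of z]
      by (simp add: integral_diff integral_add integrable_continuous_real continuous_intros)
    also have "?I r t = 0"
      by (rule integral_x_derivative_eq_0[OF C(3)]) (use xp in auto)
    finally show ?thesis by simp
  qed
  then have Iv: "?I v = (\<lambda>t. ?I h t - ?M * ?I y t - ?M\<^sup>2 * ?I z t)" by auto
  have m': "(m i has_vector_derivative m (Suc i) t) (at t)" if "i < 3" for i t
  proof -
    have "(?I v has_vector_derivative ?I k t - ?M * ?I v t - ?M\<^sup>2 * ?I y t) (at t)"
      by (subst Iv) (intro has_vector_derivative_diff has_vector_derivative_mult_right
        C1_integral_has_vector_derivative[OF C(1)] C1_integral_has_vector_derivative[OF C(2)]
        C1_integral_has_vector_derivative[OF C(4)])
    then show ?thesis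
      using that C1_integral_has_vector_derivative[OF C(1), of "-pi" pi t] C1_integral_has_vector_derivative[OF C(2), of "-pi" pi t]
      by (auto simp: m_def less_Suc_eq numeral_3_eq_3 numeral_2_eq_2)
  qed
  have mc: "continuous_on UNIV (m (Suc i))" if "i < 3" for i
    using that C C1_continuous_partials(1)[OF C(2)] C1_continuous_partials(1)[OF C(4)]
    by (auto simp: m_def intro!: continuous_intros continuous_on_integral_slice intro: C1_continuous)
  define \<mu> where "\<mu> i X = m i (fst X)" for i and X :: "real \<times> real"
  define g where "g n X = B n (c * fst X + snd X)" for n and X :: "real \<times> real"
  have C\<mu>: "C1 (\<mu> i) (\<mu> (Suc i)) (\<lambda>_. 0)" if "i < 3" for i
    using C1_plane_wave[OF m'[OF that] mc[OF that], of 1 0 0] by (simp add: \<mu>_def[abs_def])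
  have Cg: "C1 (g n) (\<lambda>X. ?c * g (Suc n) X) (g (Suc n))" for n
    using C1_plane_wave[OF B(1) Bc, of n c 1 0] by (simp add: g_def[abs_def])
  have Cm: "C1 (\<lambda>X. \<mu> i X * g n X) (\<lambda>X. \<mu> (Suc i) X * g n X + \<mu> i X * (?c * g (Suc n) X)) (\<lambda>X. \<mu> i X * g (Suc n) X)"
    if "i < 3" for i n
    using C1_mult[OF C\<mu>[OF that] Cg[of n]] by simp
  define z' where "z' X = \<mu> 0 X * g 0 X" for X
  define y' where "y' X = \<mu> 1 X * g 0 X + ?c * (\<mu> 0 X * g 1 X)" for X
  define p' where "p' X = \<mu> 0 X * g 1 X" for X
  define v' where "v' X = \<mu> 2 X * g 0 X + (2 * ?c * (\<mu> 1 X * g 1 X) + ?c\<^sup>2 * (\<mu> 0 X * g 2 X))" for X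
  define q' where "q' X = \<mu> 1 X * g 1 X + ?c * (\<mu> 0 X * g 2 X)" for X
  define r' where "r' X = \<mu> 0 X * g 2 X" for X
  define h' where "h' X = v' X - r' X + ?M * y' X + ?M\<^sup>2 * z' X" for X
  have n: "Suc 0 = 1" "Suc 1 = 2" "Suc 2 = 3" by simp_all
  \<comment> \<open>All that is needed of h' without writing out its derivatives: they exist and are
    continuous and periodic, and the time derivative vanishes wherever the bump and its derivatives
    do. These properties pass to sums and multiples.\<close>
  define good where "good F \<longleftrightarrow> (\<exists>Ft Fx. C1 F Ft Fx \<and> (\<forall>X. (\<forall>n. g n X = 0) \<longrightarrow> Ft X = 0) \<and>
     x_periodic Ft \<and> x_periodic Fx)" for F
  have gper: "g n (t, x + 2 * pi) = g n (t, x)" for n t x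
    using B(2)[of n "c * t + x"] by (simp add: g_def add.assoc)
  have \<mu>per: "\<mu> n (t, x + 2 * pi) = \<mu> n (t, x)" for n t x
    by (simp add: \<mu>_def)
  have good_m: "good (\<lambda>X. \<mu> i X * g n X)" if "i < 3" for i n
    unfolding good_def using Cm[OF that, of n]
    by (intro exI conjI, assumption) (auto simp: x_periodic_def gper \<mu>per)
  have good_add: "good (\<lambda>X. F X + G X)" if FG: "good F" "good G" for F G
  proof -
    obtain Ft Fx Gt Gx where *: "C1 F Ft Fx" "\<forall>X. (\<forall>n. g n X = 0) \<longrightarrow> Ft X = 0" "x_periodic Ft" "x_periodic Fx"
      "C1 G Gt Gx" "\<forall>X. (\<forall>n. g n X = 0) \<longrightarrow> Gt X = 0" "x_periodic Gt" "x_periodic Gx"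
      using FG unfolding good_def by (elim exE conjE) (rule that)
    show ?thesis unfolding good_def
      by (intro exI conjI, rule C1_add[OF *(1,5)]) (use * in \<open>auto simp: x_periodic_def simp del: split_paired_All\<close>)
  qed
  have good_cmul: "good (\<lambda>X. a * F X)" if F: "good F" for F a
  proof -
    obtain Ft Fx where *: "C1 F Ft Fx" "\<forall>X. (\<forall>n. g n X = 0) \<longrightarrow> Ft X = 0" "x_periodic Ft" "x_periodic Fx"
      using F unfolding good_def by (elim exE conjE) (rule that)
    show ?thesis unfolding good_def
      by (intro exI conjI, rule C1_cmul[OF *(1)]) (use * in \<open>auto simp: x_periodic_def simp del: split_paired_All\<close>)
  qed
  have "good h'"
  proof -
    have "h' = (\<lambda>X. v' X + ((-1) * r' X + (?M * y' X + ?M\<^sup>2 * z' X)))"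
      by (simp add: fun_eq_iff h'_def)
    moreover have "good (\<lambda>X. v' X + ((-1) * r' X + (?M * y' X + ?M\<^sup>2 * z' X)))"
      unfolding v'_def[abs_def] y'_def[abs_def] r'_def[abs_def] z'_def[abs_def]
      by (intro good_add good_cmul good_m) auto
    ultimately show ?thesis by (simp only:)
  qed
  then obtain k' l' where k': "C1 h' k' l'" "\<forall>X. (\<forall>n. g n X = 0) \<longrightarrow> k' X = 0" "x_periodic k'" "x_periodic l'"
    unfolding good_def by (elim exE conjE) (rule that)
  define f' where "f' X = k' X - ?M * h' X + ?M ^ 3 * z' X" for X
  have S': "strong_sol M z' y' p' v' q' r' h' k' l' f'"
    unfolding strong_sol_def
  proof (intro conjI allI k'(1))
    show "C1 z' y' p'"
      by (rule C1_cong[OF Cm[of 0 0]]) (simp_all add: z'_def y'_def p'_def mult_ac)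
    show "C1 y' v' q'"
    proof (rule C1_cong[OF C1_add[OF Cm[of 1 0] C1_cmul[OF Cm[of 0 1], of ?c]]])
      show "\<mu> (Suc 1) X * g 0 X + \<mu> 1 X * (?c * g (Suc 0) X) + ?c * (\<mu> (Suc 0) X * g 1 X + \<mu> 0 X * (?c * g (Suc 1) X)) = v' X" for X
        unfolding n v'_def by (simp add: algebra_simps power2_eq_square)
      show "\<mu> 1 X * g (Suc 0) X + ?c * (\<mu> 0 X * g (Suc 1) X) = q' X" for X
        unfolding n q'_def by simp
    qed (simp_all add: y'_def)
    show "C1 p' q' r'"
    proof (rule C1_cong[OF Cm[of 0 1]])
      show "\<mu> (Suc 0) X * g 1 X + \<mu> 0 X * (?c * g (Suc 1) X) = q' X" for X
        unfolding n q'_def by (simp add: algebra_simps)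
      show "\<mu> 0 X * g (Suc 1) X = r' X" for X unfolding n r'_def by simp
    qed (simp_all add: p'_def)
  qed (simp_all add: h'_def f'_def)
  have m0: "m 0 t = 0" if "T - \<delta> < t" for t using fin[OF that] by (simp add: m_def)
  have minit: "m 0 0 = 0" "m 1 0 = 0" "m 2 0 = 0" using init mean by (simp_all add: m_def)
  show thesis
  proof (rule that[OF \<delta> strong_sol_diff[OF S S']])
    show "\<forall>F\<in>{\<lambda>X. z X - z' X, \<lambda>X. y X - y' X, \<lambda>X. p X - p' X, \<lambda>X. v X - v' X, \<lambda>X. q X - q' X,
       \<lambda>X. r X - r' X, \<lambda>X. h X - h' X, \<lambda>X. k X - k' X, \<lambda>X. l X - l' X, \<lambda>X. f X - f' X}. x_periodic F"
      using xp k'(3,4)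
      by (auto simp: x_periodic_def gper \<mu>per z'_def y'_def p'_def v'_def q'_def r'_def h'_def f'_def)
    show "z (0, x) - z' (0, x) = 0 \<and> y (0, x) - y' (0, x) = Y0 x \<and> v (0, x) - v' (0, x) = Y1 x" for x
      using init minit by (simp add: z'_def y'_def v'_def \<mu>_def)
    show "z (t, x) - z' (t, x) = 0" if "T - \<delta> < t" for t x
      using fin[OF that] m0[OF that] by (simp add: z'_def \<mu>_def)
    show "x + c * t \<in> W" if nz: "f (t, x) - f' (t, x) \<noteq> 0" for t x
    proof (rule ccontr)
      assume nW: "x + c * t \<notin> W"
      then have g0: "g n (t, x) = 0" for n
        using B(3)[of n "c * t + x"] by (auto simp: g_def add.commute)
      then have "f' (t, x) = 0"
        using k'(2) by (simp add: f'_def h'_def v'_def r'_def y'_def z'_def)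
      moreover have "f (t, x) = 0" using fW nW by blast
      ultimately show False using nz by simp
    qed
    show "integral {-pi..pi} (\<lambda>x. z (t, x) - z' (t, x)) = 0" for t
    proof -
      have i1: "(\<lambda>x. z (t, x)) integrable_on {-pi..pi}"
        by (intro integrable_continuous_real continuous_on_slice C1_continuous[OF C(1)])
      have "continuous_on UNIV (\<lambda>x. B 0 (c * t + x))"
        by (intro continuous_on_compose2[OF Bc[of UNIV]] continuous_intros) auto
      then have i2: "(\<lambda>x. m 0 t * B 0 (c * t + x)) integrable_on {-pi..pi}"
        by (intro integrable_continuous_real continuous_intros continuous_on_subset[of UNIV _ "{-pi..pi}"]) auto
      have "integral {-pi..pi} (\<lambda>x. z (t, x) - z' (t, x)) = m 0 t - m 0 t * integral {-pi..pi} (\<lambda>x. B 0 (c * t + x))"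
        using i1 i2 by (simp add: z'_def \<mu>_def g_def integral_diff m_def)
      also have "\<dots> = 0"
        using integral_shift_periodic[OF Bc[of UNIV 0] B(2)[of 0], of "c * t"] B(4) by simp
      finally show ?thesis .
    qed
  qed
qed

subsection \<open>Uniqueness of Fourier coefficients\<close>

abbreviation torus_measure :: "real measure" where
  "torus_measure \<equiv> lebesgue_on {-pi..pi}"

lemma finite_measure_torus: "finite_measure torus_measure"
  by (intro finite_measure_lebesgue_on) simp

inductive trigpoly :: "(real \<Rightarrow> complex) \<Rightarrow> bool" where
  mono: "trigpoly (\<lambda>x. a * cis (of_int k * x))"
| add: "trigpoly p \<Longrightarrow> trigpoly q \<Longrightarrow> trigpoly (\<lambda>x. p x + q x)"

lemma trigpoly_const: "trigpoly (\<lambda>x. a)"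
  using trigpoly.mono[of a 0] by simp

lemma trigpoly_mult:
  assumes "trigpoly p" "trigpoly q"
  shows "trigpoly (\<lambda>x. p x * q x)"
  using assms(1)
proof induction
  case (mono a k)
  show ?case using assms(2)
  proof induction
    case (mono b l)
    have "(\<lambda>x. a * cis (of_int k * x) * (b * cis (of_int l * x))) = (\<lambda>x. (a * b) * cis (of_int (k + l) * x))"
      by (auto simp: cis_mult[symmetric] distrib_right)
    then show ?case by (simp only: trigpoly.mono)
  next
    case (add p q)
    then show ?case by (simp add: distrib_left trigpoly.add)
  qed
next
  case (add p q)
  then show ?case by (simp add: distrib_right trigpoly.add)
qed

lemma trigpoly_cos_sin: "trigpoly (\<lambda>x. complex_of_real (cos x))" "trigpoly (\<lambda>x. complex_of_real (sin x))"
proof -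
  have "(\<lambda>x. complex_of_real (cos x)) = (\<lambda>x. 1 / 2 * cis (of_int 1 * x) + 1 / 2 * cis (of_int (- 1) * x))"
    by (auto simp: complex_eq_iff)
  then show "trigpoly (\<lambda>x. complex_of_real (cos x))" by (simp only: trigpoly.intros)
  have "(\<lambda>x. complex_of_real (sin x)) = (\<lambda>x. - \<i> / 2 * cis (of_int 1 * x) + \<i> / 2 * cis (of_int (- 1) * x))"
    by (auto simp: complex_eq_iff)
  then show "trigpoly (\<lambda>x. complex_of_real (sin x))" by (simp only: trigpoly.intros)
qed

text \<open>On the unit circle the plane coordinates are cos x and sin x. This makes the
  Stone-Weierstrass theorem on the compact circle applicable to periodic functions.\<close>

lemma trigpoly_real_polynomial:
  fixes P :: "complex \<Rightarrow> real"
  assumes "real_polynomial_function P"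
  shows "trigpoly (\<lambda>x. complex_of_real (P (cis x)))"
  using assms
proof induction
  case (linear f)
  have "f (cis x) = cos x * f 1 + sin x * f \<i>" for x
  proof -
    have "cis x = cos x *\<^sub>R 1 + sin x *\<^sub>R \<i>" by (simp add: complex_eq_iff)
    then show ?thesis
      using linear by (simp add: bounded_linear.linear linear_add linear_scale)
  qed
  then have "(\<lambda>x. complex_of_real (f (cis x))) =
      (\<lambda>x. complex_of_real (cos x) * complex_of_real (f 1) + complex_of_real (sin x) * complex_of_real (f \<i>))"
    by auto
  then show ?case by (simp only: trigpoly.add trigpoly_mult trigpoly_cos_sin trigpoly_const)
next
  case (const c)
  show ?case by (rule trigpoly_const)
next
  case (add f g)
  then show ?case by (simp add: trigpoly.add)
next
  case (mult f g)
  then show ?case by (simp add: trigpoly_mult)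
qed

lemma trigpoly_approx:
  fixes H :: "complex \<Rightarrow> real"
  assumes "continuous_on (sphere 0 1) H" "e > 0"
  shows "\<exists>p. trigpoly p \<and> (\<forall>x. norm (complex_of_real (H (cis x)) - p x) < e)"
proof -
  obtain P where P: "real_polynomial_function P" "\<And>w. w \<in> sphere 0 1 \<Longrightarrow> \<bar>H w - P w\<bar> < e"
    using Stone_Weierstrass_real_polynomial_function[OF compact_sphere assms] by auto
  show ?thesis
  proof (intro exI conjI allI)
    show "trigpoly (\<lambda>x. complex_of_real (P (cis x)))" by (rule trigpoly_real_polynomial[OF P(1)])
    show "norm (complex_of_real (H (cis x)) - complex_of_real (P (cis x))) < e" for x
      using P(2)[of "cis x"] by (simp flip: of_real_diff)
  qed
qed

lemma integrable_mult_continuous: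
  fixes f \<phi> :: "real \<Rightarrow> complex"
  assumes f: "integrable torus_measure f" and \<phi>: "continuous_on {-pi..pi} \<phi>"
  shows "integrable torus_measure (\<lambda>x. f x * \<phi> x)"
proof -
  have "bounded (\<phi> ` {-pi..pi})"
    by (intro compact_imp_bounded compact_continuous_image \<phi>) auto
  then obtain B where B: "\<And>x. x \<in> {-pi..pi} \<Longrightarrow> norm (\<phi> x) \<le> B" unfolding bounded_iff by (metis image_eqI)
  show ?thesis
  proof (rule Bochner_Integration.integrable_bound)
    show "integrable torus_measure (\<lambda>x. B * norm (f x))"
      using f by (intro integrable_mult_right integrable_norm) auto
    show "(\<lambda>x. f x * \<phi> x) \<in> borel_measurable torus_measure"
      using borel_measurable_integrable[OF f] continuous_imp_measurable_on_sets_lebesgue[OF \<phi>]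
      by (intro borel_measurable_times) auto
    show "AE x in torus_measure. norm (f x * \<phi> x) \<le> norm (B * norm (f x))"
    proof (rule AE_I2)
      fix x assume "x \<in> space torus_measure"
      then have "x \<in> {-pi..pi}" by (simp add: space_restrict_space)
      then have "norm (f x) * norm (\<phi> x) \<le> norm (f x) * \<bar>B\<bar>"
        using B[of x] by (intro mult_left_mono) auto
      then show "norm (f x * \<phi> x) \<le> norm (B * norm (f x))" by (simp add: norm_mult abs_mult mult.commute)
    qed
  qed
qed

lemma trigpoly_continuous: "trigpoly p \<Longrightarrow> continuous_on A p"
  by (induction rule: trigpoly.induct) (auto intro!: continuous_intros)

lemma LINT_trigpoly_eq_0:
  assumes "integrable torus_measure f" "\<And>k::int. (LINT x|torus_measure. f x * cis (of_int k * x)) = 0"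
  shows "trigpoly p \<Longrightarrow> (LINT x|torus_measure. f x * p x) = 0"
proof (induction rule: trigpoly.induct)
  case (mono a k)
  have "(LINT x|torus_measure. f x * (a * cis (of_int k * x))) = a * (LINT x|torus_measure. f x * cis (of_int k * x))"
    by (subst integral_mult_right_zero[symmetric]) (simp add: mult_ac)
  then show ?case using assms(2) by simp
next
  case (add p q)
  then show ?case
    using integrable_mult_continuous[OF assms(1) trigpoly_continuous[OF add(1)]]
      integrable_mult_continuous[OF assms(1) trigpoly_continuous[OF add(2)]]
    by (simp add: distrib_left)
qed

text \<open>Uniform approximation by trigonometric polynomials, against which f integrates to zero,
  leaves an error of at most d times the L^1 norm of f. Composition with \<open>cis\<close> builds
  in the periodicity.\<close>

lemma LINT_circle_function_eq_0:
  assumes f: "integrable torus_measure f" "\<And>k::int. (LINT x|torus_measure. f x * cis (of_int k * x)) = 0"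
    and H: "continuous_on UNIV (H :: complex \<Rightarrow> real)"
  shows "(LINT x|torus_measure. f x * complex_of_real (H (cis x))) = 0"
proof -
  have Hc: "continuous_on {-pi..pi} (\<lambda>x. complex_of_real (H (cis x)))"
    by (intro continuous_on_of_real continuous_on_compose2[OF H] continuous_intros) auto
  let ?N = "LINT x|torus_measure. norm (f x)"
  have "norm (LINT x|torus_measure. f x * complex_of_real (H (cis x))) \<le> 0 + e" if e: "e > 0" for e
  proof -
    have N0: "?N \<ge> 0" by (rule integral_nonneg_AE) auto
    \<comment> \<open>The added 1 keeps the quotient meaningful when f has norm zero.\<close>
    define d where "d = e / (?N + 1)"
    have d: "d > 0" unfolding d_def using e N0 by (intro divide_pos_pos add_nonneg_pos) auto
    obtain p where p: "trigpoly p" "\<And>x. norm (complex_of_real (H (cis x)) - p x) < d"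
      using trigpoly_approx[OF continuous_on_subset[OF H] d] by blast
    have ints: "integrable torus_measure (\<lambda>x. f x * complex_of_real (H (cis x)))" "integrable torus_measure (\<lambda>x. f x * p x)"
      by (intro integrable_mult_continuous f Hc trigpoly_continuous p)+
    have "(LINT x|torus_measure. f x * complex_of_real (H (cis x)))
      = (LINT x|torus_measure. f x * complex_of_real (H (cis x)) - f x * p x)"
      using ints LINT_trigpoly_eq_0[OF f p(1)] by simp
    also have "norm \<dots> \<le> (LINT x|torus_measure. d * norm (f x))"
    proof (rule Bochner_Integration.integral_norm_bound_integral)
      show "norm (f x * complex_of_real (H (cis x)) - f x * p x) \<le> d * norm (f x)" for x
        using p(2)[of x] by (simp add: right_diff_distrib[symmetric] norm_mult mult.commute[of d] mult_left_mono)
    qed (use f ints in auto)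
    also have "\<dots> = d * ?N" by simp
    also have "\<dots> \<le> d * (?N + 1)" using d by (intro mult_left_mono) auto
    also have "\<dots> = e" using N0 unfolding d_def by (intro nonzero_eq_divide_eq[THEN iffD1]) linarith+
    finally show ?thesis by simp
  qed
  then have "norm (LINT x|torus_measure. f x * complex_of_real (H (cis x))) \<le> 0"
    by (rule field_le_epsilon)
  then show ?thesis by simp
qed

text \<open>Continuous functions on the circle approximate indicators of compact sets by dominated
  convergence, and inner regularity passes from these to all measurable sets. The compact sets avoid
  the two end points, which the circle identifies.\<close>

theorem Fourier_uniqueness:
  assumes f: "integrable torus_measure f" "\<And>k::int. (LINT x|torus_measure. f x * cis (of_int k * x)) = 0"
  shows "AE x in torus_measure. f x = 0"
proof -
  interpret finite_measure torus_measure by (rule finite_measure_torus)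
  have compact_0: "(LINT x|torus_measure. indicator K x *\<^sub>R f x) = 0" if K: "compact K" "K \<subseteq> {-pi<..<pi}" for K
  proof (cases "K = {}")
    case False
    have cK: "closed (cis ` K)" "cis ` K \<noteq> {}"
      using K False by (auto intro!: compact_imp_closed compact_continuous_image continuous_intros)
    \<comment> \<open>Continuous functions on the circle that tend pointwise to the indicator of the
      closed image of K.\<close>
    define H where "H n w = max 0 (1 - real n * infdist w (cis ` K))" for n w
    have mem: "cis x \<in> cis ` K \<longleftrightarrow> x \<in> K" if x: "x \<in> {-pi..pi}" for x
    proof
      assume "cis x \<in> cis ` K"
      then obtain y where y: "y \<in> K" "cis x = cis y" by auto
      then have "sin x = sin y \<and> cos x = cos y" by (simp add: complex_eq_iff)
      then obtain n :: int where n: "x = y + 2 * pi * of_int n" using sin_cos_eq_iff by blast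
      have "- pi < y" "y < pi" using y K by auto
      then have "\<bar>2 * pi * of_int n\<bar> < 2 * pi" using x n by auto
      then have "\<bar>of_int n :: real\<bar> < 1" by (simp add: abs_mult)
      then have "n = 0" by linarith
      then show "x \<in> K" using n y by simp
    qed auto
    have lim: "(\<lambda>n. LINT x|torus_measure. f x * complex_of_real (H n (cis x))) \<longlonglongrightarrow>
        (LINT x|torus_measure. indicator K x *\<^sub>R f x)"
    proof (rule integral_dominated_convergence[where w = "\<lambda>x. norm (f x)"])
      show "(\<lambda>x. f x * complex_of_real (H n (cis x))) \<in> borel_measurable torus_measure" for n
        unfolding H_def by (intro borel_measurable_integrable integrable_mult_continuous f continuous_intros)
      show "(\<lambda>x. indicator K x *\<^sub>R f x) \<in> borel_measurable torus_measure"
        using f K by (intro borel_measurable_scaleR borel_measurable_indicator borel_measurable_integrable)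
           (auto simp: sets_restrict_space intro!: image_eqI[of _ _ K] fmeasurableD lmeasurable_compact)
      show "AE x in torus_measure. (\<lambda>n. f x * complex_of_real (H n (cis x))) \<longlonglongrightarrow> indicator K x *\<^sub>R f x"
      proof (rule AE_I2)
        fix x assume "x \<in> space torus_measure"
        then have x: "x \<in> {-pi..pi}" by (simp add: space_restrict_space)
        show "(\<lambda>n. f x * complex_of_real (H n (cis x))) \<longlonglongrightarrow> indicator K x *\<^sub>R f x"
        proof (cases "x \<in> K")
          case True
          then have "H n (cis x) = 1" for n by (simp add: H_def)
          then show ?thesis using True by simp
        next
          case False
          then have "infdist (cis x) (cis ` K) > 0"
            using mem[OF x] in_closed_iff_infdist_zero[OF cK] infdist_nonneg[of "cis x" "cis ` K"] by fastforce
          then obtain N where N: "real N * infdist (cis x) (cis ` K) > 1"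
            using reals_Archimedean3 by blast
          have "\<forall>\<^sub>F n in sequentially. f x * complex_of_real (H n (cis x)) = 0"
            unfolding eventually_sequentially
          proof (intro exI allI impI)
            fix n assume "N \<le> n"
            then have "real N * infdist (cis x) (cis ` K) \<le> real n * infdist (cis x) (cis ` K)"
              by (intro mult_right_mono) (auto simp: infdist_nonneg)
            then show "f x * complex_of_real (H n (cis x)) = 0" using N by (simp add: H_def)
          qed
          then show ?thesis using False by (simp add: tendsto_eventually)
        qed
      qed
      show "AE x in torus_measure. norm (f x * complex_of_real (H n (cis x))) \<le> norm (f x)" for n
      proof (rule AE_I2)
        fix x
        have "\<bar>H n (cis x)\<bar> \<le> 1" using infdist_nonneg[of "cis x" "cis ` K"] by (auto simp: H_def)
        then show "norm (f x * complex_of_real (H n (cis x))) \<le> norm (f x)"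
          by (simp add: norm_mult mult_left_le)
      qed
    qed (use f in auto)
    have "continuous_on UNIV (H n)" for n
      unfolding H_def by (intro continuous_intros)
    from LINT_circle_function_eq_0[OF f this] have "(\<lambda>n. LINT x|torus_measure. f x * complex_of_real (H n (cis x))) = (\<lambda>n. 0)"
      by auto
    with lim show ?thesis by (simp add: LIMSEQ_const_iff)
  qed simp
  show ?thesis
  proof (rule density_zero[OF f(1)])
    fix A assume "A \<in> sets torus_measure"
    then have A: "A \<in> sets lebesgue" "A \<subseteq> {-pi..pi}" by (auto simp: sets_restrict_space_iff)
    then have "A \<inter> {-pi<..<pi} \<in> sets lebesgue" by auto
    \<comment> \<open>Exhaustion by compact sets up to a null set; their finite unions then increase
      to the given set.\<close>
    then obtain N C where NC: "negligible N" "\<And>n::nat. compact (C n)" "A \<inter> {-pi<..<pi} = (\<Union>n. C n) \<union> N"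
      using lebesgue_regular_inner by metis
    define E where "E n = (\<Union>i\<le>n. C i)" for n
    have E: "compact (E n)" "E n \<subseteq> {-pi<..<pi}" for n
      using NC(2,3) by (auto simp: E_def intro!: compact_UN)
    have Em: "E n \<in> sets torus_measure" for n
      using E[of n] by (auto simp: sets_restrict_space_iff intro!: lmeasurable_compact fmeasurableD)
    have "(\<lambda>n. LINT x|torus_measure. indicator (E n) x *\<^sub>R f x) \<longlonglongrightarrow> (LINT x|torus_measure. indicator A x *\<^sub>R f x)"
    proof (rule integral_dominated_convergence[where w = "\<lambda>x. norm (f x)"])
      have "negligible (N \<union> {-pi, pi})" using NC(1) by (auto intro: negligible_Un)
      then have "AE x in lebesgue. x \<notin> N \<union> {-pi, pi}"
        unfolding negligible_iff_null_sets by (rule AE_not_in)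
      then have "AE x in lebesgue. x \<in> {-pi..pi} \<longrightarrow> x \<notin> N \<union> {-pi, pi}"
        by (rule eventually_mono) blast
      then have "AE x in torus_measure. x \<notin> N \<union> {-pi, pi}"
        by (subst AE_restrict_space_iff) simp_all
      then show "AE x in torus_measure. (\<lambda>n. indicator (E n) x *\<^sub>R f x) \<longlonglongrightarrow> indicator A x *\<^sub>R f x"
      proof (eventually_elim)
        case (elim x)
        show ?case
        proof (cases "x \<in> A")
          case True
          then have "x \<in> {-pi..pi}" using A(2) by blast
          with elim have "x \<in> {-pi<..<pi}" by auto
          with True have "x \<in> (\<Union>n. C n) \<union> N" unfolding NC(3)[symmetric] by blast
          with elim have "x \<in> (\<Union>n. C n)" by blast
          then obtain m where "x \<in> C m" by blast
          then have "\<forall>\<^sub>F n in sequentially. indicator (E n) x *\<^sub>R f x = f x"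
            unfolding eventually_sequentially
          proof (intro exI allI impI)
            fix n assume "m \<le> n"
            then have "x \<in> E n" using \<open>x \<in> C m\<close> by (auto simp: E_def)
            then show "indicator (E n) x *\<^sub>R f x = f x" by simp
          qed
          then show ?thesis using True by (simp add: tendsto_eventually)
        next
          case False
          then have "x \<notin> E n" for n using NC(3) by (auto simp: E_def)
          then show ?thesis using False by simp
        qed
      qed
      show "(\<lambda>x. indicator A x *\<^sub>R f x) \<in> borel_measurable torus_measure"
        "(\<lambda>x. indicator (E n) x *\<^sub>R f x) \<in> borel_measurable torus_measure" for n
        by (intro borel_measurable_scaleR borel_measurable_indicator borel_measurable_integrable f Em \<open>A \<in> sets torus_measure\<close>)+
      show "integrable torus_measure (\<lambda>x. norm (f x))" by (intro integrable_norm f)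
      show "AE x in torus_measure. norm (indicator (E n) x *\<^sub>R f x) \<le> norm (f x)" for n
        by (rule AE_I2) (simp add: indicator_def)
    qed
    then have "(LINT x|torus_measure. indicator A x *\<^sub>R f x) = 0"
      using compact_0[OF E] by (simp add: LIMSEQ_const_iff)
    then show "set_lebesgue_integral torus_measure A f = 0"
      by (simp add: set_lebesgue_integral_def)
  qed
qed

subsection \<open>Weak derivatives on the torus\<close>

lemma L2_integrable:
  assumes "f \<in> L2"
  shows "integrable torus_measure f"
proof (rule Bochner_Integration.integrable_bound)
  interpret finite_measure torus_measure by (rule finite_measure_torus)
  show "integrable torus_measure (\<lambda>x. 1 + (cmod (f x))\<^sup>2)"
    using assms by (auto simp: L2_def)
  show "f \<in> borel_measurable torus_measure" using assms by (simp add: L2_def)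
  show "AE x in torus_measure. norm (f x) \<le> norm (1 + (cmod (f x))\<^sup>2)"
  proof (rule AE_I2)
    fix x
    have "0 \<le> (cmod (f x) - 1)\<^sup>2" by simp
    then have "2 * cmod (f x) \<le> 1 + (cmod (f x))\<^sup>2" by (simp add: power2_diff)
    then have "cmod (f x) \<le> 1 + (cmod (f x))\<^sup>2" using norm_ge_zero[of "f x"] by linarith
    also have "\<dots> \<le> norm (1 + (cmod (f x))\<^sup>2)" by simp
    finally show "norm (f x) \<le> norm (1 + (cmod (f x))\<^sup>2)" .
  qed
qed

lemma L2_D:
  assumes "f \<in> L2"
  shows "periodic f" "f \<in> borel_measurable torus_measure" "integrable torus_measure (\<lambda>x. (cmod (f x))\<^sup>2)"
  using assms by (auto simp: L2_def)

lemma integrable_torus_continuous: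
  fixes f :: "real \<Rightarrow> 'a::euclidean_space"
  assumes "continuous_on {-pi..pi} f"
  shows "integrable torus_measure f" "(LINT x|torus_measure. f x) = integral {-pi..pi} f"
proof -
  show "integrable torus_measure f" by (rule continuous_imp_integrable_real[OF assms])
  then show "(LINT x|torus_measure. f x) = integral {-pi..pi} f"
    by (rule lebesgue_integral_eq_integral) simp
qed

lemma continuous_in_L2:
  assumes "continuous_on {-pi..pi} f" "periodic f"
  shows "f \<in> L2"
  unfolding L2_def
proof (intro CollectI conjI assms(2))
  show "f \<in> borel_measurable torus_measure"
    by (rule continuous_imp_measurable_on_sets_lebesgue[OF assms(1)]) simp
  show "integrable torus_measure (\<lambda>x. (cmod (f x))\<^sup>2)"
    by (intro integrable_torus_continuous continuous_intros assms)
qed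

text \<open>The line is covered by countably many translates of the fundamental domain, and
  translates of a null set are null.\<close>

lemma ae_eq_torusI:
  assumes "AE x in torus_measure. f x = g x" "periodic f" "periodic g"
  shows "ae_eq f g"
proof -
  let ?N = "{x \<in> {-pi..pi}. f x \<noteq> g x}"
  have "AE x in lebesgue. x \<in> {-pi..pi} \<longrightarrow> f x = g x"
    using assms(1) by (subst (asm) AE_restrict_space_iff) simp_all
  then obtain N where N: "{x \<in> space lebesgue. \<not> (x \<in> {-pi..pi} \<longrightarrow> f x = g x)} \<subseteq> N"
    "emeasure lebesgue N = 0" "N \<in> sets lebesgue"
    by (rule AE_E)
  then have "negligible N" unfolding negligible_iff_null_sets by blast
  then have "negligible ?N" by (rule negligible_subset) (use N(1) in auto)
  then have neg: "negligible ((+) (2 * pi * of_int n) ` ?N)" for n :: int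
    by (rule negligible_translation)
  have "negligible (\<Union>n::int. (+) (2 * pi * of_int n) ` ?N)"
    using neg by (intro negligible_countable_Union) auto
  moreover have "{x. f x \<noteq> g x} \<subseteq> (\<Union>n::int. (+) (2 * pi * of_int n) ` ?N)"
  proof
    fix x assume x: "x \<in> {x. f x \<noteq> g x}"
    define w where "w = (x + pi) / (2 * pi)"
    have "x + 2 * pi * of_int (- \<lfloor>w\<rfloor>) = 2 * pi * (w - of_int \<lfloor>w\<rfloor>) - pi"
      by (simp add: w_def right_diff_distrib)
    moreover have "0 \<le> w - of_int \<lfloor>w\<rfloor>" "w - of_int \<lfloor>w\<rfloor> \<le> 1"
      by linarith+
    then have "0 \<le> 2 * pi * (w - of_int \<lfloor>w\<rfloor>)" "2 * pi * (w - of_int \<lfloor>w\<rfloor>) \<le> 2 * pi * 1"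
      by (intro mult_nonneg_nonneg mult_left_mono; simp)+
    ultimately have "x + 2 * pi * of_int (- \<lfloor>w\<rfloor>) \<in> {-pi..pi}" by simp
    moreover have "f (x + 2 * pi * of_int (- \<lfloor>w\<rfloor>)) \<noteq> g (x + 2 * pi * of_int (- \<lfloor>w\<rfloor>))"
      using x shift_2pi_int[of f x "- \<lfloor>w\<rfloor>"] shift_2pi_int[of g x "- \<lfloor>w\<rfloor>"] assms(2,3)
      by (simp add: periodic_def)
    ultimately have "x \<in> (+) (2 * pi * of_int \<lfloor>w\<rfloor>) ` ?N"
      by (intro image_eqI[of _ _ "x + 2 * pi * of_int (- \<lfloor>w\<rfloor>)"]) auto
    then show "x \<in> (\<Union>n::int. (+) (2 * pi * of_int n) ` ?N)" by blast
  qed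
  ultimately have "negligible {x. f x \<noteq> g x}" by (rule negligible_subset)
  then have "AE x in lebesgue. x \<notin> {x. f x \<noteq> g x}"
    unfolding negligible_iff_null_sets by (rule AE_not_in)
  then show ?thesis unfolding ae_eq_def by (rule eventually_mono) simp
qed

lemma ae_eq_torusD: "ae_eq f g \<Longrightarrow> AE x in torus_measure. f x = g x"
  unfolding ae_eq_def by (subst AE_restrict_space_iff) (auto elim: eventually_mono)

lemma LINT_cong_ae_eq:
  fixes f g :: "real \<Rightarrow> complex"
  assumes "AE x in torus_measure. f x = g x" "f \<in> borel_measurable torus_measure" "g \<in> borel_measurable torus_measure"
    and \<phi>: "\<phi> \<in> borel_measurable torus_measure"
  shows "(LINT x|torus_measure. f x * \<phi> x) = (LINT x|torus_measure. g x * \<phi> x)"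
  by (rule integral_cong_AE) (use assms in \<open>auto elim: eventually_mono\<close>)

section \<open>Fourier modes, primitives and weak derivatives\<close>

definition expi :: "int \<Rightarrow> real \<Rightarrow> complex" where
  "expi k x = cis (of_int k * x)"

lemma expi_0: "expi 0 x = 1" by (simp add: expi_def)

lemma expi_deriv: "((expi k) has_vector_derivative \<i> * of_int k * expi k x) (at x within A)"
proof -
  have "((\<lambda>z. exp (\<i> * of_int k * z)) has_field_derivative \<i> * of_int k * exp (\<i> * of_int k * of_real x)) (at (of_real x))"
    by (auto intro!: derivative_eq_intros)
  from has_vector_derivative_real_field[OF this, of A]
  show ?thesis unfolding expi_def[abs_def] cis_conv_exp by (simp add: mult.assoc)
qed

lemma expi_continuous: "continuous_on A (expi k)"
  unfolding expi_def[abs_def] by (intro continuous_intros)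

lemma expi_periodic: "expi k (x + 2 * pi) = expi k x"
proof -
  have "of_int k * (x + 2 * pi) = of_int k * x + 2 * pi * of_int k" by (simp add: algebra_simps)
  then show ?thesis unfolding expi_def by (simp add: complex_eq_iff cos_add sin_add cos_int_2pin sin_int_2pin)
qed

lemma expi_smooth:
  "nderiv n (expi k) = (\<lambda>x. (\<i> * of_int k) ^ n * expi k x)" "smooth (expi k)"
proof -
  let ?g = "\<lambda>n x. (\<i> * of_int k) ^ n * expi k x"
  have g: "(?g n has_vector_derivative ?g (Suc n) x) (at x)" for n x
    using has_vector_derivative_mult_right[OF expi_deriv[of k x UNIV], of "(\<i> * of_int k) ^ n"]
    by (simp add: mult_ac)
  have 0: "?g 0 = expi k" by auto
  from smooth_chain[of ?g, OF g] show "nderiv n (expi k) = ?g n" "smooth (expi k)"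
    unfolding 0 by blast+
qed

lemma LINT_expi: "(LINT x|torus_measure. expi k x) = (if k = 0 then 2 * pi else 0)"
proof (cases "k = 0")
  case True
  then show ?thesis
    by (simp only: expi_0 integrable_torus_continuous(2)[OF continuous_on_const]) (simp add: scaleR_conv_of_real)
next
  case False
  have I: "((\<lambda>x. \<i> * of_int k * expi k x) has_integral (expi k pi - expi k (- pi))) {-pi..pi}"
    by (rule fundamental_theorem_of_calculus) (auto intro: expi_deriv)
  have "expi k pi = expi k (- pi)" using expi_periodic[of k "-pi"] by simp
  then have "\<i> * of_int k * integral {-pi..pi} (expi k) = 0"
    using integral_unique[OF I] by simp
  then show ?thesis using False by (simp add: integrable_torus_continuous(2) expi_continuous)
qed

text \<open>The exponentials are admissible test functions, on which weak differentiation acts as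
  multiplication of Fourier coefficients.\<close>

lemma weak_derivD:
  assumes "weak_deriv 1 f g"
  shows "\<i> * of_int k * (LINT x|torus_measure. f x * expi k x) = - (LINT x|torus_measure. g x * expi k x)"
proof -
  have "(LINT x|torus_measure. f x * nderiv 1 (expi k) x) = (-1) ^ 1 * (LINT x|torus_measure. g x * expi k x)"
    using assms expi_smooth(2) expi_periodic unfolding weak_deriv_def periodic_def by blast
  then show ?thesis
    unfolding expi_smooth(1) by (simp add: mult.left_commute[of "f _"] mult.assoc)
qed

text \<open>Fubini over the triangle s \<le> x. It stands in for integration by parts, as g is
  merely integrable and its primitive need not be differentiable everywhere.\<close>

lemma LINT_primitive:
  fixes g \<phi> \<phi>' :: "real \<Rightarrow> complex"
  assumes g: "integrable torus_measure g"
    and \<phi>: "\<And>x. (\<phi> has_vector_derivative \<phi>' x) (at x)" "continuous_on UNIV \<phi>'"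
  shows "(LINT x|torus_measure. integral {-pi..x} g * \<phi>' x) = (LINT s|torus_measure. g s * (\<phi> pi - \<phi> s))"
proof -
  interpret finite_measure torus_measure by (rule finite_measure_torus)
  interpret P: pair_sigma_finite torus_measure torus_measure ..
  let ?F = "\<lambda>s x. if s \<le> x then g s * \<phi>' x else 0"
  have \<phi>c: "continuous_on A \<phi>'" for A using \<phi>(2) by (rule continuous_on_subset) simp
  have "bounded (\<phi>' ` {-pi..pi})"
    by (intro compact_imp_bounded compact_continuous_image \<phi>c) auto
  then obtain B where B: "\<And>x. x \<in> {-pi..pi} \<Longrightarrow> norm (\<phi>' x) \<le> B" unfolding bounded_iff by (metis image_eqI)
  have [measurable]: "g \<in> borel_measurable torus_measure" using g by auto
  have [measurable]: "\<phi>' \<in> borel_measurable torus_measure"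
    by (rule continuous_imp_measurable_on_sets_lebesgue[OF \<phi>c]) simp
  have [measurable]: "(\<lambda>x. x) \<in> borel_measurable torus_measure"
    by (rule continuous_imp_measurable_on_sets_lebesgue) (auto intro: continuous_intros)
  have int: "integrable (torus_measure \<Otimes>\<^sub>M torus_measure) (\<lambda>(s, x). ?F s x)"
  proof (rule Bochner_Integration.integrable_bound)
    show "integrable (torus_measure \<Otimes>\<^sub>M torus_measure) (\<lambda>(s, x). norm (g s) * B)"
    proof (rule P.Fubini_integrable)
      show "(\<lambda>(s, x). norm (g s) * B) \<in> borel_measurable (torus_measure \<Otimes>\<^sub>M torus_measure)"
        by measurable
      show "integrable torus_measure (\<lambda>s. LINT x|torus_measure. norm ((\<lambda>(s, x). norm (g s) * B) (s, x)))"
        using g by simp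
      show "AE s in torus_measure. integrable torus_measure (\<lambda>x. (\<lambda>(s, x). norm (g s) * B) (s, x))"
        by simp
    qed
    show "(\<lambda>(s, x). ?F s x) \<in> borel_measurable (torus_measure \<Otimes>\<^sub>M torus_measure)"
      by measurable
    show "AE X in (torus_measure \<Otimes>\<^sub>M torus_measure). norm ((\<lambda>(s, x). ?F s x) X) \<le> norm ((\<lambda>(s, x). norm (g s) * B) X)"
    proof (rule AE_I2)
      fix X assume X: "X \<in> space (torus_measure \<Otimes>\<^sub>M torus_measure)"
      obtain s x where sx: "X = (s, x)" by (cases X)
      with X have "x \<in> {-pi..pi}" by (auto simp: space_pair_measure space_restrict_space)
      then have "norm (\<phi>' x) \<le> \<bar>B\<bar>" using B[of x] by linarith
      then show "norm ((\<lambda>(s, x). ?F s x) X) \<le> norm ((\<lambda>(s, x). norm (g s) * B) X)"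
        by (auto simp: sx norm_mult abs_mult intro: mult_left_mono)
    qed
  qed
  have g_on: "g integrable_on {-pi..pi}"
    using g by (auto intro: integrable_on_lebesgue_on)
  have 1: "(LINT s|torus_measure. (?F s x)) = integral {-pi..x} g * \<phi>' x" if x: "x \<in> {-pi..pi}" for x
  proof -
    have "integrable torus_measure (\<lambda>s. if s \<le> x then g s else 0)"
      by (rule Bochner_Integration.integrable_bound[OF integrable_norm[OF g]]) auto
    then have "(LINT s|torus_measure. (if s \<le> x then g s else 0)) = integral {-pi..pi} (\<lambda>s. if s \<in> {..x} then g s else 0)"
      by (subst lebesgue_integral_eq_integral) auto
    also have "\<dots> = integral ({..x} \<inter> {-pi..pi}) g" by (rule integral_restrict_Int)
    also have "{..x} \<inter> {-pi..pi} = {-pi..x}" using x by auto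
    finally have e: "(LINT s|torus_measure. (if s \<le> x then g s else 0)) = integral {-pi..x} g" .
    have "(LINT s|torus_measure. (?F s x)) = (LINT s|torus_measure. (if s \<le> x then g s else 0) * \<phi>' x)"
      by (rule Bochner_Integration.integral_cong) auto
    then show ?thesis by (simp add: e)
  qed
  have 2: "(LINT x|torus_measure. (?F s x)) = g s * (\<phi> pi - \<phi> s)" if s: "s \<in> {-pi..pi}" for s
  proof -
    have "integrable torus_measure (\<lambda>x. if s \<le> x then \<phi>' x else 0)"
      by (rule Bochner_Integration.integrable_bound[OF integrable_norm[OF integrable_torus_continuous(1)[OF \<phi>c]]]) auto
    then have "(LINT x|torus_measure. (if s \<le> x then \<phi>' x else 0)) = integral {-pi..pi} (\<lambda>x. if x \<in> {s..} then \<phi>' x else 0)"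
      by (subst lebesgue_integral_eq_integral) auto
    also have "\<dots> = integral ({s..} \<inter> {-pi..pi}) \<phi>'" by (rule integral_restrict_Int)
    also have "{s..} \<inter> {-pi..pi} = {s..pi}" using s by auto
    also have "integral {s..pi} \<phi>' = \<phi> pi - \<phi> s"
      using s by (intro integral_unique fundamental_theorem_of_calculus)
        (auto intro: has_vector_derivative_at_within[OF \<phi>(1)])
    finally have e: "(LINT x|torus_measure. (if s \<le> x then \<phi>' x else 0)) = \<phi> pi - \<phi> s" .
    have "(LINT x|torus_measure. (?F s x)) = (LINT x|torus_measure. g s * (if s \<le> x then \<phi>' x else 0))"
      by (rule Bochner_Integration.integral_cong) auto
    then show ?thesis by (simp add: e)
  qed
  have "(LINT x|torus_measure. integral {-pi..x} g * \<phi>' x) = (LINT x|torus_measure. LINT s|torus_measure. (?F s x))"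
    by (rule Bochner_Integration.integral_cong) (auto simp: 1 space_restrict_space)
  also have "\<dots> = (LINT s|torus_measure. LINT x|torus_measure. (?F s x))"
    by (rule P.Fubini_integral[OF int])
  also have "\<dots> = (LINT s|torus_measure. g s * (\<phi> pi - \<phi> s))"
    by (rule Bochner_Integration.integral_cong) (auto simp: 2 space_restrict_space)
  finally show ?thesis .
qed

lemma primitive_continuous:
  assumes "integrable torus_measure (g :: real \<Rightarrow> complex)"
  shows "continuous_on {-pi..pi} (\<lambda>x. integral {-pi..x} g)"
  by (intro indefinite_integral_continuous_1 integrable_on_lebesgue_on assms) auto

lemma LINT_eq_0_if_weak_deriv:
  assumes "weak_deriv 1 f g"
  shows "(LINT x|torus_measure. g x) = 0"
  using weak_derivD[OF assms, of 0] by (simp add: expi_0)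

text \<open>Both sides have the same Fourier coefficients: for k \<noteq> 0 by
  \<open>LINT_primitive\<close>, where the boundary term drops out because g has mean zero, and for
  k = 0 by the choice of C.\<close>

lemma weak_deriv_primitive:
  assumes w: "weak_deriv 1 f g" and f: "integrable torus_measure f" and g: "integrable torus_measure g"
  shows "\<exists>C. AE x in torus_measure. f x = C + integral {-pi..x} g"
proof -
  define G where "G x = integral {-pi..x} g" for x
  have G: "integrable torus_measure G"
    unfolding G_def by (intro integrable_torus_continuous primitive_continuous g)
  define C where "C = (LINT x|torus_measure. f x - G x) / (2 * pi)"
  have "AE x in torus_measure. f x - G x - C = 0"
  proof (rule Fourier_uniqueness)
    interpret finite_measure torus_measure by (rule finite_measure_torus)
    have fG: "integrable torus_measure (\<lambda>x. f x - G x)" using f G by simp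
    show "integrable torus_measure (\<lambda>x. f x - G x - C)" using fG by simp
    fix k :: int
    have ints: "integrable torus_measure (\<lambda>x. u x * expi k x)" if "integrable torus_measure u" for u
      by (intro integrable_mult_continuous that expi_continuous)
    have e: "(LINT x|torus_measure. (f x - G x - C) * cis (of_int k * x)) =
        (LINT x|torus_measure. f x * expi k x) - (LINT x|torus_measure. G x * expi k x) - C * (LINT x|torus_measure. expi k x)"
      using ints[OF f] ints[OF G] integrable_torus_continuous(1)[OF expi_continuous[of _ k]]
      by (simp add: expi_def[symmetric] left_diff_distrib)
    show "(LINT x|torus_measure. (f x - G x - C) * cis (of_int k * x)) = 0"
    proof (cases "k = 0")
      case True
      then show ?thesis using f G unfolding e LINT_expi by (simp add: expi_0 C_def)
    next
      case False
      have per: "expi k pi = expi k (- pi)" using expi_periodic[of k "-pi"] by simp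
      have "(LINT x|torus_measure. G x * (\<i> * of_int k * expi k x)) = (LINT s|torus_measure. g s * (expi k pi - expi k s))"
        unfolding G_def by (rule LINT_primitive[OF g expi_deriv]) (intro continuous_intros expi_continuous)
      also have "\<dots> = (LINT s|torus_measure. g s) * expi k pi - (LINT s|torus_measure. g s * expi k s)"
        using g ints[OF g] by (simp add: right_diff_distrib)
      also have "\<dots> = - (LINT s|torus_measure. g s * expi k s)"
        using LINT_eq_0_if_weak_deriv[OF w] by simp
      also have "\<dots> = \<i> * of_int k * (LINT x|torus_measure. f x * expi k x)"
        using weak_derivD[OF w] by simp
      finally have "\<i> * of_int k * (LINT x|torus_measure. G x * expi k x) = \<i> * of_int k * (LINT x|torus_measure. f x * expi k x)"
        by (simp add: mult.left_commute[of "G _"] mult.assoc)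
      then show ?thesis using False unfolding e LINT_expi by simp
    qed
  qed
  then show ?thesis unfolding G_def by (intro exI[of _ C]) (auto elim!: eventually_mono simp: algebra_simps)
qed

text \<open>The definition tests with smooth functions, but z_x, which is only C^1, will have to
  serve as a test function. Writing f as a constant plus a primitive of g gives the extension
  without mollification.\<close>

lemma weak_deriv_C1_test:
  assumes w: "weak_deriv 1 f g" and f: "integrable torus_measure f" and g: "integrable torus_measure g"
    and \<psi>: "\<And>x. (\<psi> has_vector_derivative \<psi>' x) (at x)" "continuous_on UNIV \<psi>'" "periodic \<psi>"
  shows "(LINT x|torus_measure. f x * \<psi>' x) = - (LINT x|torus_measure. g x * \<psi> x)"
proof -
  obtain C where C: "AE x in torus_measure. f x = C + integral {-pi..x} g"
    using weak_deriv_primitive[OF w f g] by blast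
  have \<psi>c: "continuous_on A \<psi>" for A
    by (rule continuous_at_imp_continuous_on) (simp add: has_vector_derivative_continuous[OF \<psi>(1)])
  have \<psi>'c: "continuous_on A \<psi>'" for A using \<psi>(2) by (rule continuous_on_subset) simp
  have per: "\<psi> pi = \<psi> (- pi)" using \<psi>(3)[unfolded periodic_def, rule_format, of "- pi"] by simp
  have Gc: "continuous_on {-pi..pi} (\<lambda>x. integral {-pi..x} g)" by (rule primitive_continuous[OF g])
  have "(LINT x|torus_measure. f x * \<psi>' x) = (LINT x|torus_measure. (C + integral {-pi..x} g) * \<psi>' x)"
    by (rule LINT_cong_ae_eq[OF C])
      (use f in \<open>auto intro!: continuous_imp_measurable_on_sets_lebesgue continuous_intros Gc \<psi>'c\<close>)
  also have "\<dots> = C * (LINT x|torus_measure. \<psi>' x) + (LINT x|torus_measure. integral {-pi..x} g * \<psi>' x)"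
    using integrable_torus_continuous(1)[OF \<psi>'c] integrable_torus_continuous(1)[OF continuous_on_mult[OF Gc \<psi>'c]]
    by (simp add: distrib_right)
  also have "(LINT x|torus_measure. \<psi>' x) = 0"
  proof -
    have "(\<psi>' has_integral \<psi> pi - \<psi> (- pi)) {-pi..pi}"
      by (rule fundamental_theorem_of_calculus) (auto intro: has_vector_derivative_at_within[OF \<psi>(1)])
    then show ?thesis using per by (simp add: integrable_torus_continuous(2)[OF \<psi>'c] integral_unique)
  qed
  also have "(LINT x|torus_measure. integral {-pi..x} g * \<psi>' x) = (LINT s|torus_measure. g s * (\<psi> pi - \<psi> s))"
    by (rule LINT_primitive[OF g \<psi>(1,2)])
  also have "\<dots> = (LINT s|torus_measure. g s) * \<psi> pi - (LINT s|torus_measure. g s * \<psi> s)"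
    using g integrable_mult_continuous[OF g \<psi>c] by (simp add: right_diff_distrib)
  also have "\<dots> = - (LINT s|torus_measure. g s * \<psi> s)"
    using LINT_eq_0_if_weak_deriv[OF w] by simp
  finally show ?thesis by simp
qed

lemma weak_deriv_unique:
  assumes "weak_deriv 1 f g" "weak_deriv 1 f g'" "g \<in> L2" "g' \<in> L2"
  shows "AE x in torus_measure. g x = g' x"
proof -
  have i: "integrable torus_measure g" "integrable torus_measure g'" using assms L2_integrable by auto
  have "AE x in torus_measure. g x - g' x = 0"
  proof (rule Fourier_uniqueness)
    show "integrable torus_measure (\<lambda>x. g x - g' x)" using i by simp
    fix k :: int
    have "(LINT x|torus_measure. (g x - g' x) * expi k x) =
        (LINT x|torus_measure. g x * expi k x) - (LINT x|torus_measure. g' x * expi k x)"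
      using integrable_mult_continuous[OF i(1) expi_continuous[of _ k]] integrable_mult_continuous[OF i(2) expi_continuous[of _ k]]
      by (simp add: left_diff_distrib)
    also have "\<dots> = 0" using weak_derivD[OF assms(1), of k] weak_derivD[OF assms(2), of k] by simp
    finally show "(LINT x|torus_measure. (g x - g' x) * cis (of_int k * x)) = 0" by (simp add: expi_def)
  qed
  then show ?thesis by simp
qed

lemma weak_deriv_classical:
  assumes f: "\<And>x. (f has_vector_derivative f' x) (at x)" "continuous_on UNIV f'" "periodic f"
  shows "weak_deriv 1 f f'"
  unfolding weak_deriv_def
proof (intro allI impI)
  fix \<phi> assume \<phi>: "smooth \<phi> \<and> periodic \<phi>"
  have d: "(\<phi> has_vector_derivative nderiv 1 \<phi> x) (at x within A)" for x A
    using smooth_nderiv[of \<phi> 0 x A] \<phi> by (simp add: nderiv_def)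
  have d2: "(nderiv 1 \<phi> has_vector_derivative nderiv 2 \<phi> x) (at x within A)" for x A
    using smooth_nderiv[of \<phi> 1 x A] \<phi> by (simp add: numeral_2_eq_2)
  have fc: "continuous_on A f" for A
    by (rule continuous_at_imp_continuous_on) (simp add: has_vector_derivative_continuous[OF f(1)])
  have f'c: "continuous_on A f'" for A using f(2) by (rule continuous_on_subset) simp
  have \<phi>c: "continuous_on A \<phi>" "continuous_on A (nderiv 1 \<phi>)" for A
    unfolding continuous_on_eq_continuous_within
    using has_vector_derivative_continuous[OF d] has_vector_derivative_continuous[OF d2] by blast+
  have per: "f pi = f (- pi)" "\<phi> pi = \<phi> (- pi)"
    using f(3)[unfolded periodic_def, rule_format, of "- pi"] \<phi>[unfolded periodic_def, THEN conjunct2, rule_format, of "- pi"] by simp_all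
  have "((\<lambda>x. f x * nderiv 1 \<phi> x + f' x * \<phi> x) has_integral f pi * \<phi> pi - f (- pi) * \<phi> (- pi)) {-pi..pi}"
    by (rule fundamental_theorem_of_calculus, simp,
        intro has_vector_derivative_mult has_vector_derivative_at_within[OF f(1)] d)
  then have "integral {-pi..pi} (\<lambda>x. f x * nderiv 1 \<phi> x + f' x * \<phi> x) = 0"
    using per by (simp add: integral_unique)
  moreover have "integral {-pi..pi} (\<lambda>x. f x * nderiv 1 \<phi> x + f' x * \<phi> x)
     = integral {-pi..pi} (\<lambda>x. f x * nderiv 1 \<phi> x) + integral {-pi..pi} (\<lambda>x. f' x * \<phi> x)"
    by (intro integral_add integrable_continuous_real continuous_intros fc f'c \<phi>c)
  moreover have "(LINT x|torus_measure. f x * nderiv 1 \<phi> x) = integral {-pi..pi} (\<lambda>x. f x * nderiv 1 \<phi> x)"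
    "(LINT x|torus_measure. f' x * \<phi> x) = integral {-pi..pi} (\<lambda>x. f' x * \<phi> x)"
    by (intro integrable_torus_continuous(2) continuous_intros fc f'c \<phi>c)+
  ultimately show "(LINT x|torus_measure. f x * nderiv 1 \<phi> x) = (- 1) ^ 1 * (LINT x|torus_measure. f' x * \<phi> x)"
    by (simp add: eq_neg_iff_add_eq_0 del: One_nat_def)
qed

lemma classical_in_Hp1:
  assumes f: "\<And>x. (f has_vector_derivative f' x) (at x)" "continuous_on UNIV f'" "periodic f" "periodic f'"
    and mean: "integral {-pi..pi} f = 0"
  shows "f \<in> Hp 1"
proof -
  have fc: "continuous_on A f" for A
    by (rule continuous_at_imp_continuous_on) (simp add: has_vector_derivative_continuous[OF f(1)])
  have f'c: "continuous_on A f'" for A using f(2) by (rule continuous_on_subset) simp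
  have L2: "f \<in> L2" "f' \<in> L2" by (intro continuous_in_L2 fc f'c f)+
  have "weak_deriv 0 f f" by (simp add: weak_deriv_def nderiv_def)
  moreover have "weak_deriv 1 f f'" by (rule weak_deriv_classical[OF f(1-3)])
  moreover have "f \<in> L2p"
    using L2 mean by (simp add: L2p_def integrable_torus_continuous(2)[OF fc])
  ultimately show ?thesis
    using L2 unfolding Hp_def by (auto simp: le_Suc_eq)
qed

lemma Hp1_D:
  assumes "f \<in> Hp 1"
  shows "D 1 f \<in> L2" "weak_deriv 1 f (D 1 f)"
proof -
  have "\<exists>g. g \<in> L2 \<and> weak_deriv 1 f g" using assms by (auto simp: Hp_def)
  from someI_ex[OF this] show "D 1 f \<in> L2" "weak_deriv 1 f (D 1 f)" by (auto simp: D_def)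
qed

text \<open>\<open>D\<close> chooses some weak derivative, so even for a classical function it is
  identified only almost everywhere.\<close>

lemma D_classical:
  assumes f: "\<And>x. (f has_vector_derivative f' x) (at x)" "continuous_on UNIV f'" "periodic f" "periodic f'"
    and mean: "integral {-pi..pi} f = 0"
  shows "AE x in torus_measure. D 1 f x = f' x"
proof -
  have f'c: "continuous_on A f'" for A using f(2) by (rule continuous_on_subset) simp
  show ?thesis
    by (rule weak_deriv_unique[OF Hp1_D(2)[OF classical_in_Hp1[OF assms]] weak_deriv_classical[OF f(1-3)]
        Hp1_D(1)[OF classical_in_Hp1[OF assms]] continuous_in_L2[OF f'c f(4)]])
qed

section \<open>Continuously differentiable representatives of the data\<close>

lemma periodic_extension:
  fixes u :: "real \<Rightarrow> complex"
  assumes u: "continuous_on {-pi..pi} u" "u (- pi) = u pi"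
  obtains E where "continuous_on UNIV E" "\<And>x. E (x + 2 * pi) = E x" "\<And>x. x \<in> {-pi..pi} \<Longrightarrow> E x = u x"
proof -
  define E where "E x = u (x - 2 * pi * of_int \<lfloor>(x + pi) / (2 * pi)\<rfloor>)" for x
  have per: "E (x + 2 * pi) = E x" for x
  proof -
    define k where "k = \<lfloor>(x + pi) / (2 * pi)\<rfloor>"
    have "(x + 2 * pi + pi) / (2 * pi) = (x + pi) / (2 * pi) + 1" by (simp add: field_simps)
    then have k: "\<lfloor>(x + 2 * pi + pi) / (2 * pi)\<rfloor> = k + 1" unfolding k_def by simp
    have "x + 2 * pi - 2 * pi * of_int (k + 1) = x - 2 * pi * of_int k" by (simp add: distrib_left)
    then show ?thesis unfolding E_def k k_def[symmetric] by (simp only:)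
  qed
  have Eu: "E x = u x" if "x \<in> {-pi..pi}" for x
  proof (cases "x = pi")
    case True
    \<comment> \<open>At x = pi the floor jumps to 1 and the value is taken from -pi; here the
      equality of the end values enters.\<close>
    have "(pi + pi) / (2 * pi) = 1" by simp
    then show ?thesis using True u(2) by (simp add: E_def)
  next
    case False
    then have "\<lfloor>(x + pi) / (2 * pi)\<rfloor> = 0" using that by (simp add: floor_eq_iff)
    then show ?thesis by (simp add: E_def)
  qed
  have c1: "continuous_on {-pi..pi} E" by (rule continuous_on_eq[OF u(1)]) (simp add: Eu)
  have "continuous_on {pi..3*pi} (\<lambda>x. E (x - 2 * pi))"
    by (rule continuous_on_compose2[OF c1]) (auto intro!: continuous_intros)
  moreover have "E (x - 2 * pi) = E x" for x using per[of "x - 2 * pi"] by simp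
  ultimately have c2: "continuous_on {pi..3*pi} E" by simp
  have "continuous_on ({-pi..pi} \<union> {pi..3*pi}) E"
    by (rule continuous_on_closed_Un[OF _ _ c1 c2]) auto
  then have "continuous_on {-pi<..<3*pi} E" by (rule continuous_on_subset) auto
  then have c: "isCont E x" if "- pi < x" "x < 3 * pi" for x
    using that by (auto simp: continuous_on_eq_continuous_at)
  have "isCont E x" for x
  proof -
    define w where "w = x / (2 * pi)"
    define n where "n = - \<lfloor>w\<rfloor>"
    have e: "x + 2 * pi * of_int n = 2 * pi * (w - of_int \<lfloor>w\<rfloor>)"
      by (simp add: w_def n_def right_diff_distrib)
    have "0 \<le> w - of_int \<lfloor>w\<rfloor>" "w - of_int \<lfloor>w\<rfloor> \<le> 1" by linarith+
    then have "0 \<le> 2 * pi * (w - of_int \<lfloor>w\<rfloor>)" "2 * pi * (w - of_int \<lfloor>w\<rfloor>) \<le> 2 * pi * 1"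
      by (intro mult_nonneg_nonneg mult_left_mono; simp)+
    then have "isCont E (x + 2 * pi * of_int n)" unfolding e using pi_gt_zero by (intro c) linarith+
    moreover have "isCont (\<lambda>x. x + 2 * pi * of_int n) x" by (intro continuous_intros)
    ultimately have "isCont (\<lambda>x. E (x + 2 * pi * of_int n)) x"
      using isCont_o2[of x "\<lambda>x. x + 2 * pi * of_int n" E] by blast
    moreover have "(\<lambda>x. E (x + 2 * pi * of_int n)) = E"
      using shift_2pi_int[of E, OF per] by auto
    ultimately show ?thesis by simp
  qed
  then have "continuous_on UNIV E" by (simp add: continuous_at_imp_continuous_on)
  from that[OF this per Eu] show thesis .
qed

lemma periodic_bounded:
  fixes f :: "real \<Rightarrow> complex"
  assumes "continuous_on UNIV f" "periodic f"
  obtains K where "\<And>x. norm (f x) \<le> K"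
proof -
  have "bounded (f ` {-pi..pi})"
    by (intro compact_imp_bounded compact_continuous_image continuous_on_subset[OF assms(1)]) auto
  then obtain K where K: "\<And>x. x \<in> {-pi..pi} \<Longrightarrow> norm (f x) \<le> K" unfolding bounded_iff by (metis image_eqI)
  have "norm (f x) \<le> K" for x
  proof -
    define w where "w = (x + pi) / (2 * pi)"
    have "x + 2 * pi * of_int (- \<lfloor>w\<rfloor>) = 2 * pi * (w - of_int \<lfloor>w\<rfloor>) - pi"
      by (simp add: w_def right_diff_distrib)
    moreover have "0 \<le> w - of_int \<lfloor>w\<rfloor>" "w - of_int \<lfloor>w\<rfloor> \<le> 1" by linarith+
    then have "0 \<le> 2 * pi * (w - of_int \<lfloor>w\<rfloor>)" "2 * pi * (w - of_int \<lfloor>w\<rfloor>) \<le> 2 * pi * 1"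
      by (intro mult_nonneg_nonneg mult_left_mono; simp)+
    ultimately have "x + 2 * pi * of_int (- \<lfloor>w\<rfloor>) \<in> {-pi..pi}" by simp
    from K[OF this] show ?thesis
      using shift_2pi_int[of f x "- \<lfloor>w\<rfloor>"] assms(2) by (simp add: periodic_def)
  qed
  then show thesis by (rule that)
qed

text \<open>A one-dimensional Sobolev embedding. The first weak derivative has itself a weak
  derivative in L^2 and so agrees almost everywhere with a continuous function E; the representative
  is a primitive of E with its mean removed.\<close>

lemma Hp2_representative:
  assumes "y \<in> Hp 2"
  obtains Y Y' where "\<And>x. (Y has_vector_derivative Y' x) (at x)" "continuous_on UNIV Y'"
    "periodic Y" "periodic Y'" "ae_eq y Y" "integral {-pi..pi} Y = 0"
proof -
  have y: "y \<in> L2p" and ex: "\<exists>g\<in>L2. weak_deriv 1 y g" "\<exists>g\<in>L2. weak_deriv 2 y g"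
    using assms unfolding Hp_def by auto
  obtain g1 g2 where g: "g1 \<in> L2" "weak_deriv 1 y g1" "g2 \<in> L2" "weak_deriv 2 y g2"
    using ex by blast
  have yL: "y \<in> L2" "(LINT x|torus_measure. y x) = 0" using y by (auto simp: L2p_def)
  \<comment> \<open>Testing y with the derivative of \<phi> shows that the second weak derivative is
    a weak derivative of the first.\<close>
  have w12: "weak_deriv 1 g1 g2"
    unfolding weak_deriv_def
  proof (intro allI impI)
    fix \<phi> assume \<phi>: "smooth \<phi> \<and> periodic \<phi>"
    have d: "(\<phi> has_vector_derivative nderiv 1 \<phi> x) (at x)" for x
      using smooth_nderiv[of \<phi> 0 x UNIV] \<phi> by (simp add: nderiv_def)
    have "smooth (nderiv 1 \<phi>)" and n1: "nderiv 1 (nderiv 1 \<phi>) = nderiv 2 \<phi>"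
    proof -
      have n: "nderiv n (nderiv 1 \<phi>) = nderiv (n + 1) \<phi>" for n
        unfolding nderiv_def funpow_add by simp
      then show "smooth (nderiv 1 \<phi>)" using \<phi> by (simp only: smooth_def n simp_thms)
      show "nderiv 1 (nderiv 1 \<phi>) = nderiv 2 \<phi>" using n[of 1] by (simp only: one_add_one)
    qed
    moreover have "periodic (nderiv 1 \<phi>)"
      unfolding periodic_def
    proof
      fix x
      have "((\<lambda>x. x + 2 * pi) has_vector_derivative 1) (at x)" by (auto intro!: derivative_eq_intros)
      from vector_diff_chain_at[OF this d]
      have "(\<phi> has_vector_derivative nderiv 1 \<phi> (x + 2 * pi)) (at x)"
        using \<phi> by (simp add: o_def periodic_def)
      then show "nderiv 1 \<phi> (x + 2 * pi) = nderiv 1 \<phi> x" using d vector_derivative_unique_at by blast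
    qed
    ultimately have "(LINT x|torus_measure. y x * nderiv 1 (nderiv 1 \<phi>) x) = (- 1) ^ 1 * (LINT x|torus_measure. g1 x * nderiv 1 \<phi> x)"
      using g(2) unfolding weak_deriv_def by blast
    moreover have "(LINT x|torus_measure. y x * nderiv 2 \<phi> x) = (- 1) ^ 2 * (LINT x|torus_measure. g2 x * \<phi> x)"
      using g(4) \<phi> unfolding weak_deriv_def by blast
    ultimately show "(LINT x|torus_measure. g1 x * nderiv 1 \<phi> x) = (- 1) ^ 1 * (LINT x|torus_measure. g2 x * \<phi> x)"
      unfolding n1 by (simp add: minus_equation_iff)
  qed
  note ig = L2_integrable[OF g(1)] L2_integrable[OF g(3)]
  obtain a1 where a1: "AE x in torus_measure. g1 x = a1 + integral {-pi..x} g2"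
    using weak_deriv_primitive[OF w12 ig] by blast
  have "integral {-pi..pi} g2 = 0"
    using LINT_eq_0_if_weak_deriv[OF w12] lebesgue_integral_eq_integral[OF ig(2)] by simp
  \<comment> \<open>The zero mean of \<open>g2\<close> makes the end values agree, so that a
    continuous periodic extension exists.\<close>
  then have e0: "a1 + integral {-pi..- pi} g2 = a1 + integral {-pi..pi} g2" by simp
  obtain E where E: "continuous_on UNIV E" "\<And>x. E (x + 2 * pi) = E x"
      "\<And>x. x \<in> {-pi..pi} \<Longrightarrow> E x = a1 + integral {-pi..x} g2"
  proof (rule periodic_extension[of "\<lambda>x. a1 + integral {-pi..x} g2"])
    show "continuous_on {-pi..pi} (\<lambda>x. a1 + integral {-pi..x} g2)"
      by (intro continuous_on_add continuous_on_const primitive_continuous ig)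
  qed (rule e0, rule that)
  have g1E: "AE x in torus_measure. g1 x = E x"
    using a1 AE_space by eventually_elim (simp add: E(3) space_restrict_space)
  have Ec: "continuous_on A E" for A using E(1) by (rule continuous_on_subset) simp
  have E0: "integral {-pi..pi} E = 0"
  proof -
    have "(LINT x|torus_measure. g1 x * 1) = (LINT x|torus_measure. E x * 1)"
      by (rule LINT_cong_ae_eq[OF g1E]) (use L2_D(2)[OF g(1)] in \<open>auto intro!: continuous_imp_measurable_on_sets_lebesgue Ec\<close>)
    then show ?thesis
      using LINT_eq_0_if_weak_deriv[OF g(2)] by (simp add: integrable_torus_continuous(2)[OF Ec])
  qed
  define I where "I s = s *\<^sub>R integral {0..1} (\<lambda>\<tau>. E (s * \<tau>))" for s
  have I: "(I has_vector_derivative E s) (at s within A)" for s A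
    unfolding I_def by (rule has_vector_derivative_at_within[OF has_vector_derivative_integral_scaled[OF E(1)]])
  have Ic: "continuous_on A I" for A
    by (auto simp: continuous_on_eq_continuous_within intro: has_vector_derivative_continuous I)
  have Iper: "I (x + 2 * pi) = I x" for x
  proof -
    have "((\<lambda>x. I (x + 2 * pi) - I x) has_vector_derivative 0) (at x within UNIV)" for x
    proof -
      have "((\<lambda>x. x + 2 * pi) has_vector_derivative 1) (at x)" by (auto intro!: derivative_eq_intros)
      from has_vector_derivative_diff[OF vector_diff_chain_at[OF this I] I[of x UNIV]]
      show ?thesis by (simp add: o_def E(2))
    qed
    then obtain k where k: "\<And>x. I (x + 2 * pi) - I x = k"
      using has_vector_derivative_zero_constant[OF convex_UNIV, of "\<lambda>x. I (x + 2 * pi) - I x"] by auto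
    have "(E has_integral I pi - I (- pi)) {-pi..pi}"
      by (rule fundamental_theorem_of_calculus) (auto intro: I)
    then have "I pi - I (- pi) = 0" using E0 by (simp add: integral_unique)
    then have "k = 0" using k[of "- pi"] by simp
    then show ?thesis using k[of x] by simp
  qed
  have wI: "weak_deriv 1 I E"
    by (rule weak_deriv_classical) (auto intro: I E(1) simp: periodic_def Iper)
  note iy = L2_integrable[OF yL(1)]
  have iI: "integrable torus_measure I" by (rule integrable_torus_continuous(1)[OF Ic])
  define C0 where "C0 = integral {-pi..pi} I / (2 * pi)"
  define Y where "Y x = I x - C0" for x
  have "AE x in torus_measure. y x - Y x = 0"
  proof (rule Fourier_uniqueness)
    interpret finite_measure torus_measure by (rule finite_measure_torus)
    show "integrable torus_measure (\<lambda>x. y x - Y x)" using iy iI by (simp add: Y_def)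
    fix k :: int
    have e: "(LINT x|torus_measure. (y x - Y x) * cis (of_int k * x)) =
        (LINT x|torus_measure. y x * expi k x) - (LINT x|torus_measure. I x * expi k x) + C0 * (LINT x|torus_measure. expi k x)"
      using integrable_mult_continuous[OF iy expi_continuous[of _ k]] integrable_mult_continuous[OF iI expi_continuous[of _ k]]
        integrable_torus_continuous(1)[OF expi_continuous[of _ k]]
      by (simp add: Y_def expi_def[symmetric] left_diff_distrib right_diff_distrib distrib_right diff_diff_eq2)
    show "(LINT x|torus_measure. (y x - Y x) * cis (of_int k * x)) = 0"
    proof (cases "k = 0")
      case True
      then show ?thesis unfolding e LINT_expi
        by (simp add: expi_0 yL(2) C0_def integrable_torus_continuous(2)[OF Ic])
    next
      case False
      have "(LINT x|torus_measure. g1 x * expi k x) = (LINT x|torus_measure. E x * expi k x)"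
        by (rule LINT_cong_ae_eq[OF g1E]) (use L2_D(2)[OF g(1)] in \<open>auto intro!: continuous_imp_measurable_on_sets_lebesgue Ec expi_continuous\<close>)
      then have "\<i> * of_int k * (LINT x|torus_measure. y x * expi k x) = \<i> * of_int k * (LINT x|torus_measure. I x * expi k x)"
        using weak_derivD[OF g(2), of k] weak_derivD[OF wI, of k] by simp
      then show ?thesis using False unfolding e LINT_expi by simp
    qed
  qed
  then have yY: "AE x in torus_measure. y x = Y x" by simp
  show thesis
  proof (rule that[of Y E])
    show "(Y has_vector_derivative E x) (at x)" for x
      unfolding Y_def[abs_def] by (auto intro!: derivative_eq_intros I)
    show pY: "periodic Y" "periodic E" by (simp_all add: periodic_def Y_def Iper E(2))
    show "ae_eq y Y" by (rule ae_eq_torusI[OF yY L2_D(1)[OF yL(1)] pY(1)])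
    show "integral {-pi..pi} Y = 0"
      unfolding Y_def[abs_def]
      by (subst integral_diff) (auto intro!: integrable_continuous_real Ic simp: C0_def scaleR_conv_of_real)
  qed (rule E(1))
qed

subsection \<open>Classical solutions are weak solutions\<close>

text \<open>Compactness of the fundamental domain makes the continuity of the time derivative
  uniform in x, and the mean value inequality turns this into a first-order expansion uniform in x,
  strong enough for differentiability in L^2.\<close>

lemma C1_uniform_linearization:
  assumes C: "C1 F Ft Fx" and e: "e > 0"
  shows "\<forall>\<^sub>F s in at t within S. \<forall>x\<in>{-pi..pi}. norm (F (s, x) - F (t, x) - (s - t) *\<^sub>R Ft (t, x)) \<le> \<bar>s - t\<bar> * e"
proof -
  have "continuous_on (UNIV \<times> {-pi..pi}) Ft"
    using C1_continuous_partials(1)[OF C] by (rule continuous_on_subset) simp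
  then obtain X0 where X0: "t \<in> X0" "open X0"
    "\<forall>s\<in>X0 \<inter> UNIV. \<forall>x\<in>{-pi..pi}. dist (Ft (s, x)) (Ft (t, x)) \<le> e"
    by (rule continuous_on_prod_compactE[OF _ compact_Icc UNIV_I e]) (rule that)
  then obtain d where d: "d > 0" "ball t d \<subseteq> X0" by (meson open_contains_ball)
  have main: "norm (F (s, x) - F (t, x) - (s - t) *\<^sub>R Ft (t, x)) \<le> \<bar>s - t\<bar> * e"
    if s: "s \<in> ball t d" and x: "x \<in> {-pi..pi}" for s x
  proof -
    have "norm (F (s, x) - F (t, x) - (s - t) *\<^sub>R Ft (t, x)) \<le> norm (s - t) * e"
    proof (rule vector_differentiable_bound_linearization[where S = "ball t d" and f = "\<lambda>s. F (s, x)" and f' = "\<lambda>s. Ft (s, x)"])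
      show "closed_segment t s \<subseteq> ball t d"
        using s d(1) by (intro closed_segment_subset) auto
      show "norm (Ft (\<sigma>, x) - Ft (t, x)) \<le> e" if "\<sigma> \<in> ball t d" for \<sigma>
        using X0(3) d(2) that x by (auto simp: dist_norm)
    qed (use d in \<open>auto intro: C1_partial_fst[OF C]\<close>)
    then show ?thesis by simp
  qed
  have "\<forall>\<^sub>F s in at t within S. s \<in> ball t d"
    using d(1) by (intro eventually_at_in_open'[THEN filter_leD[OF at_le[OF subset_UNIV]]]) auto
  then show ?thesis by eventually_elim (use main in auto)
qed

lemma continuous_uniform_slice:
  fixes F :: "real \<times> real \<Rightarrow> complex"
  assumes "continuous_on UNIV F" and e: "e > 0"
  shows "\<forall>\<^sub>F s in at t within S. \<forall>x\<in>{-pi..pi}. norm (F (s, x) - F (t, x)) \<le> e"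
proof -
  have "continuous_on (UNIV \<times> {-pi..pi}) F"
    using assms(1) by (rule continuous_on_subset) simp
  then obtain X0 where X0: "t \<in> X0" "open X0"
    "\<forall>s\<in>X0 \<inter> UNIV. \<forall>x\<in>{-pi..pi}. dist (F (s, x)) (F (t, x)) \<le> e"
    by (rule continuous_on_prod_compactE[OF _ compact_Icc UNIV_I e]) (rule that)
  have "\<forall>\<^sub>F s in at t within S. s \<in> X0"
    using X0 by (intro eventually_at_in_open'[THEN filter_leD[OF at_le[OF subset_UNIV]]]) auto
  then show ?thesis by eventually_elim (use X0(3) in \<open>auto simp: dist_norm\<close>)
qed

text \<open>The factor 1/(2 pi) gives the constant 1 norm one, so a pointwise bound passes over
  without a constant.\<close>

lemma L2_norm_le:
  assumes "AE x in torus_measure. norm (f x) \<le> e" "e \<ge> 0"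
  shows "L2_norm f \<le> e"
proof -
  have "(LINT x|torus_measure. (cmod (f x))\<^sup>2) \<le> (LINT x|torus_measure. e\<^sup>2)"
  proof (rule integral_mono_AE')
    show "integrable torus_measure (\<lambda>x. e\<^sup>2)" by (intro integrable_torus_continuous continuous_intros)
    show "AE x in torus_measure. (cmod (f x))\<^sup>2 \<le> e\<^sup>2"
      using assms(1) by eventually_elim (simp add: power_mono)
  qed simp
  also have "\<dots> = 2 * pi * e\<^sup>2"
    by (simp only: integrable_torus_continuous(2)[OF continuous_on_const]) simp
  finally have "1 / (2 * pi) * (LINT x|torus_measure. (cmod (f x))\<^sup>2) \<le> e\<^sup>2"
    by (simp add: divide_le_eq mult.commute)
  then have "L2_norm f \<le> sqrt (e\<^sup>2)" unfolding L2_norm_def by (rule real_sqrt_le_mono)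
  then show ?thesis using assms(2) by simp
qed

lemma L2_norm_nonneg: "L2_norm f \<ge> 0"
  unfolding L2_norm_def by (intro real_sqrt_ge_zero mult_nonneg_nonneg integral_nonneg_AE) auto

lemma L2_norm_tendsto_0:
  assumes "\<And>e. e > 0 \<Longrightarrow> \<forall>\<^sub>F s in F. AE x in torus_measure. norm (g s x) \<le> e"
  shows "((\<lambda>s. L2_norm (g s)) \<longlongrightarrow> 0) F"
proof (rule tendstoI)
  fix e :: real assume "e > 0"
  then have "\<forall>\<^sub>F s in F. AE x in torus_measure. norm (g s x) \<le> e / 2" by (intro assms) simp
  then show "\<forall>\<^sub>F s in F. dist (L2_norm (g s)) 0 < e"
  proof eventually_elim
    case (elim s)
    have "L2_norm (g s) \<le> e / 2" using \<open>e > 0\<close> by (intro L2_norm_le elim) simp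
    then show ?case using L2_norm_nonneg[of "g s"] \<open>e > 0\<close> by simp
  qed
qed

lemma AE_torusI: "(\<And>x. x \<in> {-pi..pi} \<Longrightarrow> P x) \<Longrightarrow> AE x in torus_measure. P x"
  by (rule AE_I2) (simp add: space_restrict_space)

section \<open>Pairings of time slices with a fixed function of x\<close>

definition slice_pair :: "(real \<times> real \<Rightarrow> complex) \<Rightarrow> (real \<Rightarrow> complex) \<Rightarrow> real \<Rightarrow> complex" where
  "slice_pair F u t = pair (\<lambda>x. F (t, x)) u"

lemma integrable_slice_mult:
  fixes F :: "real \<times> real \<Rightarrow> complex"
  assumes "continuous_on UNIV F" "integrable torus_measure u"
  shows "integrable torus_measure (\<lambda>x. F (t, x) * u x)"
  using integrable_mult_continuous[OF assms(2) continuous_on_slice(2)[OF assms(1)], of t]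
  by (simp add: mult.commute)

lemma slice_pair_linear:
  assumes "continuous_on UNIV F" "continuous_on UNIV G" "integrable torus_measure u"
  shows "slice_pair (\<lambda>X. F X + G X) u t = slice_pair F u t + slice_pair G u t"
    "slice_pair (\<lambda>X. F X - G X) u t = slice_pair F u t - slice_pair G u t"
    "slice_pair (\<lambda>X. a * F X) u t = a * slice_pair F u t"
  using integrable_slice_mult[OF assms(1,3), of t] integrable_slice_mult[OF assms(2,3), of t]
  by (simp_all add: slice_pair_def pair_def distrib_right left_diff_distrib right_diff_distrib distrib_left mult.assoc add_divide_distrib diff_divide_distrib)

lemma slice_pair_bound:
  assumes u: "integrable torus_measure u" and G: "continuous_on {-pi..pi} G"
    and b: "\<And>x. x \<in> {-pi..pi} \<Longrightarrow> norm (G x) \<le> b"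
  shows "norm (pair G u) \<le> b * (LINT x|torus_measure. norm (u x))"
proof -
  have b0: "0 \<le> b" using order_trans[OF norm_ge_zero b[of 0]] by simp
  have N0: "0 \<le> (LINT x|torus_measure. norm (u x))" by (rule integral_nonneg_AE) auto
  have i: "integrable torus_measure (\<lambda>x. G x * u x)"
    using integrable_mult_continuous[OF u G] by (simp add: mult.commute)
  have "norm (LINT x|torus_measure. G x * u x) \<le> (LINT x|torus_measure. norm (G x * u x))"
    by (rule integral_norm_bound)
  also have "\<dots> \<le> (LINT x|torus_measure. b * norm (u x))"
  proof (rule integral_mono_AE)
    show "integrable torus_measure (\<lambda>x. norm (G x * u x))" by (rule integrable_norm[OF i])
    show "integrable torus_measure (\<lambda>x. b * norm (u x))" using u by simp
    show "AE x in torus_measure. norm (G x * u x) \<le> b * norm (u x)"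
      by (rule AE_torusI) (simp only: norm_mult b mult_right_mono norm_ge_zero)
  qed
  also have "\<dots> = b * (LINT x|torus_measure. norm (u x))" by simp
  finally have m: "norm (LINT x|torus_measure. G x * u x) \<le> b * (LINT x|torus_measure. norm (u x))" .
  have "norm (pair G u) = 1 / (2 * pi) * norm (LINT x|torus_measure. G x * u x)"
    by (simp add: pair_def norm_mult norm_divide)
  also have "\<dots> \<le> 1 * norm (LINT x|torus_measure. G x * u x)"
    using pi_gt3 by (intro mult_right_mono) auto
  finally show ?thesis using m by simp
qed

text \<open>For integrable u the pairing is controlled by the sup norm of the slice, in which the
  uniform linearization is an estimate. The factor u is only integrable so that \<phi> and
  \<open>D 1 \<phi>\<close> can both take its place.\<close>

lemma slice_pair_has_vector_derivative:
  assumes C: "C1 F Ft Fx" and u: "integrable torus_measure u"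
  shows "(slice_pair F u has_vector_derivative slice_pair Ft u t) (at t within S)"
  unfolding has_vector_derivative_def has_derivative_within_alt2
proof (intro conjI allI impI bounded_linear_scaleR_left)
  fix e :: real assume e: "e > 0"
  define N where "N = (LINT x|torus_measure. norm (u x))"
  have N0: "0 \<le> N" unfolding N_def by (rule integral_nonneg_AE) auto
  have Fc: "continuous_on UNIV F" "continuous_on UNIV Ft" using C1_continuous[OF C] C1_continuous_partials[OF C] by auto
  have "e / (N + 1) > 0" using e N0 by (intro divide_pos_pos add_nonneg_pos) auto
  from C1_uniform_linearization[OF C this, of t S]
  show "\<forall>\<^sub>F s in at t within S. norm (slice_pair F u s - slice_pair F u t - (s - t) *\<^sub>R slice_pair Ft u t) \<le> e * norm (s - t)"
  proof eventually_elim
    case (elim s)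
    let ?G = "\<lambda>x. F (s, x) - F (t, x) - (s - t) *\<^sub>R Ft (t, x)"
    have "(LINT x|torus_measure. ?G x * u x) = (LINT x|torus_measure. F (s, x) * u x)
        - (LINT x|torus_measure. F (t, x) * u x) - complex_of_real (s - t) * (LINT x|torus_measure. Ft (t, x) * u x)"
      using integrable_slice_mult[OF Fc(1) u, of s] integrable_slice_mult[OF Fc(1) u, of t] integrable_slice_mult[OF Fc(2) u, of t]
      by (simp add: left_diff_distrib[of _ _ "u _"] scaleR_conv_of_real mult.assoc del: of_real_diff)
    note E = this
    have "slice_pair F u s - slice_pair F u t - (s - t) *\<^sub>R slice_pair Ft u t = pair ?G u"
      unfolding slice_pair_def pair_def E by (simp only: scaleR_conv_of_real right_diff_distrib mult.left_commute)
    also have "norm \<dots> \<le> (\<bar>s - t\<bar> * (e / (N + 1))) * N"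
      unfolding N_def
      by (rule slice_pair_bound[OF u]) (use elim in \<open>auto simp: N_def intro!: continuous_intros continuous_on_slice Fc\<close>)
    also have "\<dots> = (\<bar>s - t\<bar> * e) * (N / (N + 1))" by simp
    also have "\<dots> \<le> (\<bar>s - t\<bar> * e) * 1"
      using N0 e by (intro mult_left_mono) auto
    finally show ?case by (simp add: mult.commute)
  qed
qed

lemma continuous_on_slice_pair:
  assumes F: "continuous_on UNIV F" and u: "integrable torus_measure u"
  shows "continuous_on A (slice_pair F u)"
  unfolding continuous_on_def
proof (intro ballI tendstoI)
  fix t and e :: real assume e: "e > 0"
  define N where "N = (LINT x|torus_measure. norm (u x))"
  have N0: "0 \<le> N" unfolding N_def by (rule integral_nonneg_AE) auto
  have d: "e / (N + 1) > 0" using e N0 by (intro divide_pos_pos add_nonneg_pos) auto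
  from continuous_uniform_slice[OF F d, of t A]
  show "\<forall>\<^sub>F s in at t within A. dist (slice_pair F u s) (slice_pair F u t) < e"
  proof eventually_elim
    case (elim s)
    have "slice_pair F u s - slice_pair F u t = pair (\<lambda>x. F (s, x) - F (t, x)) u"
      using integrable_slice_mult[OF F u, of s] integrable_slice_mult[OF F u, of t]
      by (simp add: slice_pair_def pair_def left_diff_distrib right_diff_distrib)
    also have "norm \<dots> \<le> e / (N + 1) * N"
      unfolding N_def
      by (rule slice_pair_bound[OF u]) (use elim in \<open>auto simp: N_def intro!: continuous_intros continuous_on_slice F\<close>)
    also have "\<dots> < e / (N + 1) * (N + 1)" using d by (intro mult_strict_left_mono) auto
    also have "\<dots> = e" using N0 by simp
    finally show ?case by (simp add: dist_norm)
  qed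
qed

section \<open>Integration by parts against test functions of time\<close>

text \<open>The complement of K is open, so all derivatives vanish on it, and it contains both 0 and
  T.\<close>

lemma test_fun_boundary:
  assumes "test_fun T \<theta>"
  shows "nderiv n \<theta> 0 = 0" "nderiv n \<theta> T = 0"
proof -
  obtain K where K: "compact K" "K \<subseteq> {0<..<T}" "\<And>t. t \<notin> K \<Longrightarrow> \<theta> t = 0" and s: "smooth \<theta>"
    using assms by (auto simp: test_fun_def)
  have o: "open (- K)" using K(1) by (simp add: compact_imp_closed open_Compl)
  have "nderiv n \<theta> t = 0" if "t \<in> - K" for t
    using that
  proof (induction n arbitrary: t)
    case 0
    then show ?case using K(3) by (simp add: nderiv_def)
  next
    case (Suc n)
    have "((\<lambda>_. 0) has_vector_derivative nderiv (Suc n) \<theta> t) (at t)"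
      using smooth_nderiv[OF s, of n t UNIV]
      by (rule has_vector_derivative_transform_within_open[OF _ o Suc.prems]) (simp add: Suc.IH)
    then show ?case using vector_derivative_unique_at[OF has_vector_derivative_const] by metis
  qed
  moreover have "0 \<in> - K" "T \<in> - K" using K(2) by auto
  ultimately show "nderiv n \<theta> 0 = 0" "nderiv n \<theta> T = 0" by blast+
qed

lemma smooth_nderiv_continuous: "smooth \<theta> \<Longrightarrow> continuous_on A (nderiv n \<theta>)"
  unfolding continuous_on_eq_continuous_within
  using has_vector_derivative_continuous[OF smooth_nderiv] by blast

lemma test_fun_by_parts:
  assumes \<theta>: "test_fun T \<theta>" and T: "T \<ge> 0"
    and Y: "\<And>t. t \<in> {0..T} \<Longrightarrow> (Y has_vector_derivative V t) (at t within {0..T})" "continuous_on {0..T} V"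
  shows "integral {0..T} (\<lambda>t. nderiv (Suc n) \<theta> t * Y t) = - integral {0..T} (\<lambda>t. nderiv n \<theta> t * V t)"
proof -
  have s: "smooth \<theta>" using \<theta> by (simp add: test_fun_def)
  have Yc: "continuous_on {0..T} Y"
    unfolding continuous_on_eq_continuous_within using has_vector_derivative_continuous[OF Y(1)] by blast
  have "((\<lambda>t. nderiv n \<theta> t * V t + nderiv (Suc n) \<theta> t * Y t) has_integral
      nderiv n \<theta> T * Y T - nderiv n \<theta> 0 * Y 0) {0..T}"
    by (rule fundamental_theorem_of_calculus[OF T])
      (intro has_vector_derivative_mult smooth_nderiv[OF s] Y(1))
  then have "integral {0..T} (\<lambda>t. nderiv n \<theta> t * V t + nderiv (Suc n) \<theta> t * Y t) = 0"
    by (simp add: integral_unique test_fun_boundary[OF \<theta>])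
  moreover have "integral {0..T} (\<lambda>t. nderiv n \<theta> t * V t + nderiv (Suc n) \<theta> t * Y t)
      = integral {0..T} (\<lambda>t. nderiv n \<theta> t * V t) + integral {0..T} (\<lambda>t. nderiv (Suc n) \<theta> t * Y t)"
    by (intro integral_add integrable_continuous_real continuous_intros smooth_nderiv_continuous[OF s] Yc Y(2))
  ultimately show ?thesis by (simp add: add_eq_0_iff)
qed

lemma LINT_eq_integral_continuous:
  fixes f :: "real \<Rightarrow> complex"
  assumes "continuous_on {a..b} f"
  shows "(LINT t|lebesgue_on {a..b}. f t) = integral {a..b} f"
  by (rule lebesgue_integral_eq_integral[OF continuous_imp_integrable_real[OF assms]]) simp

lemma strong_sol_weak_solution:
  assumes S: "strong_sol M z y p v q r h k l f" and T: "T \<ge> 0"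
    and xp: "\<forall>F\<in>{z, y, p, v, q, r, h, k, l, f}. x_periodic F"
    and z0: "\<And>x. z (0, x) = 0" and mean: "\<And>t. integral {-pi..pi} (\<lambda>x. z (t, x)) = 0"
    and zT: "\<And>x. z (T, x) = 0"
    and y0: "ae_eq (\<lambda>x. y (0, x)) y0" and y1: "ae_eq (\<lambda>x. v (0, x)) y1"
  shows "weak_solution M T (\<lambda>t x. f (t, x)) y0 y1 (\<lambda>t x. y (t, x)) (\<lambda>t x. v (t, x))"
    and "eq_Hm1 (int_Hm1 0 T (\<lambda>s. Dxx (\<lambda>x. y (s, x)))) (\<lambda>\<phi>. 0)"
    and "integral {-pi..pi} (\<lambda>x. f (t, x)) = 0"
proof -
  let ?M = "complex_of_real M"
  have C: "C1 z y p" "C1 y v q" "C1 p q r" "C1 h k l"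
    using S unfolding strong_sol_def by blast+
  have eh: "h = (\<lambda>X. v X - r X + ?M * y X + ?M\<^sup>2 * z X)"
    and ef: "f = (\<lambda>X. k X - ?M * h X + ?M ^ 3 * z X)"
    using S unfolding strong_sol_def fun_eq_iff by blast+
  have cont: "continuous_on UNIV z" "continuous_on UNIV y" "continuous_on UNIV p" "continuous_on UNIV v"
    "continuous_on UNIV q" "continuous_on UNIV r" "continuous_on UNIV h" "continuous_on UNIV k"
    using C1_continuous[OF C(1)] C1_continuous[OF C(2)] C1_continuous[OF C(3)] C1_continuous[OF C(4)]
      C1_continuous_partials[OF C(2)] C1_continuous_partials[OF C(3)] C1_continuous_partials[OF C(4)] by auto
  have fcont: "continuous_on UNIV f" unfolding ef by (intro continuous_intros cont)
  have per: "periodic (\<lambda>x. F (t, x))" if "F \<in> {z, y, p, v, q, r, h, k, l, f}" for F t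
    using xp that by (auto simp: periodic_def x_periodic_def)
  \<comment> \<open>The zero mean of z passes to its time derivatives and, through the defining
    relations, to h and to f.\<close>
  have mean_t: "integral {-pi..pi} (\<lambda>x. Ft (t, x)) = 0"
    if "C1 F Ft Fx" "\<And>t. integral {-pi..pi} (\<lambda>x. F (t, x)) = 0" for F Ft Fx t
    using C1_integral_has_vector_derivative[OF that(1), of "-pi" pi t] unfolding that(2)
    using vector_derivative_unique_at[OF has_vector_derivative_const] by metis
  have my: "integral {-pi..pi} (\<lambda>x. y (t, x)) = 0" for t by (rule mean_t[OF C(1) mean])
  have mv: "integral {-pi..pi} (\<lambda>x. v (t, x)) = 0" for t by (rule mean_t[OF C(2) my])
  have mr: "integral {-pi..pi} (\<lambda>x. r (t, x)) = 0" for t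
    by (rule integral_x_derivative_eq_0[OF C(3)]) (use xp in auto)
  note cs = continuous_on_slice(2)[where S = "{-pi..pi}"]
  have mh: "integral {-pi..pi} (\<lambda>x. h (t, x)) = 0" for t
  proof -
    note i = integrable_continuous_real[OF cs[OF cont(1), of t]] integrable_continuous_real[OF cs[OF cont(2), of t]]
      integrable_continuous_real[OF cs[OF cont(4), of t]] integrable_continuous_real[OF cs[OF cont(6), of t]]
    have "((\<lambda>x. v (t, x) - r (t, x) + ?M * y (t, x) + ?M\<^sup>2 * z (t, x)) has_integral 0 - 0 + ?M * 0 + ?M\<^sup>2 * 0) {-pi..pi}"
      by (intro has_integral_add has_integral_diff has_integral_mult_right)
        (use i mean[of t] my[of t] mv[of t] mr[of t] in \<open>auto simp: has_integral_iff\<close>)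
    then show ?thesis unfolding eh by (simp add: integral_unique)
  qed
  have mk: "integral {-pi..pi} (\<lambda>x. k (t, x)) = 0" for t by (rule mean_t[OF C(4) mh])
  show "integral {-pi..pi} (\<lambda>x. f (t, x)) = 0"
  proof -
    note i = integrable_continuous_real[OF cs[OF cont(1), of t]] integrable_continuous_real[OF cs[OF cont(7), of t]]
      integrable_continuous_real[OF cs[OF cont(8), of t]]
    have "((\<lambda>x. k (t, x) - ?M * h (t, x) + ?M ^ 3 * z (t, x)) has_integral 0 - ?M * 0 + ?M ^ 3 * 0) {-pi..pi}"
      by (intro has_integral_add has_integral_diff has_integral_mult_right)
        (use i mean[of t] mh[of t] mk[of t] in \<open>auto simp: has_integral_iff\<close>)
    then show ?thesis unfolding ef by (simp add: integral_unique)
  qed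
  have yHp: "(\<lambda>x. y (t, x)) \<in> Hp 1" for t
    by (rule classical_in_Hp1[OF C1_partial_snd[OF C(2)] continuous_on_slice(2)[OF cont(5)] per per my]) auto
  have Dy: "AE x in torus_measure. D 1 (\<lambda>x. y (t, x)) x = q (t, x)" for t
    by (rule D_classical[OF C1_partial_snd[OF C(2)] continuous_on_slice(2)[OF cont(5)] per per my]) auto
  have Ddiff: "AE x in torus_measure. D 1 (\<lambda>x. y (s, x) - y (t, x)) x = q (s, x) - q (t, x)" for s t
  proof (rule D_classical)
    show "((\<lambda>x. y (s, x) - y (t, x)) has_vector_derivative q (s, x) - q (t, x)) (at x)" for x
      by (intro has_vector_derivative_diff C1_partial_snd[OF C(2)])
    show "continuous_on UNIV (\<lambda>x. q (s, x) - q (t, x))"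
      by (intro continuous_intros continuous_on_slice cont)
    show "periodic (\<lambda>x. y (s, x) - y (t, x))" "periodic (\<lambda>x. q (s, x) - q (t, x))"
      using per[of y s] per[of y t] per[of q s] per[of q t] by (auto simp: periodic_def)
    show "integral {-pi..pi} (\<lambda>x. y (s, x) - y (t, x)) = 0"
      using my by (subst integral_diff) (auto intro!: integrable_continuous_real cs cont)
  qed
  have C0H: "C0_H1p T (\<lambda>t x. y (t, x))"
    unfolding C0_H1p_def
  proof (intro ballI conjI yHp)
    fix t
    show "((\<lambda>s. Hp_norm 1 (\<lambda>x. y (s, x) - y (t, x))) \<longlongrightarrow> 0) (at t within {0..T})"
      unfolding Hp_norm_def
    proof (rule L2_norm_tendsto_0)
      fix e :: real assume "e > 0"
      from continuous_uniform_slice[OF cont(5) this, of t "{0..T}"]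
      show "\<forall>\<^sub>F s in at t within {0..T}. AE x in torus_measure. norm (D 1 (\<lambda>x. y (s, x) - y (t, x)) x) \<le> e"
      proof eventually_elim
        case (elim s)
        have "AE x in torus_measure. norm (q (s, x) - q (t, x)) \<le> e" by (rule AE_torusI) (use elim in auto)
        with Ddiff[of s t] show ?case by eventually_elim simp
      qed
    qed
  qed
  have C0L: "C0_L2p T (\<lambda>t x. F (t, x))"
    if F: "F \<in> {z, y, p, v, q, r, h, k, l, f}" "continuous_on UNIV F" "\<And>t. integral {-pi..pi} (\<lambda>x. F (t, x)) = 0" for F
    unfolding C0_L2p_def
  proof (intro ballI conjI)
    fix t
    show "(\<lambda>x. F (t, x)) \<in> L2p"
      using F continuous_in_L2[OF cs[OF F(2)] per[OF F(1)]] by (simp add: L2p_def integrable_torus_continuous(2)[OF cs[OF F(2)]])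
    show "((\<lambda>s. L2_norm (\<lambda>x. F (s, x) - F (t, x))) \<longlongrightarrow> 0) (at t within {0..T})"
    proof (rule L2_norm_tendsto_0)
      fix e :: real assume "e > 0"
      from continuous_uniform_slice[OF F(2) this, of t "{0..T}"]
      show "\<forall>\<^sub>F s in at t within {0..T}. AE x in torus_measure. norm (F (s, x) - F (t, x)) \<le> e"
        by eventually_elim (rule AE_torusI, auto)
    qed
  qed
  have C1L: "C1_L2p T (\<lambda>t x. y (t, x)) (\<lambda>t x. v (t, x))"
    unfolding C1_L2p_def
  proof (intro conjI ballI)
    show "C0_L2p T (\<lambda>t x. y (t, x))" "C0_L2p T (\<lambda>t x. v (t, x))"
      by (rule C0L; use my mv cont in auto)+
    fix t
    show "((\<lambda>s. L2_norm (\<lambda>x. (y (s, x) - y (t, x)) / of_real (s - t) - v (t, x))) \<longlongrightarrow> 0) (at t within {0..T})"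
    proof (rule L2_norm_tendsto_0)
      fix e :: real assume e: "e > 0"
      have "\<forall>\<^sub>F s in at t within {0..T}. s \<noteq> t" by (simp add: eventually_at_filter)
      with C1_uniform_linearization[OF C(2) e, of t "{0..T}"]
      show "\<forall>\<^sub>F s in at t within {0..T}. AE x in torus_measure. norm ((y (s, x) - y (t, x)) / of_real (s - t) - v (t, x)) \<le> e"
      proof eventually_elim
        case (elim s)
        show ?case
        proof (rule AE_torusI)
          fix x assume x: "x \<in> {-pi..pi}"
          have "norm ((y (s, x) - y (t, x)) / of_real (s - t) - v (t, x)) = norm (y (s, x) - y (t, x) - (s - t) *\<^sub>R v (t, x)) / \<bar>s - t\<bar>"
          proof -
            have "(y (s, x) - y (t, x)) / of_real (s - t) - v (t, x) = (y (s, x) - y (t, x) - (s - t) *\<^sub>R v (t, x)) / of_real (s - t)"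
              using elim(2) by (simp add: diff_divide_distrib scaleR_conv_of_real del: of_real_diff)
            then show ?thesis by (simp only: norm_divide norm_of_real)
          qed
          also have "\<dots> \<le> e" using elim x by (simp add: divide_le_eq mult.commute)
          finally show "norm ((y (s, x) - y (t, x)) / of_real (s - t) - v (t, x)) \<le> e" .
        qed
      qed
    qed
  qed
  have p0: "p (0, x) = 0" for x
    using C1_partial_snd[OF C(1), of 0 x UNIV] unfolding z0
    using vector_derivative_unique_at[OF has_vector_derivative_const] by metis
  have pT: "p (T, x) = 0" for x
    using C1_partial_snd[OF C(1), of T x UNIV] unfolding zT
    using vector_derivative_unique_at[OF has_vector_derivative_const] by metis
  have Dxx_y: "Dxx (\<lambda>x. y (t, x)) \<phi> = - slice_pair q (D 1 \<phi>) t" if \<phi>: "\<phi> \<in> Hp 1" for \<phi> t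
    unfolding Dxx_def slice_pair_def pair_def
    using LINT_cong_ae_eq[OF Dy[of t] L2_D(2)[OF Hp1_D(1)[OF yHp]] _ L2_D(2)[OF Hp1_D(1)[OF \<phi>]]]
      continuous_imp_measurable_on_sets_lebesgue[OF cs[OF cont(5)]] by simp
  have int_Dxx: "int_Hm1 0 t (\<lambda>s. Dxx (\<lambda>x. y (s, x))) \<phi> = - slice_pair p (D 1 \<phi>) t" if \<phi>: "\<phi> \<in> Hp 1" and t: "t \<ge> 0" for \<phi> t
  proof -
    have u: "integrable torus_measure (D 1 \<phi>)" by (rule L2_integrable[OF Hp1_D(1)[OF \<phi>]])
    have "((\<lambda>s. - slice_pair q (D 1 \<phi>) s) has_integral - slice_pair p (D 1 \<phi>) t - - slice_pair p (D 1 \<phi>) 0) {0..t}"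
      by (rule fundamental_theorem_of_calculus[OF t])
        (intro has_vector_derivative_minus slice_pair_has_vector_derivative[OF C(3) u])
    moreover have "slice_pair p (D 1 \<phi>) 0 = 0" by (simp add: slice_pair_def pair_def p0)
    ultimately have "integral {0..t} (\<lambda>s. - slice_pair q (D 1 \<phi>) s) = - slice_pair p (D 1 \<phi>) t"
      by (simp only: integral_unique minus_zero diff_zero)
    then show ?thesis
      unfolding int_Hm1_def Dxx_y[OF \<phi>]
      by (subst LINT_eq_integral_continuous) (intro continuous_intros continuous_on_slice_pair cont u)
  qed
  \<comment> \<open>The integral of y_xx is z_xx(T), represented by the pairing of z_x(T) = 0 with
    the derivative of \<phi>.\<close>
  show "eq_Hm1 (int_Hm1 0 T (\<lambda>s. Dxx (\<lambda>x. y (s, x)))) (\<lambda>\<phi>. 0)"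
    unfolding eq_Hm1_def using int_Dxx[OF _ T] by (simp add: slice_pair_def pair_def pT)
  have eqn: "eq_Hm1
          (\<lambda>\<phi>. distr_Hm1 T (\<lambda>t. pair (\<lambda>x. y (t, x))) (nderiv 2 \<theta>) \<phi>
             - distr_Hm1 T (\<lambda>t. Dxx (\<lambda>x. y (t, x))) \<theta> \<phi>
             + of_real M * distr_Hm1 T (\<lambda>t. int_Hm1 0 t (\<lambda>s. Dxx (\<lambda>x. y (s, x)))) \<theta> \<phi>)
          (distr_Hm1 T (\<lambda>t. pair (\<lambda>x. f (t, x))) \<theta>)" if \<theta>: "test_fun T \<theta>" for \<theta>
    unfolding eq_Hm1_def
  proof
    fix \<phi> assume \<phi>: "\<phi> \<in> Hp 1"
    define \<psi> where "\<psi> = D 1 \<phi>"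
    have \<phi>i: "integrable torus_measure \<phi>" using \<phi> by (intro L2_integrable) (simp add: Hp_def L2p_def)
    have \<psi>i: "integrable torus_measure \<psi>" unfolding \<psi>_def by (rule L2_integrable[OF Hp1_D(1)[OF \<phi>]])
    have s: "smooth \<theta>" using \<theta> by (simp add: test_fun_def)
    have \<theta>c: "continuous_on A \<theta>" "continuous_on A (nderiv n \<theta>)" for A n
      using smooth_nderiv_continuous[OF s, of A 0] smooth_nderiv_continuous[OF s, of A n] by (simp_all add: nderiv_def)
    let ?P = "\<lambda>F. slice_pair F \<phi>" and ?Q = "\<lambda>F. slice_pair F \<psi>"
    \<comment> \<open>Here the derivative moves onto \<phi>: p is C^1 with x-derivative r, so it can
      be used as a test function for the weak derivative of \<phi>.\<close>
    have rp: "?P r t = - ?Q p t" for t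
    proof -
      have "(LINT x|torus_measure. \<phi> x * r (t, x)) = - (LINT x|torus_measure. \<psi> x * p (t, x))"
        unfolding \<psi>_def
        by (rule weak_deriv_C1_test[OF Hp1_D(2)[OF \<phi>] \<phi>i \<psi>i[unfolded \<psi>_def]])
          (use per in \<open>auto intro: C1_partial_snd[OF C(3)] continuous_on_slice cont\<close>)
      then show ?thesis by (simp add: slice_pair_def pair_def mult.commute)
    qed
    \<comment> \<open>The value of the equation z_ttt = f + z_txx - M z_xx paired with \<phi>, with
      one x-derivative of the last two terms moved onto \<phi>.\<close>
    define V2 where "V2 t = ?P f t - ?Q q t + ?M * ?Q p t" for t
    have Vt: "?P v t = ?P h t - ?Q p t - ?M * ?P y t - ?M\<^sup>2 * ?P z t" for t
    proof -
      have "v = (\<lambda>X. ((h X + r X) - ?M * y X) - ?M\<^sup>2 * z X)" by (simp add: eh)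
      then have "?P v t = ?P (\<lambda>X. ((h X + r X) - ?M * y X) - ?M\<^sup>2 * z X) t" by simp
      also have "\<dots> = ((?P h t + ?P r t) - ?M * ?P y t) - ?M\<^sup>2 * ?P z t"
        by (subst slice_pair_linear(2)[OF _ _ \<phi>i], (intro continuous_intros cont)+,
            subst slice_pair_linear(2)[OF _ _ \<phi>i], (intro continuous_intros cont)+)
          (simp add: slice_pair_linear(1)[OF cont(7,6) \<phi>i] slice_pair_linear(3)[OF cont(2,2) \<phi>i] slice_pair_linear(3)[OF cont(1,1) \<phi>i])
      finally show ?thesis by (simp add: rp)
    qed
    have ft: "?P f t = ?P k t - ?M * ?P h t + ?M ^ 3 * ?P z t" for t
      unfolding ef
      by (subst slice_pair_linear(1)[OF _ _ \<phi>i], (intro continuous_intros cont)+,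
          subst slice_pair_linear(2)[OF _ _ \<phi>i], (intro continuous_intros cont)+)
        (simp add: slice_pair_linear(3)[OF cont(7,7) \<phi>i] slice_pair_linear(3)[OF cont(1,1) \<phi>i])
    note dP = slice_pair_has_vector_derivative[OF C(1) \<phi>i] slice_pair_has_vector_derivative[OF C(2) \<phi>i]
      slice_pair_has_vector_derivative[OF C(4) \<phi>i] slice_pair_has_vector_derivative[OF C(3) \<psi>i]
    have dV: "(?P v has_vector_derivative V2 t) (at t within {0..T})" for t
    proof -
      have "((\<lambda>t. ?P h t - ?Q p t - ?M * ?P y t - ?M\<^sup>2 * ?P z t) has_vector_derivative
          ?P k t - ?Q q t - ?M * ?P v t - ?M\<^sup>2 * ?P y t) (at t within {0..T})"
        by (intro has_vector_derivative_diff has_vector_derivative_mult_right dP)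
      moreover have "?P k t - ?Q q t - ?M * ?P v t - ?M\<^sup>2 * ?P y t = V2 t"
        unfolding V2_def ft Vt by (simp add: algebra_simps power2_eq_square power3_eq_cube)
      moreover have "?P v = (\<lambda>t. ?P h t - ?Q p t - ?M * ?P y t - ?M\<^sup>2 * ?P z t)" using Vt by auto
      ultimately show ?thesis by simp
    qed
    note cP = continuous_on_slice_pair[OF _ \<phi>i] and cQ = continuous_on_slice_pair[OF _ \<psi>i]
    have V2c: "continuous_on {0..T} V2"
      unfolding V2_def[abs_def] by (intro continuous_intros cP cQ cont fcont)
    have "integral {0..T} (\<lambda>t. nderiv 2 \<theta> t * ?P y t) = - integral {0..T} (\<lambda>t. nderiv 1 \<theta> t * ?P v t)"
      using test_fun_by_parts[OF \<theta> T dP(2) cP[OF cont(4)], of 1] by (simp only: Suc_1)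
    also have "\<dots> = integral {0..T} (\<lambda>t. \<theta> t * V2 t)"
      using test_fun_by_parts[OF \<theta> T dV V2c, of 0] by (simp add: nderiv_def)
    also have "\<dots> = integral {0..T} (\<lambda>t. \<theta> t * ?P f t) - integral {0..T} (\<lambda>t. \<theta> t * ?Q q t) + ?M * integral {0..T} (\<lambda>t. \<theta> t * ?Q p t)"
    proof -
      have I: "(\<lambda>t. \<theta> t * ?P f t) integrable_on {0..T}" "(\<lambda>t. \<theta> t * ?Q q t) integrable_on {0..T}"
        "(\<lambda>t. \<theta> t * ?Q p t) integrable_on {0..T}"
        by (intro integrable_continuous_real continuous_intros \<theta>c cP cQ cont fcont)+
      have "((\<lambda>t. \<theta> t * ?P f t - \<theta> t * ?Q q t + ?M * (\<theta> t * ?Q p t)) has_integral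
        integral {0..T} (\<lambda>t. \<theta> t * ?P f t) - integral {0..T} (\<lambda>t. \<theta> t * ?Q q t) + ?M * integral {0..T} (\<lambda>t. \<theta> t * ?Q p t)) {0..T}"
        by (intro has_integral_add has_integral_diff has_integral_mult_right integrable_integral I)
      moreover have "(\<lambda>t. \<theta> t * V2 t) = (\<lambda>t. \<theta> t * ?P f t - \<theta> t * ?Q q t + ?M * (\<theta> t * ?Q p t))"
        by (simp add: V2_def algebra_simps)
      ultimately show ?thesis by (simp only: integral_unique)
    qed
    finally have main: "integral {0..T} (\<lambda>t. nderiv 2 \<theta> t * ?P y t) =
      integral {0..T} (\<lambda>t. \<theta> t * ?P f t) - integral {0..T} (\<lambda>t. \<theta> t * ?Q q t) + ?M * integral {0..T} (\<lambda>t. \<theta> t * ?Q p t)" .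
    have d1: "distr_Hm1 T (\<lambda>t. pair (\<lambda>x. y (t, x))) (nderiv 2 \<theta>) \<phi> = integral {0..T} (\<lambda>t. nderiv 2 \<theta> t * ?P y t)"
      unfolding distr_Hm1_def int_Hm1_def slice_pair_def[symmetric]
      by (intro LINT_eq_integral_continuous continuous_intros \<theta>c cP cont)
    have d2: "distr_Hm1 T (\<lambda>t. Dxx (\<lambda>x. y (t, x))) \<theta> \<phi> = - integral {0..T} (\<lambda>t. \<theta> t * ?Q q t)"
    proof -
      have "(LINT t|lebesgue_on {0..T}. \<theta> t * (- ?Q q t)) = integral {0..T} (\<lambda>t. \<theta> t * (- ?Q q t))"
        by (intro LINT_eq_integral_continuous continuous_intros \<theta>c cQ cont)
      then show ?thesis unfolding distr_Hm1_def int_Hm1_def Dxx_y[OF \<phi>] \<psi>_def[symmetric] by simp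
    qed
    have d3: "distr_Hm1 T (\<lambda>t. int_Hm1 0 t (\<lambda>s. Dxx (\<lambda>x. y (s, x)))) \<theta> \<phi> = - integral {0..T} (\<lambda>t. \<theta> t * ?Q p t)"
    proof -
      have "(LINT t|lebesgue_on {0..T}. \<theta> t * int_Hm1 0 t (\<lambda>s. Dxx (\<lambda>x. y (s, x))) \<phi>) = (LINT t|lebesgue_on {0..T}. \<theta> t * (- ?Q p t))"
        by (rule Bochner_Integration.integral_cong) (auto simp: int_Dxx[OF \<phi>] \<psi>_def space_restrict_space)
      also have "\<dots> = integral {0..T} (\<lambda>t. \<theta> t * (- ?Q p t))"
        by (intro LINT_eq_integral_continuous continuous_intros \<theta>c cQ cont)
      finally show ?thesis unfolding distr_Hm1_def int_Hm1_def[of 0 T] by simp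
    qed
    have d4: "distr_Hm1 T (\<lambda>t. pair (\<lambda>x. f (t, x))) \<theta> \<phi> = integral {0..T} (\<lambda>t. \<theta> t * ?P f t)"
      unfolding distr_Hm1_def int_Hm1_def slice_pair_def[symmetric]
      by (intro LINT_eq_integral_continuous continuous_intros \<theta>c cP fcont)
    show "distr_Hm1 T (\<lambda>t. pair (\<lambda>x. y (t, x))) (nderiv 2 \<theta>) \<phi>
             - distr_Hm1 T (\<lambda>t. Dxx (\<lambda>x. y (t, x))) \<theta> \<phi>
             + of_real M * distr_Hm1 T (\<lambda>t. int_Hm1 0 t (\<lambda>s. Dxx (\<lambda>x. y (s, x)))) \<theta> \<phi>
        = distr_Hm1 T (\<lambda>t. pair (\<lambda>x. f (t, x))) \<theta> \<phi>"
      unfolding d1 d2 d3 d4 main by simp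
  qed
  show "weak_solution M T (\<lambda>t x. f (t, x)) y0 y1 (\<lambda>t x. y (t, x)) (\<lambda>t x. v (t, x))"
    unfolding weak_solution_def using C0H C1L eqn y0 y1 by blast
qed

subsection \<open>Uniqueness of weak solutions\<close>

lemma L2_lincomb:
  assumes f: "f \<in> L2" and g: "g \<in> L2"
  shows "(\<lambda>x. a * f x + b * g x) \<in> L2"
  unfolding L2_def
proof (intro CollectI conjI)
  show "periodic (\<lambda>x. a * f x + b * g x)" using L2_D(1)[OF f] L2_D(1)[OF g] by (simp add: periodic_def)
  show m: "(\<lambda>x. a * f x + b * g x) \<in> borel_measurable torus_measure"
    using L2_D(2)[OF f] L2_D(2)[OF g] by measurable
  show "integrable torus_measure (\<lambda>x. (cmod (a * f x + b * g x))\<^sup>2)"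
  proof (rule Bochner_Integration.integrable_bound)
    show "integrable torus_measure (\<lambda>x. 2 * (cmod a)\<^sup>2 * (cmod (f x))\<^sup>2 + 2 * (cmod b)\<^sup>2 * (cmod (g x))\<^sup>2)"
      using L2_D(3)[OF f] L2_D(3)[OF g] by simp
    show "(\<lambda>x. (cmod (a * f x + b * g x))\<^sup>2) \<in> borel_measurable torus_measure" using m by measurable
    show "AE x in torus_measure. norm ((cmod (a * f x + b * g x))\<^sup>2)
        \<le> norm (2 * (cmod a)\<^sup>2 * (cmod (f x))\<^sup>2 + 2 * (cmod b)\<^sup>2 * (cmod (g x))\<^sup>2)"
    proof (rule AE_I2)
      fix x
      have "(cmod (a * f x + b * g x))\<^sup>2 \<le> (cmod (a * f x) + cmod (b * g x))\<^sup>2"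
        by (intro power_mono norm_triangle_ineq) auto
      also have "\<dots> \<le> 2 * (cmod (a * f x))\<^sup>2 + 2 * (cmod (b * g x))\<^sup>2"
        using zero_le_power2[of "cmod (a * f x) - cmod (b * g x)"] by (simp add: power2_sum power2_diff)
      finally show "norm ((cmod (a * f x + b * g x))\<^sup>2) \<le> norm (2 * (cmod a)\<^sup>2 * (cmod (f x))\<^sup>2 + 2 * (cmod b)\<^sup>2 * (cmod (g x))\<^sup>2)"
        by (simp add: norm_mult power_mult_distrib)
    qed
  qed
qed

lemma L2_diff: "f \<in> L2 \<Longrightarrow> g \<in> L2 \<Longrightarrow> (\<lambda>x. f x - g x) \<in> L2"
  using L2_lincomb[of f g 1 "-1"] by simp

text \<open>Cauchy-Schwarz against a function of modulus one, from 2 d |g| \<le> d^2 + |g|^2. The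
  optimal d, the norm of g, is enlarged slightly so that division by d is possible when this norm is
  zero.\<close>

lemma norm_pair_expi_le:
  assumes g: "g \<in> L2"
  shows "norm (pair g (expi k)) \<le> L2_norm g"
proof -
  define n where "n = L2_norm g"
  have n0: "n \<ge> 0" unfolding n_def by (rule L2_norm_nonneg)
  have N2: "(LINT x|torus_measure. (cmod (g x))\<^sup>2) = 2 * pi * n\<^sup>2"
  proof -
    have "0 \<le> (LINT x|torus_measure. (cmod (g x))\<^sup>2)" by (rule integral_nonneg_AE) auto
    then show ?thesis unfolding n_def L2_norm_def by (simp add: real_sqrt_pow2)
  qed
  have gi: "integrable torus_measure g" by (rule L2_integrable[OF g])
  have le: "(LINT x|torus_measure. cmod (g x)) \<le> 2 * pi * n + e" if e: "e > 0" for e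
  proof -
    define d where "d = n + e / (2 * pi)"
    have d: "d > 0" "n \<le> d" using n0 e by (auto simp: d_def intro: add_nonneg_pos)
    have "2 * d * (LINT x|torus_measure. cmod (g x)) = (LINT x|torus_measure. 2 * d * cmod (g x))" by simp
    also have "\<dots> \<le> (LINT x|torus_measure. d\<^sup>2 + (cmod (g x))\<^sup>2)"
    proof (rule integral_mono_AE)
      show "integrable torus_measure (\<lambda>x. 2 * d * cmod (g x))" using gi by simp
      show "integrable torus_measure (\<lambda>x. d\<^sup>2 + (cmod (g x))\<^sup>2)"
        using L2_D(3)[OF g] integrable_torus_continuous(1)[OF continuous_on_const[of _ "d\<^sup>2"]] by simp
      show "AE x in torus_measure. 2 * d * cmod (g x) \<le> d\<^sup>2 + (cmod (g x))\<^sup>2"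
        using zero_le_power2[of "d - cmod (g _)"] by (intro AE_I2) (simp add: power2_diff)
    qed
    also have "\<dots> = (LINT x|torus_measure. d\<^sup>2) + 2 * pi * n\<^sup>2"
      using L2_D(3)[OF g] integrable_torus_continuous(1)[OF continuous_on_const[of _ "d\<^sup>2"]] N2 by simp
    also have "(LINT x|torus_measure. d\<^sup>2) = 2 * pi * d\<^sup>2"
      by (simp only: integrable_torus_continuous(2)[OF continuous_on_const]) simp
    also have "2 * pi * d\<^sup>2 + 2 * pi * n\<^sup>2 \<le> 2 * pi * d\<^sup>2 + 2 * pi * d\<^sup>2"
      using d n0 by (intro add_left_mono mult_left_mono power_mono) auto
    also have "\<dots> = 2 * d * (2 * pi * d)" by (simp add: power2_eq_square)
    finally have "(LINT x|torus_measure. cmod (g x)) \<le> 2 * pi * d"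
      using d(1) by simp
    also have "\<dots> = 2 * pi * n + e" by (simp add: d_def distrib_left)
    finally show ?thesis .
  qed
  have "(LINT x|torus_measure. cmod (g x)) \<le> 2 * pi * n"
    by (rule field_le_epsilon) (rule le)
  moreover have "norm (LINT x|torus_measure. g x * expi k x) \<le> (LINT x|torus_measure. norm (g x * expi k x))"
    by (rule integral_norm_bound)
  moreover have "(LINT x|torus_measure. norm (g x * expi k x)) = (LINT x|torus_measure. cmod (g x))"
    by (rule Bochner_Integration.integral_cong) (simp_all add: norm_mult expi_def)
  ultimately have "norm (LINT x|torus_measure. g x * expi k x) \<le> 2 * pi * n" by simp
  then have "1 / (2 * pi) * norm (LINT x|torus_measure. g x * expi k x) \<le> n"
    by (simp add: divide_le_eq mult.commute)
  then show ?thesis by (simp add: pair_def norm_mult norm_divide n_def)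
qed

lemma pair_expi_linear:
  assumes "f \<in> L2" "g \<in> L2"
  shows "pair (\<lambda>x. a * f x + b * g x) (expi k) = a * pair f (expi k) + b * pair g (expi k)"
  using integrable_mult_continuous[OF L2_integrable[OF assms(1)] expi_continuous[of _ k]]
    integrable_mult_continuous[OF L2_integrable[OF assms(2)] expi_continuous[of _ k]]
  by (simp add: pair_def distrib_right mult.assoc add_divide_distrib)

lemma pair_expi_diff:
  assumes "f \<in> L2" "g \<in> L2"
  shows "pair (\<lambda>x. f x - g x) (expi k) = pair f (expi k) - pair g (expi k)"
  using pair_expi_linear[OF assms, of 1 "-1"] by simp

lemma expi_Hp1:
  assumes "k \<noteq> 0"
  shows "expi k \<in> Hp 1" "AE x in torus_measure. D 1 (expi k) x = \<i> * of_int k * expi k x"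
proof -
  have c: "continuous_on UNIV (\<lambda>x. \<i> * of_int k * expi k x)" by (intro continuous_intros expi_continuous)
  have p: "periodic (expi k)" "periodic (\<lambda>x. \<i> * of_int k * expi k x)"
    by (simp_all add: periodic_def expi_periodic)
  have m: "integral {-pi..pi} (expi k) = 0"
    using LINT_expi[of k] assms by (simp add: integrable_torus_continuous(2) expi_continuous)
  show "expi k \<in> Hp 1" by (rule classical_in_Hp1[OF expi_deriv c p m])
  show "AE x in torus_measure. D 1 (expi k) x = \<i> * of_int k * expi k x" by (rule D_classical[OF expi_deriv c p m])
qed

lemma Dxx_expi:
  assumes y: "y \<in> Hp 1" and k: "k \<noteq> 0"
  shows "Dxx y (expi k) = - ((of_int k)\<^sup>2 * pair y (expi k))"
proof -
  note D1y = Hp1_D[OF y] and D1e = Hp1_D[OF expi_Hp1(1)[OF k]]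
  have m: "(\<lambda>x. \<i> * of_int k * expi k x) \<in> borel_measurable torus_measure"
    by (intro continuous_imp_measurable_on_sets_lebesgue continuous_intros expi_continuous) simp
  have "(LINT x|torus_measure. D 1 (expi k) x * D 1 y x) = (LINT x|torus_measure. \<i> * of_int k * expi k x * D 1 y x)"
    by (rule LINT_cong_ae_eq[OF expi_Hp1(2)[OF k] L2_D(2)[OF D1e(1)] m L2_D(2)[OF D1y(1)]])
  also have "\<dots> = \<i> * of_int k * (LINT x|torus_measure. D 1 y x * expi k x)"
    by (subst integral_mult_right_zero[symmetric]) (simp add: mult_ac)
  also have "\<dots> = \<i> * of_int k * (- (\<i> * of_int k * (LINT x|torus_measure. y x * expi k x)))"
    using weak_derivD[OF D1y(2), of k] by simp
  also have "\<dots> = (of_int k)\<^sup>2 * (LINT x|torus_measure. y x * expi k x)"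
    by (simp add: power2_eq_square algebra_simps)
  finally show ?thesis unfolding Dxx_def pair_def by (simp add: mult.commute)
qed

text \<open>The nonzero modes have mean zero and are admissible as \<phi>, which makes the equation
  scalar. Its right-hand side is kept as a functional of f: it will cancel between two solutions, so
  no regularity of f is called for.\<close>

lemma weak_solution_coefficient:
  assumes ws: "weak_solution M T f y0 y1 y v" and k: "k \<noteq> 0"
  defines "Y \<equiv> \<lambda>t. pair (y t) (expi k)" and "V \<equiv> \<lambda>t. pair (v t) (expi k)"
  shows "\<And>t. t \<in> {0..T} \<Longrightarrow> (Y has_vector_derivative V t) (at t within {0..T})"
    and "continuous_on {0..T} V"
    and "\<And>\<theta>. test_fun T \<theta> \<Longrightarrow>
      integral {0..T} (\<lambda>t. nderiv 2 \<theta> t * Y t) + (of_int k)\<^sup>2 * integral {0..T} (\<lambda>t. \<theta> t * Y t)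
        - of_real M * (of_int k)\<^sup>2 * integral {0..T} (\<lambda>t. \<theta> t * integral {0..t} Y)
      = distr_Hm1 T (\<lambda>t. pair (f t)) \<theta> (expi k)"
proof -
  have C0H: "C0_H1p T y" and C1: "C1_L2p T y v" using ws by (auto simp: weak_solution_def)
  have yL: "y t \<in> L2" and vL: "v t \<in> L2" and yH: "y t \<in> Hp 1" if "t \<in> {0..T}" for t
    using C0H C1 that by (auto simp: C1_L2p_def C0_L2p_def C0_H1p_def L2p_def)
  show dY: "(Y has_vector_derivative V t) (at t within {0..T})" if t: "t \<in> {0..T}" for t
    unfolding has_vector_derivative_def has_derivative_within_alt2
  proof (intro conjI allI impI bounded_linear_scaleR_left)
    fix e :: real assume e: "e > 0"
    have "((\<lambda>s. L2_norm (\<lambda>x. (y s x - y t x) / of_real (s - t) - v t x)) \<longlongrightarrow> 0) (at t within {0..T})"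
      using C1 t by (auto simp: C1_L2p_def)
    then have "\<forall>\<^sub>F s in at t within {0..T}. dist (L2_norm (\<lambda>x. (y s x - y t x) / of_real (s - t) - v t x)) 0 < e"
      using e by (rule tendstoD)
    moreover have "\<forall>\<^sub>F s in at t within {0..T}. s \<noteq> t \<and> s \<in> {0..T}" by (simp add: eventually_at_filter)
    ultimately show "\<forall>\<^sub>F s in at t within {0..T}. norm (Y s - Y t - (s - t) *\<^sub>R V t) \<le> e * norm (s - t)"
    proof eventually_elim
      case (elim s)
      then have s: "s \<noteq> t" "s \<in> {0..T}" by auto
      let ?q = "\<lambda>x. (1 / of_real (s - t)) * (y s x - y t x) + (-1) * v t x"
      have yd: "(\<lambda>x. y s x - y t x) \<in> L2" by (intro L2_diff yL s t)
      have qL: "?q \<in> L2" by (intro L2_lincomb yd vL t)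
      have "?q = (\<lambda>x. (y s x - y t x) / of_real (s - t) - v t x)" by simp
      with elim(1) have "L2_norm ?q < e" by simp
      then have "norm (pair ?q (expi k)) < e" using norm_pair_expi_le[OF qL, of k] by linarith
      moreover have "pair ?q (expi k) = (1 / of_real (s - t)) * (Y s - Y t) - V t"
        unfolding pair_expi_linear[OF yd vL[OF t]] pair_expi_diff[OF yL[OF s(2)] yL[OF t]] by (simp add: Y_def V_def)
      moreover have "Y s - Y t - (s - t) *\<^sub>R V t = of_real (s - t) * ((1 / of_real (s - t)) * (Y s - Y t) - V t)"
        using s(1) by (simp add: right_diff_distrib scaleR_conv_of_real del: of_real_diff)
      ultimately have "norm (Y s - Y t - (s - t) *\<^sub>R V t) \<le> \<bar>s - t\<bar> * e"
        by (simp only: norm_mult norm_of_real) (intro mult_left_mono, auto)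
      then show ?case by (simp add: mult.commute)
    qed
  qed
  show Vc: "continuous_on {0..T} V"
    unfolding continuous_on_def
  proof (intro ballI tendstoI)
    fix t and e :: real assume t: "t \<in> {0..T}" and e: "e > 0"
    have "((\<lambda>s. L2_norm (\<lambda>x. v s x - v t x)) \<longlongrightarrow> 0) (at t within {0..T})"
      using C1 t by (auto simp: C1_L2p_def C0_L2p_def)
    then have "\<forall>\<^sub>F s in at t within {0..T}. dist (L2_norm (\<lambda>x. v s x - v t x)) 0 < e"
      using e by (rule tendstoD)
    moreover have "\<forall>\<^sub>F s in at t within {0..T}. s \<in> {0..T}" by (simp add: eventually_at_filter)
    ultimately show "\<forall>\<^sub>F s in at t within {0..T}. dist (V s) (V t) < e"
    proof eventually_elim
      case (elim s)
      have "norm (pair (\<lambda>x. v s x - v t x) (expi k)) < e"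
        using norm_pair_expi_le[OF L2_diff[OF vL[OF elim(2)] vL[OF t]], of k] elim(1) by simp
      then show ?case
        unfolding pair_expi_diff[OF vL[OF elim(2)] vL[OF t]] by (simp add: V_def dist_norm)
    qed
  qed
  have Yc: "continuous_on {0..T} Y"
    unfolding continuous_on_eq_continuous_within using has_vector_derivative_continuous[OF dY] by blast
  fix \<theta> assume \<theta>: "test_fun T \<theta>"
  have s: "smooth \<theta>" using \<theta> by (simp add: test_fun_def)
  have \<theta>c: "continuous_on A \<theta>" "continuous_on A (nderiv n \<theta>)" for A n
    using smooth_nderiv_continuous[OF s, of A 0] smooth_nderiv_continuous[OF s, of A n] by (simp_all add: nderiv_def)
  let ?k = "(of_int k)\<^sup>2 :: complex" and ?N = "\<lambda>t. integral {0..t} Y"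
  have Nc: "continuous_on {0..T} ?N"
    by (intro indefinite_integral_continuous_1 integrable_continuous_real Yc)
  have int: "int_Hm1 0 t (\<lambda>s. Dxx (y s)) (expi k) = - (?k * ?N t)" if t: "t \<in> {0..T}" for t
  proof -
    have Yct: "continuous_on {0..t} Y" using Yc by (rule continuous_on_subset) (use t in auto)
    have "int_Hm1 0 t (\<lambda>s. Dxx (y s)) (expi k) = (LINT s|lebesgue_on {0..t}. - (?k * Y s))"
      unfolding int_Hm1_def
      by (rule Bochner_Integration.integral_cong) (use t in \<open>auto simp: Dxx_expi[OF yH k] Y_def space_restrict_space\<close>)
    also have "\<dots> = integral {0..t} (\<lambda>s. - (?k * Y s))"
      by (intro LINT_eq_integral_continuous continuous_intros Yct)
    finally show ?thesis by simp
  qed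
  have d1: "distr_Hm1 T (\<lambda>t. pair (y t)) (nderiv 2 \<theta>) (expi k) = integral {0..T} (\<lambda>t. nderiv 2 \<theta> t * Y t)"
  proof -
    have "(LINT t|lebesgue_on {0..T}. nderiv 2 \<theta> t * Y t) = integral {0..T} (\<lambda>t. nderiv 2 \<theta> t * Y t)"
      by (intro LINT_eq_integral_continuous continuous_intros \<theta>c Yc)
    then show ?thesis by (simp only: distr_Hm1_def int_Hm1_def Y_def)
  qed
  have d2: "distr_Hm1 T (\<lambda>t. Dxx (y t)) \<theta> (expi k) = - (?k * integral {0..T} (\<lambda>t. \<theta> t * Y t))"
  proof -
    have "distr_Hm1 T (\<lambda>t. Dxx (y t)) \<theta> (expi k) = (LINT t|lebesgue_on {0..T}. - (?k * (\<theta> t * Y t)))"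
      unfolding distr_Hm1_def int_Hm1_def
      by (rule Bochner_Integration.integral_cong) (auto simp: Dxx_expi[OF yH k] Y_def space_restrict_space)
    also have "\<dots> = integral {0..T} (\<lambda>t. - (?k * (\<theta> t * Y t)))"
      by (intro LINT_eq_integral_continuous continuous_intros \<theta>c Yc)
    finally show ?thesis by simp
  qed
  have d3: "distr_Hm1 T (\<lambda>t. int_Hm1 0 t (\<lambda>s. Dxx (y s))) \<theta> (expi k) = - (?k * integral {0..T} (\<lambda>t. \<theta> t * ?N t))"
  proof -
    have "distr_Hm1 T (\<lambda>t. int_Hm1 0 t (\<lambda>s. Dxx (y s))) \<theta> (expi k) = (LINT t|lebesgue_on {0..T}. - (?k * (\<theta> t * ?N t)))"
      unfolding distr_Hm1_def int_Hm1_def[of 0 T]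
      by (rule Bochner_Integration.integral_cong) (auto simp: int space_restrict_space)
    also have "\<dots> = integral {0..T} (\<lambda>t. - (?k * (\<theta> t * ?N t)))"
      by (intro LINT_eq_integral_continuous continuous_intros \<theta>c Nc)
    finally show ?thesis by simp
  qed
  have "distr_Hm1 T (\<lambda>t. pair (y t)) (nderiv 2 \<theta>) (expi k)
       - distr_Hm1 T (\<lambda>t. Dxx (y t)) \<theta> (expi k)
       + of_real M * distr_Hm1 T (\<lambda>t. int_Hm1 0 t (\<lambda>s. Dxx (y s))) \<theta> (expi k)
      = distr_Hm1 T (\<lambda>t. pair (f t)) \<theta> (expi k)"
    using ws \<theta> expi_Hp1(1)[OF k] unfolding weak_solution_def eq_Hm1_def by blast
  then show "integral {0..T} (\<lambda>t. nderiv 2 \<theta> t * Y t) + ?k * integral {0..T} (\<lambda>t. \<theta> t * Y t)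
        - of_real M * ?k * integral {0..T} (\<lambda>t. \<theta> t * integral {0..t} Y)
      = distr_Hm1 T (\<lambda>t. pair (f t)) \<theta> (expi k)"
    unfolding d1 d2 d3 by (simp add: mult.assoc)
qed

section \<open>The scalar equations of single modes\<close>

text \<open>A difference of two smooth steps is a test function. One step has its slope concentrated
  near an interior point t0, so its derivative reproduces u(t0) up to e; the other is fixed and
  yields the constant C. Orthogonality forces u(t0) = C, and continuity covers the end
  points.\<close>

lemma du_Bois_Reymond:
  fixes u :: "real \<Rightarrow> complex"
  assumes T: "T > 0" and u: "continuous_on {0..T} u"
    and orth: "\<And>\<theta>. test_fun T \<theta> \<Longrightarrow> integral {0..T} (\<lambda>t. nderiv 1 \<theta> t * u t) = 0"
    and t: "t \<in> {0..T}"
  shows "u t = u 0"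
proof -
  obtain s :: "nat \<Rightarrow> real \<Rightarrow> real" where s:
    "\<And>n x. (s n has_real_derivative s (Suc n) x) (at x)"
    "\<And>x. x \<le> T / 3 \<Longrightarrow> s 0 x = 0" "\<And>x. x \<ge> 2 * T / 3 \<Longrightarrow> s 0 x = 1"
    by (rule smooth_step[of "T / 3" "2 * T / 3"]) (use T in simp, rule that)
  define C where "C = integral {0..T} (\<lambda>t. complex_of_real (s 1 t) * u t)"
  have cont: "continuous_on A (\<lambda>t. complex_of_real (\<sigma> n t))" if "\<And>n x. (\<sigma> n has_real_derivative \<sigma> (Suc n) x) (at x)"
    for A n and \<sigma> :: "nat \<Rightarrow> real \<Rightarrow> real"
    by (intro continuous_on_of_real continuous_at_imp_continuous_on) (use DERIV_isCont[OF that] in blast)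
  have uC: "u t0 = C" if t0: "t0 \<in> {0<..<T}" for t0
  proof -
    have "norm (C - u t0) \<le> 0 + e" if e: "e > 0" for e
    proof -
      have "continuous (at t0 within {0..T}) u" using u t0 by (auto simp: continuous_on_eq_continuous_within)
      then obtain d where d: "d > 0" "\<And>\<tau>. \<tau> \<in> {0..T} \<Longrightarrow> dist \<tau> t0 < d \<Longrightarrow> dist (u \<tau>) (u t0) < e"
        using e unfolding continuous_within_eps_delta by metis
      \<comment> \<open>Small enough for the oscillation of u to stay below e and for the step to
        stay inside (0, T).\<close>
      define \<rho> where "\<rho> = min d (min (t0 / 2) ((T - t0) / 2))"
      have \<rho>: "\<rho> > 0" "\<rho> \<le> d" "0 < t0 - \<rho>" "t0 + \<rho> < T"
        using d(1) t0 by (auto simp: \<rho>_def min_def field_simps)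
      obtain \<sigma> :: "nat \<Rightarrow> real \<Rightarrow> real" where \<sigma>:
        "\<And>n x. (\<sigma> n has_real_derivative \<sigma> (Suc n) x) (at x)"
        "\<And>x. x \<le> t0 - \<rho> \<Longrightarrow> \<sigma> 0 x = 0" "\<And>x. x \<ge> t0 + \<rho> \<Longrightarrow> \<sigma> 0 x = 1"
        "\<And>n x. x \<notin> {t0 - \<rho><..<t0 + \<rho>} \<Longrightarrow> \<sigma> (Suc n) x = 0" "\<And>x. \<sigma> (Suc 0) x \<ge> 0"
        by (rule smooth_step[of "t0 - \<rho>" "t0 + \<rho>"]) (use \<rho> in simp, rule that)
      define g where "g n x = complex_of_real (\<sigma> n x - s n x)" for n x
      have g: "(g n has_vector_derivative g (Suc n) x) (at x)" for n x
        unfolding g_def by (intro has_vector_derivative_of_real DERIV_diff \<sigma>(1) s(1))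
      have "test_fun T (g 0)"
        unfolding test_fun_def
      proof (intro conjI exI[of _ "{min (t0 - \<rho>) (T / 3)..max (t0 + \<rho>) (2 * T / 3)}"] allI impI)
        show "smooth (g 0)" by (rule smooth_chain(2)[where g = g, OF g])
        show "{min (t0 - \<rho>) (T / 3)..max (t0 + \<rho>) (2 * T / 3)} \<subseteq> {0<..<T}"
          using \<rho> T by auto
        fix x assume "x \<notin> {min (t0 - \<rho>) (T / 3)..max (t0 + \<rho>) (2 * T / 3)}"
        then consider "x \<le> t0 - \<rho>" "x \<le> T / 3" | "x \<ge> t0 + \<rho>" "x \<ge> 2 * T / 3" by fastforce
        then show "g 0 x = 0" by cases (simp_all add: g_def \<sigma>(2,3) s(2,3))
      qed simp
      from orth[OF this] have "integral {0..T} (\<lambda>t. complex_of_real (\<sigma> 1 t) * u t - complex_of_real (s 1 t) * u t) = 0"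
        unfolding smooth_chain(1)[where g = g, OF g] by (simp add: g_def left_diff_distrib)
      moreover have i: "(\<lambda>t. complex_of_real (\<sigma> 1 t) * u t) integrable_on {0..T}" "(\<lambda>t. complex_of_real (s 1 t) * u t) integrable_on {0..T}"
        "(\<lambda>t. complex_of_real (\<sigma> 1 t) * u t0) integrable_on {0..T}"
        by (intro integrable_continuous_real continuous_intros cont[where \<sigma> = \<sigma>, OF \<sigma>(1)] cont[where \<sigma> = s, OF s(1)] u)+
      ultimately have C\<sigma>: "integral {0..T} (\<lambda>t. complex_of_real (\<sigma> 1 t) * u t) = C"
        by (simp add: integral_diff C_def)
      have I1: "((\<lambda>t. \<sigma> 1 t) has_integral \<sigma> 0 T - \<sigma> 0 0) {0..T}"
      proof (rule fundamental_theorem_of_calculus)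
        show "0 \<le> T" using T by simp
        show "(\<sigma> 0 has_vector_derivative \<sigma> 1 x) (at x within {0..T})" for x
          using has_field_derivative_at_within[OF \<sigma>(1)[of 0 x]]
          by (simp add: has_real_derivative_iff_has_vector_derivative)
      qed
      then have I1: "((\<lambda>t. \<sigma> 1 t) has_integral 1) {0..T}" using \<sigma>(2)[of 0] \<sigma>(3)[of T] \<rho> by simp
      have "((\<lambda>t. complex_of_real (\<sigma> 1 t)) has_integral 1) {0..T}"
        using has_integral_linear[OF I1 bounded_linear_of_real[where 'a = complex]] by (simp add: o_def)
      then have hI: "((\<lambda>t. complex_of_real (\<sigma> 1 t) * u t0) has_integral 1 * u t0) {0..T}"
        by (rule has_integral_mult_left)
      have "C - u t0 = integral {0..T} (\<lambda>t. complex_of_real (\<sigma> 1 t) * u t - complex_of_real (\<sigma> 1 t) * u t0)"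
        using C\<sigma> integral_unique[OF hI] integral_diff[OF i(1,3)] by (simp only: mult_1_left)
      also have "norm \<dots> \<le> integral {0..T} (\<lambda>t. \<sigma> 1 t * e)"
      proof (rule Henstock_Kurzweil_Integration.integral_norm_bound_integral)
        show "(\<lambda>t. complex_of_real (\<sigma> 1 t) * u t - complex_of_real (\<sigma> 1 t) * u t0) integrable_on {0..T}"
          using i by (intro integrable_diff)
        show "(\<lambda>t. \<sigma> 1 t * e) integrable_on {0..T}" using I1 by (intro integrable_on_mult_left) (auto simp: has_integral_iff)
        fix \<tau> assume \<tau>: "\<tau> \<in> {0..T}"
        show "norm (complex_of_real (\<sigma> 1 \<tau>) * u \<tau> - complex_of_real (\<sigma> 1 \<tau>) * u t0) \<le> \<sigma> 1 \<tau> * e"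
        proof (cases "\<tau> \<in> {t0 - \<rho><..<t0 + \<rho>}")
          case True
          then have "norm (u \<tau> - u t0) \<le> e" using d(2)[OF \<tau>] \<rho>(2) by (auto simp: dist_norm abs_less_iff)
          then show ?thesis using \<sigma>(5)[of \<tau>]
            by (simp add: right_diff_distrib[symmetric] norm_mult mult_left_mono)
        next
          case False
          then have "\<sigma> 1 \<tau> = 0" using \<sigma>(4)[of \<tau> 0] by simp
          then show ?thesis by simp
        qed
      qed
      also have "\<dots> = e" using integral_unique[OF has_integral_mult_left[OF I1, of e]] by simp
      finally show ?thesis by simp
    qed
    then have "norm (C - u t0) \<le> 0" by (rule field_le_epsilon)
    then show ?thesis by simp
  qed
  have cl: "closure {0<..<T} = {0..T}" using T by (rule closure_greaterThanLessThan)
  have all: "u t = C" if "t \<in> {0..T}" for t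
    by (rule continuous_constant_on_closure[of "{0<..<T}" u C t]) (use u uC that cl in auto)
  show ?thesis using all[OF t] all[of 0] T by simp
qed

text \<open>Gronwall's argument: the energy |N|^2 + |Y|^2 + |V|^2 satisfies E' \<le> L E and starts
  from zero. The unknown N is the primitive of Y produced by the memory term.\<close>

lemma linear_ode_zero:
  fixes N Y V :: "real \<Rightarrow> complex" and a b :: real
  assumes N: "\<And>t. t \<in> {0..T} \<Longrightarrow> (N has_vector_derivative Y t) (at t within {0..T})"
    and Y: "\<And>t. t \<in> {0..T} \<Longrightarrow> (Y has_vector_derivative V t) (at t within {0..T})"
    and V: "\<And>t. t \<in> {0..T} \<Longrightarrow> (V has_vector_derivative a * Y t + b * N t) (at t within {0..T})"
    and 0: "N 0 = 0" "Y 0 = 0" "V 0 = 0" and t: "t \<in> {0..T}"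
  shows "Y t = 0 \<and> V t = 0"
proof (cases "t = 0")
  case False
  define E where "E t = N t \<bullet> N t + Y t \<bullet> Y t + V t \<bullet> V t" for t
  \<comment> \<open>The 2 accounts for the products of N with Y and of Y with V, the moduli of a and
    b for the right-hand side of the equation for V.\<close>
  define L where "L = 2 + \<bar>a\<bar> + \<bar>b\<bar>"
  define E' where "E' t = 2 * (N t \<bullet> Y t) + 2 * (Y t \<bullet> V t) + 2 * (V t \<bullet> (a * Y t + b * N t))" for t
  have dE: "(E has_real_derivative E' t) (at t within {0..T})" if "t \<in> {0..T}" for t
  proof -
    have d: "((\<lambda>t. F t \<bullet> F t) has_vector_derivative 2 * (F t \<bullet> F')) (at t within {0..T})"
      if "(F has_vector_derivative F') (at t within {0..T})" for F :: "real \<Rightarrow> complex" and F'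
    proof -
      have "((\<lambda>t. F t \<bullet> F t) has_vector_derivative (F t \<bullet> F' + F' \<bullet> F t)) (at t within {0..T})"
        by (rule bounded_bilinear.has_vector_derivative[OF bounded_bilinear_inner that that])
      then show ?thesis by (simp add: inner_commute)
    qed
    show ?thesis
      unfolding E_def[abs_def] E'_def has_real_derivative_iff_has_vector_derivative
      by (intro has_vector_derivative_add d N Y V that)
  qed
  have le: "E' t \<le> L * E t" for t
  proof -
    have in1: "2 * (x \<bullet> y) \<le> x \<bullet> x + y \<bullet> y" for x y :: complex
      using inner_ge_zero[of "x - y"] by (simp add: inner_diff inner_commute)
    have in2: "2 * (x \<bullet> (complex_of_real k * y)) \<le> \<bar>k\<bar> * (x \<bullet> x + y \<bullet> y)" for x y and k :: real
    proof -
      have "2 * (x \<bullet> y) \<le> x \<bullet> x + y \<bullet> y" "- (2 * (x \<bullet> y)) \<le> x \<bullet> x + y \<bullet> y"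
        using in1[of x y] in1[of x "- y"] by auto
      then have "\<bar>k\<bar> * \<bar>2 * (x \<bullet> y)\<bar> \<le> \<bar>k\<bar> * (x \<bullet> x + y \<bullet> y)" by (intro mult_left_mono) auto
      moreover have "2 * (x \<bullet> (complex_of_real k * y)) = k * (2 * (x \<bullet> y))"
        by (simp flip: scaleR_conv_of_real)
      moreover have "k * (2 * (x \<bullet> y)) \<le> \<bar>k\<bar> * \<bar>2 * (x \<bullet> y)\<bar>" by (metis abs_ge_self abs_mult)
      ultimately show ?thesis by linarith
    qed
    have nn: "N t \<bullet> N t \<ge> 0" "Y t \<bullet> Y t \<ge> 0" "V t \<bullet> V t \<ge> 0" by simp_all
    have "2 * (V t \<bullet> (a * Y t)) \<le> \<bar>a\<bar> * E t"
      by (rule order_trans[OF in2]) (use nn in \<open>auto simp: E_def intro!: mult_left_mono\<close>)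
    moreover have "2 * (V t \<bullet> (b * N t)) \<le> \<bar>b\<bar> * E t"
      by (rule order_trans[OF in2]) (use nn in \<open>auto simp: E_def intro!: mult_left_mono\<close>)
    moreover have "2 * (N t \<bullet> Y t) \<le> E t" "2 * (Y t \<bullet> V t) \<le> E t"
      unfolding E_def using in1[of "N t" "Y t"] in1[of "Y t" "V t"] nn by linarith+
    moreover have "E' t = 2 * (N t \<bullet> Y t) + 2 * (Y t \<bullet> V t) + (2 * (V t \<bullet> (a * Y t)) + 2 * (V t \<bullet> (b * N t)))"
      by (simp add: E'_def inner_add_right)
    moreover have "L * E t = E t + E t + (\<bar>a\<bar> * E t + \<bar>b\<bar> * E t)" by (simp add: L_def distrib_right)
    ultimately show ?thesis by linarith
  qed
  have t0: "0 < t" "t \<le> T" using False t by auto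
  have "E t * exp (- L * t) \<le> E 0 * exp (- L * 0)"
  proof (rule DERIV_nonpos_imp_decreasing_open[OF less_imp_le[OF t0(1)], of "\<lambda>t. E t * exp (- L * t)"])
    fix s assume s: "0 < s" "s < t"
    have "at s within {0..T} = at s" by (rule at_within_interior) (use s t0 in auto)
    then have "(E has_real_derivative E' s) (at s)" using dE[of s] s t0 by auto
    then have "((\<lambda>t. E t * exp (- L * t)) has_real_derivative (E' s - L * E s) * exp (- L * s)) (at s)"
      by (auto intro!: derivative_eq_intros simp: algebra_simps)
    moreover have "(E' s - L * E s) * exp (- L * s) \<le> 0" using le[of s] by (intro mult_nonpos_nonneg) auto
    ultimately show "\<exists>y. ((\<lambda>t. E t * exp (- L * t)) has_real_derivative y) (at s) \<and> y \<le> 0" by blast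
  next
    have "continuous_on {0..T} E"
      unfolding continuous_on_eq_continuous_within
      using dE DERIV_continuous by blast
    then have "continuous_on {0..t} E" by (rule continuous_on_subset) (use t0 in auto)
    then show "continuous_on {0..t} (\<lambda>t. E t * exp (- L * t))" by (intro continuous_intros)
  qed
  then have "E t \<le> 0" using 0 by (simp add: E_def mult_le_0_iff)
  then have "E t = 0" "N t \<bullet> N t \<ge> 0" "Y t \<bullet> Y t \<ge> 0" "V t \<bullet> V t \<ge> 0"
    by (auto simp: E_def intro!: antisym add_nonneg_nonneg)
  then have "Y t \<bullet> Y t = 0" "V t \<bullet> V t = 0" unfolding E_def by linarith+
  then show ?thesis by simp
qed (use 0 in simp)

text \<open>A Fourier coefficient of the difference satisfies its equation at first only as a
  distribution. By \<open>du_Bois_Reymond\<close> V + \<Gamma> is constant, where \<Gamma> is the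
  primitive of the lower-order terms; so V is differentiable and the differential equation holds
  classically.\<close>

lemma weak_solution_unique:
  assumes T: "T > 0" and ws: "weak_solution M T f y0 y1 y v" "weak_solution M T f y0 y1 z w" and t: "t \<in> {0..T}"
  shows "ae_eq (z t) (y t) \<and> ae_eq (w t) (v t)"
proof -
  have L: "y t \<in> L2p" "v t \<in> L2p" "z t \<in> L2p" "w t \<in> L2p" if "t \<in> {0..T}" for t
    using ws that by (auto simp: weak_solution_def C1_L2p_def C0_L2p_def)
  have L': "y t \<in> L2" "v t \<in> L2" "z t \<in> L2" "w t \<in> L2" if "t \<in> {0..T}" for t
    using L[OF that] by (auto simp: L2p_def)
  have coeff: "pair (z t) (expi k) = pair (y t) (expi k) \<and> pair (w t) (expi k) = pair (v t) (expi k)" for k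
  proof (cases "k = 0")
    case True
    \<comment> \<open>The constant mode is no admissible \<phi>, but its coefficient is zero for
      both solutions by the zero-mean condition.\<close>
    have "expi 0 = (\<lambda>x. 1)" by (auto simp: expi_0)
    then show ?thesis using True L[OF t] by (simp add: pair_def L2p_def)
  next
    case False
    note cy = weak_solution_coefficient[OF ws(1) False] and cz = weak_solution_coefficient[OF ws(2) False]
    define Y where "Y t = pair (z t) (expi k) - pair (y t) (expi k)" for t
    define V where "V t = pair (w t) (expi k) - pair (v t) (expi k)" for t
    define N where "N t = integral {0..t} Y" for t
    have dY: "(Y has_vector_derivative V t) (at t within {0..T})" if "t \<in> {0..T}" for t
      unfolding Y_def[abs_def] V_def by (intro has_vector_derivative_diff cy(1) cz(1) that)
    have Vc: "continuous_on {0..T} V" unfolding V_def[abs_def] by (intro continuous_intros cy(2) cz(2))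
    have Yc: "continuous_on {0..T} Y"
      unfolding continuous_on_eq_continuous_within using has_vector_derivative_continuous[OF dY] by blast
    have yc: "continuous_on {0..T} (\<lambda>t. pair (y t) (expi k))" "continuous_on {0..T} (\<lambda>t. pair (z t) (expi k))"
      unfolding continuous_on_eq_continuous_within
      using has_vector_derivative_continuous[OF cy(1)] has_vector_derivative_continuous[OF cz(1)] by blast+
    have dN: "(N has_vector_derivative Y t) (at t within {0..T})" if "t \<in> {0..T}" for t
      unfolding N_def[abs_def] by (rule integral_has_vector_derivative[OF Yc that])
    have Nc: "continuous_on {0..T} N"
      unfolding continuous_on_eq_continuous_within using has_vector_derivative_continuous[OF dN] by blast
    have Neq: "N t = integral {0..t} (\<lambda>t. pair (z t) (expi k)) - integral {0..t} (\<lambda>t. pair (y t) (expi k))" if "t \<in> {0..T}" for t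
      unfolding N_def Y_def[abs_def]
      by (rule integral_diff) (use that in \<open>auto intro!: integrable_continuous_real continuous_on_subset[OF yc(1)] continuous_on_subset[OF yc(2)]\<close>)
    define \<kappa> where "\<kappa> = (real_of_int k)\<^sup>2"
    have \<kappa>: "(of_int k)\<^sup>2 = complex_of_real \<kappa>" by (simp add: \<kappa>_def)
    \<comment> \<open>The equation of the difference is Y'' = - G in the sense of
      distributions.\<close>
    define G where "G t = complex_of_real \<kappa> * (Y t - M * N t)" for t
    have Gc: "continuous_on {0..T} G" unfolding G_def[abs_def] by (intro continuous_intros Yc Nc)
    define \<Gamma> where "\<Gamma> t = integral {0..t} G" for t
    have d\<Gamma>: "(\<Gamma> has_vector_derivative G t) (at t within {0..T})" if "t \<in> {0..T}" for t
      unfolding \<Gamma>_def[abs_def] by (rule integral_has_vector_derivative[OF Gc that])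
    have \<Gamma>c: "continuous_on {0..T} \<Gamma>"
      unfolding continuous_on_eq_continuous_within using has_vector_derivative_continuous[OF d\<Gamma>] by blast
    have orth: "integral {0..T} (\<lambda>t. nderiv 1 \<theta> t * (V t + \<Gamma> t)) = 0" if \<theta>: "test_fun T \<theta>" for \<theta>
    proof -
      have s: "smooth \<theta>" using \<theta> by (simp add: test_fun_def)
      have \<theta>c: "continuous_on A \<theta>" "continuous_on A (nderiv n \<theta>)" for A n
        using smooth_nderiv_continuous[OF s, of A 0] smooth_nderiv_continuous[OF s, of A n] by (simp_all add: nderiv_def)
      let ?I = "integral {0..T}"
      let ?y = "\<lambda>t. pair (y t) (expi k)" and ?z = "\<lambda>t. pair (z t) (expi k)"
      have ic: "continuous_on {0..T} (\<lambda>t. integral {0..t} ?y)" "continuous_on {0..T} (\<lambda>t. integral {0..t} ?z)"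
        by (intro indefinite_integral_continuous_1 integrable_continuous_real yc)+
      have e1: "?I (\<lambda>t. nderiv 2 \<theta> t * Y t) = ?I (\<lambda>t. nderiv 2 \<theta> t * ?z t) - ?I (\<lambda>t. nderiv 2 \<theta> t * ?y t)"
        unfolding Y_def right_diff_distrib
        by (intro integral_diff integrable_continuous_real continuous_intros \<theta>c yc)
      have e2: "?I (\<lambda>t. \<theta> t * Y t) = ?I (\<lambda>t. \<theta> t * ?z t) - ?I (\<lambda>t. \<theta> t * ?y t)"
        unfolding Y_def right_diff_distrib
        by (intro integral_diff integrable_continuous_real continuous_intros \<theta>c yc)
      have e3: "?I (\<lambda>t. \<theta> t * N t) = ?I (\<lambda>t. \<theta> t * integral {0..t} ?z) - ?I (\<lambda>t. \<theta> t * integral {0..t} ?y)"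
      proof -
        have "?I (\<lambda>t. \<theta> t * N t) = ?I (\<lambda>t. \<theta> t * integral {0..t} ?z - \<theta> t * integral {0..t} ?y)"
          by (rule Henstock_Kurzweil_Integration.integral_cong) (simp add: Neq right_diff_distrib)
        also have "\<dots> = ?I (\<lambda>t. \<theta> t * integral {0..t} ?z) - ?I (\<lambda>t. \<theta> t * integral {0..t} ?y)"
          by (intro integral_diff integrable_continuous_real continuous_intros \<theta>c ic)
        finally show ?thesis .
      qed
      have eqn: "?I (\<lambda>t. nderiv 2 \<theta> t * Y t) + of_real \<kappa> * ?I (\<lambda>t. \<theta> t * Y t) - of_real M * of_real \<kappa> * ?I (\<lambda>t. \<theta> t * N t) = 0"
        using cy(3)[OF \<theta>] cz(3)[OF \<theta>] unfolding e1 e2 e3 \<kappa> by (simp add: right_diff_distrib algebra_simps)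
      have GI: "?I (\<lambda>t. \<theta> t * G t) = of_real \<kappa> * ?I (\<lambda>t. \<theta> t * Y t) - of_real M * of_real \<kappa> * ?I (\<lambda>t. \<theta> t * N t)"
      proof -
        have i: "(\<lambda>t. \<theta> t * Y t) integrable_on {0..T}" "(\<lambda>t. \<theta> t * N t) integrable_on {0..T}"
          by (intro integrable_continuous_real continuous_intros \<theta>c Yc Nc)+
        have "((\<lambda>t. of_real \<kappa> * (\<theta> t * Y t) - of_real M * of_real \<kappa> * (\<theta> t * N t)) has_integral
          of_real \<kappa> * ?I (\<lambda>t. \<theta> t * Y t) - of_real M * of_real \<kappa> * ?I (\<lambda>t. \<theta> t * N t)) {0..T}"
          by (intro has_integral_diff has_integral_mult_right integrable_integral i)
        moreover have "(\<lambda>t. \<theta> t * G t) = (\<lambda>t. of_real \<kappa> * (\<theta> t * Y t) - of_real M * of_real \<kappa> * (\<theta> t * N t))"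
          by (simp add: G_def algebra_simps)
        ultimately show ?thesis by (simp only: integral_unique)
      qed
      have "?I (\<lambda>t. nderiv 2 \<theta> t * Y t) + ?I (\<lambda>t. \<theta> t * G t) = 0"
        unfolding GI using eqn by (simp only: add_diff_eq)
      moreover have "?I (\<lambda>t. nderiv 2 \<theta> t * Y t) = - ?I (\<lambda>t. nderiv 1 \<theta> t * V t)"
        using test_fun_by_parts[OF \<theta> less_imp_le[OF T] dY Vc, of 1] by (simp only: Suc_1)
      moreover have "?I (\<lambda>t. nderiv 1 \<theta> t * \<Gamma> t) = - ?I (\<lambda>t. \<theta> t * G t)"
        using test_fun_by_parts[OF \<theta> less_imp_le[OF T] d\<Gamma> Gc, of 0] by (simp add: nderiv_def)
      moreover have "?I (\<lambda>t. nderiv 1 \<theta> t * (V t + \<Gamma> t)) = ?I (\<lambda>t. nderiv 1 \<theta> t * V t) + ?I (\<lambda>t. nderiv 1 \<theta> t * \<Gamma> t)"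
        unfolding distrib_left by (intro integral_add integrable_continuous_real continuous_intros \<theta>c Vc \<Gamma>c)
      ultimately show ?thesis by (simp add: add_eq_0_iff)
    qed
    have 00: "0 \<in> {0..T}" using T by simp
    have init: "AE x in torus_measure. z 0 x = y 0 x" "AE x in torus_measure. w 0 x = v 0 x"
    proof -
      have "ae_eq (y 0) y0" "ae_eq (z 0) y0" "ae_eq (v 0) y1" "ae_eq (w 0) y1"
        using ws by (auto simp: weak_solution_def)
      note a = ae_eq_torusD[OF this(1)] ae_eq_torusD[OF this(2)] ae_eq_torusD[OF this(3)] ae_eq_torusD[OF this(4)]
      show "AE x in torus_measure. z 0 x = y 0 x" using a(1,2) by eventually_elim simp
      show "AE x in torus_measure. w 0 x = v 0 x" using a(3,4) by eventually_elim simp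
    qed
    have em: "expi k \<in> borel_measurable torus_measure"
      by (rule continuous_imp_measurable_on_sets_lebesgue[OF expi_continuous]) simp
    have Y0: "Y 0 = 0"
      using LINT_cong_ae_eq[OF init(1) L2_D(2)[OF L'(3)[OF 00]] L2_D(2)[OF L'(1)[OF 00]] em] by (simp add: Y_def pair_def)
    have V0: "V 0 = 0"
      using LINT_cong_ae_eq[OF init(2) L2_D(2)[OF L'(4)[OF 00]] L2_D(2)[OF L'(2)[OF 00]] em] by (simp add: V_def pair_def)
    have N0: "N 0 = 0" "\<Gamma> 0 = 0" by (simp_all add: N_def \<Gamma>_def)
    have V\<Gamma>: "V t = - \<Gamma> t" if "t \<in> {0..T}" for t
    proof -
      have "V t + \<Gamma> t = V 0 + \<Gamma> 0"
        by (rule du_Bois_Reymond[OF T _ orth that]) (intro continuous_intros Vc \<Gamma>c)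
      then show ?thesis using V0 N0 by (simp add: add_eq_0_iff2)
    qed
    have dV: "(V has_vector_derivative (- \<kappa>) * Y t + (\<kappa> * M) * N t) (at t within {0..T})" if "t \<in> {0..T}" for t
    proof -
      have d: "((\<lambda>t. - \<Gamma> t) has_vector_derivative - G t) (at t within {0..T})"
        by (intro has_vector_derivative_minus d\<Gamma> that)
      have "(V has_vector_derivative - G t) (at t within {0..T})"
        by (rule has_vector_derivative_transform[OF that _ d]) (simp add: V\<Gamma>)
      then show ?thesis by (simp add: G_def algebra_simps)
    qed
    have "Y t = 0 \<and> V t = 0" by (rule linear_ode_zero[OF dN dY dV N0(1) Y0 V0 t])
    then show ?thesis by (simp add: Y_def V_def)
  qed
  have ae: "ae_eq F G" if FG: "F \<in> L2" "G \<in> L2" "\<And>k. pair F (expi k) = pair G (expi k)" for F G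
  proof (rule ae_eq_torusI[OF _ L2_D(1)[OF FG(1)] L2_D(1)[OF FG(2)]])
    have "AE x in torus_measure. F x - G x = 0"
    proof (rule Fourier_uniqueness)
      show "integrable torus_measure (\<lambda>x. F x - G x)" by (rule L2_integrable[OF L2_diff[OF FG(1,2)]])
      fix k
      have "pair (\<lambda>x. F x - G x) (expi k) = 0" using pair_expi_diff[OF FG(1,2)] FG(3) by simp
      then show "(LINT x|torus_measure. (F x - G x) * cis (of_int k * x)) = 0"
        by (simp add: pair_def expi_def)
    qed
    then show "AE x in torus_measure. F x = G x" by simp
  qed
  show ?thesis using ae[OF L'(3)[OF t] L'(1)[OF t]] ae[OF L'(4)[OF t] L'(2)[OF t]] coeff by blast
qed

subsection \<open>Null controllability\<close>

lemma continuous_in_L2_region: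
  assumes F: "continuous_on UNIV F" "open Q" and "x_periodic F" "Q \<subseteq> {0..T} \<times> UNIV"
  shows "(\<lambda>t x. F (t, x)) \<in> L2_region Q"
proof -
  let ?B = "cbox (0, -pi) (T, pi)" and ?Q = "Q \<inter> UNIV \<times> {-pi..pi}"
  have c: "continuous_on A F" for A by (rule continuous_on_subset[OF F(1)]) simp
  have Q: "?Q \<in> sets lebesgue" "?Q \<subseteq> ?B"
    using assms(2,4) by (auto simp: borel_open closed_Times borel_closed intro!: sets.Int)
  have "(\<lambda>X. (cmod (F X))\<^sup>2) absolutely_integrable_on ?B"
    by (rule absolutely_integrable_continuous) (intro continuous_intros c)
  then have "(\<lambda>X. (cmod (F X))\<^sup>2) absolutely_integrable_on ?Q"
    by (rule set_integrable_subset) (use Q in auto)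
  then have "integrable (lebesgue_on ?Q) (\<lambda>X. (cmod (F X))\<^sup>2)"
    using Q(1) by (simp add: set_integrable_def integrable_restrict_space)
  moreover have "F \<in> borel_measurable (lebesgue_on ?Q)"
    by (rule continuous_imp_measurable_on_sets_lebesgue[OF c Q(1)])
  ultimately show ?thesis
    using assms(3) by (auto simp: L2_region_def x_periodic_def split_def)
qed

theorem theorem2p3:
  fixes M c T :: real and W :: "real set" and y0 y1 :: "real \<Rightarrow> complex"
  assumes "M \<noteq> 0"
    and "c \<notin> {-1, 0, 1}"
    and "T > 2 * pi * (1 / \<bar>c\<bar> + 1 / \<bar>1 - c\<bar> + 1 / \<bar>1 + c\<bar>)"
    and "torus_set W" and "open W" and "W \<noteq> {}"
    and "y0 \<in> Hp 3" and "y1 \<in> Hp 2"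
  shows "\<exists>u \<in> L2_region (control_region W c T).
    (\<forall>t\<in>{0<..<T}. has_bochner_integral (lebesgue_on {-pi..pi}) (extend0 (moving W c) u t) 0) \<and>
    (\<exists>y v. weak_solution M T (extend0 (moving W c) u) y0 y1 y v \<and>
       (\<forall>z w. weak_solution M T (extend0 (moving W c) u) y0 y1 z w \<longrightarrow>
          (\<forall>t\<in>{0..T}. ae_eq (z t) (y t) \<and> ae_eq (w t) (v t))) \<and>
       ae_eq (y T) (\<lambda>x. 0) \<and> ae_eq (v T) (\<lambda>x. 0) \<and>
       eq_Hm1 (int_Hm1 0 T (\<lambda>s. Dxx (y s))) (\<lambda>\<phi>. 0))"
proof -
  have "y0 \<in> Hp 2" using assms(7) by (auto simp: Hp_def)
  then obtain Y0 Y0' where Y0: "\<And>x. (Y0 has_vector_derivative Y0' x) (at x)" "continuous_on UNIV Y0'"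
      "periodic Y0" "periodic Y0'" "ae_eq y0 Y0" "integral {-pi..pi} Y0 = 0"
    by (rule Hp2_representative) (rule that)
  obtain Y1 Y1' where Y1: "\<And>x. (Y1 has_vector_derivative Y1' x) (at x)" "continuous_on UNIV Y1'"
      "periodic Y1" "periodic Y1'" "ae_eq y1 Y1" "integral {-pi..pi} Y1 = 0"
    by (rule Hp2_representative[OF assms(8)]) (rule that)
  have Yc: "continuous_on UNIV Y0" "continuous_on UNIV Y1"
    using has_vector_derivative_continuous[OF Y0(1)] has_vector_derivative_continuous[OF Y1(1)]
    by (simp_all add: continuous_at_imp_continuous_on)
  obtain K0 where K0: "\<And>x. norm (Y0 x) \<le> K0" by (rule periodic_bounded[OF Yc(1) Y0(3)]) (rule that)
  obtain K0' where K0': "\<And>x. norm (Y0' x) \<le> K0'" by (rule periodic_bounded[OF Y0(2,4)]) (rule that)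
  obtain K1 where K1: "\<And>x. norm (Y1 x) \<le> K1" by (rule periodic_bounded[OF Yc(2) Y1(3)]) (rule that)
  obtain K1' where K1': "\<And>x. norm (Y1' x) \<le> K1'" by (rule periodic_bounded[OF Y1(2,4)]) (rule that)
  define K where "K = max (max K0 K0') (max K1 K1')"
  have bd: "norm (Y0 x) \<le> K" "norm (Y0' x) \<le> K" "norm (Y1 x) \<le> K" "norm (Y1' x) \<le> K" for x
    unfolding K_def using K0[of x] K0'[of x] K1[of x] K1'[of x] by (simp_all add: le_max_iff_disj)
  obtain x0 where "x0 \<in> W" using assms(6) by blast
  with assms(5) obtain \<epsilon> where \<epsilon>: "\<epsilon> > 0" "ball x0 \<epsilon> \<subseteq> W" by (rule openE)
  \<comment> \<open>The construction takes an interval with left end x0; the right half of a ball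
    inside W serves.\<close>
  have sub: "{x0<..<x0 + \<epsilon>} \<subseteq> W" using \<epsilon>(2) by (rule order_trans[rotated]) (auto simp: dist_real_def)
  obtain \<delta> z y p v q r h k l f where \<delta>: "0 < \<delta>" "\<delta> < T"
    and S: "strong_sol M z y p v q r h k l f"
    and xp: "\<forall>F\<in>{z, y, p, v, q, r, h, k, l, f}. x_periodic F"
    and init: "\<And>x. z (0, x) = 0 \<and> y (0, x) = Y0 x \<and> v (0, x) = Y1 x"
    and fin: "\<And>t x. T - \<delta> < t \<Longrightarrow> z (t, x) = 0"
    and supp: "\<And>t x. f (t, x) \<noteq> 0 \<Longrightarrow> x + c * t \<in> W"
    and mean: "\<And>t. integral {-pi..pi} (\<lambda>x. z (t, x)) = 0"
    by (rule controlled_solution[where M = M, OF assms(2,3) Y0(1,2) Y1(1,2) bd Y0(3) Y1(3) Y0(6) Y1(6)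
          assms(4) sub \<epsilon>(1)]) (rule that)
  have T: "T > 0" using \<delta> by simp
  have C: "C1 z y p" "C1 y v q" "C1 h k l"
    and f: "f = (\<lambda>X. k X - complex_of_real M * h X + complex_of_real M ^ 3 * z X)"
    using S by (auto simp: strong_sol_def)
  have fc: "continuous_on UNIV f"
    unfolding f by (intro continuous_intros C1_continuous[OF C(1)] C1_continuous[OF C(3)] C1_continuous_partials(1)[OF C(3)])
  have m: "x \<in> moving W c t \<longleftrightarrow> x + c * t \<in> W" for t x
    by (auto simp: moving_def image_iff intro!: bexI[of _ "x + c * t"])
  define u where "u t x = f (t, x)" for t x
  \<comment> \<open>The classical source already vanishes outside the moving set, so extension by
    zero does not change it and u can be f itself.\<close>
  have ext: "extend0 (moving W c) u = (\<lambda>t x. f (t, x))"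
    using supp by (auto simp: extend0_def u_def fun_eq_iff indicator_def m)
  have y0: "ae_eq (\<lambda>x. y (0, x)) y0" "ae_eq (\<lambda>x. v (0, x)) y1"
    using Y0(5) Y1(5) unfolding ae_eq_def by (eventually_elim; simp add: init)+
  have zT: "z (T, x) = 0" for x by (rule fin) (use \<delta> in simp)
  note ws = strong_sol_weak_solution[OF S less_imp_le[OF T] xp conjunct1[OF init] mean zT y0]
  have op: "open {X :: real \<times> real. T - \<delta> < fst X}" by (intro open_Collect_less continuous_intros)
  \<comment> \<open>z vanishes on an open half-plane containing the line t = T, so its time
    derivatives vanish on that line as well.\<close>
  have yfin: "y X = 0" if "T - \<delta> < fst X" for X
    by (rule C1_unique(1)[OF C(1) C1_const[of 0] op]) (use that fin in auto)
  have vfin: "v X = 0" if "T - \<delta> < fst X" for X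
    by (rule C1_unique(1)[OF C(2) C1_const[of 0] op]) (use that yfin in auto)
  show ?thesis
  proof (rule bexI[of _ u], rule conjI[OF _ exI[of _ "\<lambda>t x. y (t, x)", OF exI[of _ "\<lambda>t x. v (t, x)"]]];
      (intro conjI ballI allI impI)?)
    show "has_bochner_integral (lebesgue_on {-pi..pi}) (extend0 (moving W c) u t) 0" for t
      unfolding ext has_bochner_integral_iff
      using integrable_torus_continuous[OF continuous_on_slice(2)[OF fc, of _ t]] ws(3)[of t] by simp
    show "weak_solution M T (extend0 (moving W c) u) y0 y1 (\<lambda>t x. y (t, x)) (\<lambda>t x. v (t, x))"
      unfolding ext by (rule ws(1))
    show "ae_eq (z' t) (\<lambda>x. y (t, x))" "ae_eq (w t) (\<lambda>x. v (t, x))"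
      if "weak_solution M T (extend0 (moving W c) u) y0 y1 z' w" "t \<in> {0..T}" for z' w t
      using weak_solution_unique[OF T ws(1) that(1)[unfolded ext] that(2)] by blast+
    show "ae_eq (\<lambda>x. y (T, x)) (\<lambda>x. 0)" "ae_eq (\<lambda>x. v (T, x)) (\<lambda>x. 0)"
      using \<delta> by (simp_all add: yfin vfin ae_eq_def)
    show "eq_Hm1 (int_Hm1 0 T (\<lambda>s. Dxx (\<lambda>x. y (s, x)))) (\<lambda>\<phi>. 0)" by (rule ws(2))
    \<comment> \<open>Described through x + c t, the region is an intersection of open
      preimages.\<close>
    have "control_region W c T = {X. 0 < fst X} \<inter> {X. fst X < T} \<inter> (\<lambda>X. snd X + c * fst X) -` W"
      by (auto simp: control_region_def m)
    moreover have "open \<dots>"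
      by (intro open_Int open_vimage assms(5) open_Collect_less continuous_intros)
    ultimately have "open (control_region W c T)" by simp
    then show "u \<in> L2_region (control_region W c T)"
      unfolding u_def[abs_def]
      by (rule continuous_in_L2_region[where T = T, OF fc]) (use xp in \<open>auto simp: control_region_def\<close>)
  qed
qed

end
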